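(* Let $(M,\mathcal P)$ be an almost para-quaternionic manifold of dimension $4m\ge 8$. Suppose one of the following situations holds: (1) there are two globally defined, independent, compatible, (integrable) complex or para-complex structures $I_1$ and $I_2$ on $(M,\mathcal P)$ such that either $I_1$ or $I_2$ is a complex structure; (2) there are two globally defined, independent, compatible, (integrable) para-complex structures $I_1$ and $I_2$ on $(M,\mathcal P)$ such that at any $p\in M$ the $2$-plane $\mathrm{Span}\{I_1(p),I_2(p)\}\subset\mathcal P_p$ is non-degenerate with respect to the standard Lorentzian metric $\langle\cdot,\cdot\rangle$ of $\mathcal P$; (3) there are three globally defined, pairwise independent, compatible, (integrable) para-complex structures $I_1,I_2,I_3$ on $(M,\mathcal P)$ such that at any $p\in M$ the endomorphisms $I_1(p),I_2(p),I_3(p)$ are linearly dependent and for any $i\ne j$ the $2$-plane $\mathrm{Span}\{I_i(p),I_j(p)\}$ is degenerate with respect to $\langle\cdot,\cdot\rangle$. Then $(M,\mathcal P)$ is para-quaternionic.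
   Context: For $\epsilon\in\{-1,1\}$, an almost $\epsilon$-complex structure on a smooth manifold $M$ is an endomorphism $J$ of $TM$ with $J^2=\epsilon\,\mathrm{Id}$ and, when $\epsilon=1$, such that $\mathrm{Ker}(J-\mathrm{Id})$ and $\mathrm{Ker}(J+\mathrm{Id})$ have the same rank. It is called almost complex if $\epsilon=-1$ and almost para-complex if $\epsilon=1$. It is integrable (and then called complex, respectively para-complex) if its Nijenhuis tensor $N_J(X,Y)=\epsilon[X,Y]+[JX,JY]-J([JX,Y]+[X,JY])$ vanishes. An almost para-quaternionic structure on a smooth manifold $M$ of dimension $4m\ge 8$ is a rank three sub-bundle $\mathcal P\subset\mathrm{End}(TM)$ locally spanned by triples $\{J_1,J_2,J_3\}$ (called admissible bases of $\mathcal P$) where $J_1$ is an almost complex structure, $J_2$ and $J_3$ are anti-commuting almost para-complex structures and $J_3=J_1J_2$. The standard Lorentzian metric on $\mathcal P$ is defined in terms of an admissible basis by $\langle\sum_i a_iJ_i,\sum_j b_jJ_j\rangle=-a_1b_1+a_2b_2+a_3b_3$ (independent of the admissible basis). A para-quaternionic connection on $(M,\mathcal P)$ is a linear connection on $M$ which preserves $\mathcal P$. $(M,\mathcal P)$ (or $\mathcal P$) is para-quaternionic if it admits a torsion-free para-quaternionic connection. An almost complex or almost para-complex structure is compatible with $\mathcal P$ if it is a section of $\mathcal P$. Two such structures $I_i,I_j$ are independent if $I_i(p)\ne\pm I_j(p)$ at every point $p$. *)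

theory Defs
  imports "HOL-Analysis.Analysis" "HOL-Library.Function_Algebras"
begin

text \<open>
  Functions with values in a real vector space form a real vector space under pointwise operations.
  Tangent vectors, their endomorphisms and vector fields below are all functions of this kind, so that
  the library's \<^const>\<open>subspace\<close>, \<^const>\<open>span\<close>, \<^const>\<open>dim\<close> and \<^const>\<open>dependent\<close> apply to them.
\<close>

instantiation "fun" :: (type, scaleR) scaleR
begin

definition scaleR_fun :: "real \<Rightarrow> ('a \<Rightarrow> 'b) \<Rightarrow> 'a \<Rightarrow> 'b" where
  "scaleR_fun c f = (\<lambda>x. c *\<^sub>R f x)"

instance ..

end

instance "fun" :: (type, real_vector) real_vector
  by standard (simp_all add: scaleR_fun_def plus_fun_def fun_eq_iff scaleR_add_right scaleR_add_left)


section \<open>Smooth manifolds\<close>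

text \<open>On open subsets of a Euclidean space this is the usual class of \<open>k\<close> times continuously
  differentiable maps.\<close>

primrec Ck_on :: "nat \<Rightarrow> ('v::real_normed_vector \<Rightarrow> 'w::real_normed_vector) \<Rightarrow> 'v set \<Rightarrow> bool" where
  "Ck_on 0 f S \<longleftrightarrow> continuous_on S f"
| "Ck_on (Suc k) f S \<longleftrightarrow>
     (\<forall>x\<in>S. f differentiable (at x)) \<and>
     (\<forall>v. Ck_on k (\<lambda>x. frechet_derivative f (at x) v) S)"

definition smooth_on :: "('v::real_normed_vector \<Rightarrow> 'w::real_normed_vector) \<Rightarrow> 'v set \<Rightarrow> bool" where
  "smooth_on f S \<longleftrightarrow> (\<forall>k. Ck_on k f S)"

type_synonym ('a, 'n) chart = "'a set \<times> ('a \<Rightarrow> real ^ 'n)"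

text \<open>The manifold is a whole type \<open>'a\<close>, equipped with its topology and with a smooth atlas modelled on
  \<open>real ^ 'n\<close>; the topology is required to be Hausdorff and second countable by the sort of \<open>'a\<close>.\<close>

definition smooth_atlas :: "('a::{t2_space,second_countable_topology}, 'n::finite) chart set \<Rightarrow> bool" where
  "smooth_atlas \<A> \<longleftrightarrow>
     (\<Union>(U, \<phi>)\<in>\<A>. U) = UNIV \<and>
     (\<forall>(U, \<phi>)\<in>\<A>. open U \<and> open (\<phi> ` U) \<and> inj_on \<phi> U \<and>
        homeomorphism U (\<phi> ` U) \<phi> (inv_into U \<phi>)) \<and>
     (\<forall>(U, \<phi>)\<in>\<A>. \<forall>(V, \<psi>)\<in>\<A>. smooth_on (\<psi> \<circ> inv_into U \<phi>) (\<phi> ` (U \<inter> V)))"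

definition smooth_fun_on ::
  "('a::{t2_space,second_countable_topology}, 'n::finite) chart set \<Rightarrow> 'a set \<Rightarrow> ('a \<Rightarrow> real) \<Rightarrow> bool" where
  "smooth_fun_on \<A> W f \<longleftrightarrow> (\<forall>(U, \<phi>)\<in>\<A>. smooth_on (f \<circ> inv_into U \<phi>) (\<phi> ` (U \<inter> W)))"

definition smooth_funs ::
  "('a::{t2_space,second_countable_topology}, 'n::finite) chart set \<Rightarrow> ('a \<Rightarrow> real) set" where
  "smooth_funs \<A> = {f. smooth_fun_on \<A> UNIV f}"


section \<open>Tangent vectors, vector fields and endomorphisms\<close>

type_synonym 'a tvec = "('a \<Rightarrow> real) \<Rightarrow> real"
type_synonym 'a tend = "'a tvec \<Rightarrow> 'a tvec"

text \<open>Tangent vectors at \<open>p\<close> are the derivations at \<open>p\<close> of the algebra of smooth functions. They are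
  extended by \<open>0\<close> to functions that are not smooth, so that equality of tangent vectors is equality in HOL.\<close>

definition tangent_space ::
  "('a::{t2_space,second_countable_topology}, 'n::finite) chart set \<Rightarrow> 'a \<Rightarrow> 'a tvec set" where
  "tangent_space \<A> p = {v.
     (\<forall>f\<in>smooth_funs \<A>. \<forall>g\<in>smooth_funs \<A>. v (f + g) = v f + v g) \<and>
     (\<forall>c. \<forall>f\<in>smooth_funs \<A>. v (c *\<^sub>R f) = c * v f) \<and>
     (\<forall>f\<in>smooth_funs \<A>. \<forall>g\<in>smooth_funs \<A>. v (f * g) = f p * v g + g p * v f) \<and>
     (\<forall>f. f \<notin> smooth_funs \<A> \<longrightarrow> v f = 0)}"

text \<open>Elements of \<open>End(T\<^sub>pM)\<close> are likewise extended by \<open>0\<close> outside \<open>T\<^sub>pM\<close>.\<close>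

definition tangent_end ::
  "('a::{t2_space,second_countable_topology}, 'n::finite) chart set \<Rightarrow> 'a \<Rightarrow> 'a tend set" where
  "tangent_end \<A> p = {E.
     (\<forall>v\<in>tangent_space \<A> p. E v \<in> tangent_space \<A> p) \<and>
     (\<forall>v\<in>tangent_space \<A> p. \<forall>w\<in>tangent_space \<A> p. E (v + w) = E v + E w) \<and>
     (\<forall>c. \<forall>v\<in>tangent_space \<A> p. E (c *\<^sub>R v) = c *\<^sub>R E v) \<and>
     (\<forall>v. v \<notin> tangent_space \<A> p \<longrightarrow> E v = 0)}"

definition vector_fields ::
  "('a::{t2_space,second_countable_topology}, 'n::finite) chart set \<Rightarrow> ('a \<Rightarrow> 'a tvec) set" where
  "vector_fields \<A> = {X. (\<forall>p. X p \<in> tangent_space \<A> p) \<and>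
     (\<forall>f\<in>smooth_funs \<A>. (\<lambda>p. X p f) \<in> smooth_funs \<A>)}"

definition lie_bracket :: "('a \<Rightarrow> 'a tvec) \<Rightarrow> ('a \<Rightarrow> 'a tvec) \<Rightarrow> 'a \<Rightarrow> 'a tvec" where
  "lie_bracket X Y = (\<lambda>p f. X p (\<lambda>q. Y q f) - Y p (\<lambda>q. X q f))"

definition fscale :: "('a \<Rightarrow> real) \<Rightarrow> ('a \<Rightarrow> 'a tvec) \<Rightarrow> 'a \<Rightarrow> 'a tvec" where
  "fscale f X = (\<lambda>p. f p *\<^sub>R X p)"

definition app :: "('a \<Rightarrow> 'a tend) \<Rightarrow> ('a \<Rightarrow> 'a tvec) \<Rightarrow> 'a \<Rightarrow> 'a tvec" where
  "app J X = (\<lambda>p. J p (X p))"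

text \<open>Smooth sections of \<open>End(TM)\<close> over an open set \<open>U\<close>.\<close>

definition smooth_end_on ::
  "('a::{t2_space,second_countable_topology}, 'n::finite) chart set \<Rightarrow> 'a set \<Rightarrow> ('a \<Rightarrow> 'a tend) \<Rightarrow> bool" where
  "smooth_end_on \<A> U J \<longleftrightarrow> (\<forall>p\<in>U. J p \<in> tangent_end \<A> p) \<and>
     (\<forall>X\<in>vector_fields \<A>. \<forall>f\<in>smooth_funs \<A>. smooth_fun_on \<A> U (\<lambda>p. app J X p f))"


section \<open>Complex and para-complex structures\<close>

definition almost_eps_complex_on ::
  "('a::{t2_space,second_countable_topology}, 'n::finite) chart set \<Rightarrow> 'a set \<Rightarrow> real \<Rightarrow> ('a \<Rightarrow> 'a tend) \<Rightarrow> bool" where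
  "almost_eps_complex_on \<A> U \<epsilon> J \<longleftrightarrow> \<epsilon> \<in> {-1, 1} \<and> smooth_end_on \<A> U J \<and>
     (\<forall>p\<in>U. \<forall>v\<in>tangent_space \<A> p. J p (J p v) = \<epsilon> *\<^sub>R v) \<and>
     (\<epsilon> = 1 \<longrightarrow> (\<forall>p\<in>U. dim {v \<in> tangent_space \<A> p. J p v = v} =
                         dim {v \<in> tangent_space \<A> p. J p v = - v}))"

definition nijenhuis ::
  "real \<Rightarrow> ('a \<Rightarrow> 'a tend) \<Rightarrow> ('a \<Rightarrow> 'a tvec) \<Rightarrow> ('a \<Rightarrow> 'a tvec) \<Rightarrow> 'a \<Rightarrow> 'a tvec" where
  "nijenhuis \<epsilon> J X Y =
     \<epsilon> *\<^sub>R lie_bracket X Y + lie_bracket (app J X) (app J Y)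
     - app J (lie_bracket (app J X) Y + lie_bracket X (app J Y))"

text \<open>Integrable structures: complex for \<open>\<epsilon> = -1\<close>, para-complex for \<open>\<epsilon> = 1\<close>.\<close>

definition eps_complex ::
  "('a::{t2_space,second_countable_topology}, 'n::finite) chart set \<Rightarrow> real \<Rightarrow> ('a \<Rightarrow> 'a tend) \<Rightarrow> bool" where
  "eps_complex \<A> \<epsilon> J \<longleftrightarrow> almost_eps_complex_on \<A> UNIV \<epsilon> J \<and>
     (\<forall>X\<in>vector_fields \<A>. \<forall>Y\<in>vector_fields \<A>. nijenhuis \<epsilon> J X Y = 0)"

abbreviation complex_structure ::
  "('a::{t2_space,second_countable_topology}, 'n::finite) chart set \<Rightarrow> ('a \<Rightarrow> 'a tend) \<Rightarrow> bool" where
  "complex_structure \<A> J \<equiv> eps_complex \<A> (-1) J"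

abbreviation para_complex_structure ::
  "('a::{t2_space,second_countable_topology}, 'n::finite) chart set \<Rightarrow> ('a \<Rightarrow> 'a tend) \<Rightarrow> bool" where
  "para_complex_structure \<A> J \<equiv> eps_complex \<A> 1 J"


section \<open>Para-quaternionic structures\<close>

text \<open>Compositions below are compositions in \<open>End(T\<^sub>pM)\<close>: elements of \<^const>\<open>tangent_end\<close> are closed under
  \<open>\<circ>\<close> and under the pointwise vector space operations.\<close>

definition admissible_basis_on ::
  "('a::{t2_space,second_countable_topology}, 'n::finite) chart set \<Rightarrow> ('a \<Rightarrow> 'a tend set) \<Rightarrow> 'a set \<Rightarrow>
     ('a \<Rightarrow> 'a tend) \<Rightarrow> ('a \<Rightarrow> 'a tend) \<Rightarrow> ('a \<Rightarrow> 'a tend) \<Rightarrow> bool" where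
  "admissible_basis_on \<A> \<P> U J1 J2 J3 \<longleftrightarrow>
     almost_eps_complex_on \<A> U (-1) J1 \<and>
     almost_eps_complex_on \<A> U 1 J2 \<and>
     almost_eps_complex_on \<A> U 1 J3 \<and>
     (\<forall>p\<in>U. J2 p \<circ> J3 p = - (J3 p \<circ> J2 p) \<and> J3 p = J1 p \<circ> J2 p \<and>
            \<P> p = span {J1 p, J2 p, J3 p})"

definition almost_para_quaternionic ::
  "('a::{t2_space,second_countable_topology}, 'n::finite) chart set \<Rightarrow> ('a \<Rightarrow> 'a tend set) \<Rightarrow> bool" where
  "almost_para_quaternionic \<A> \<P> \<longleftrightarrow>
     (\<forall>p. dim (\<P> p) = 3) \<and>
     (\<forall>p. \<exists>U J1 J2 J3. open U \<and> p \<in> U \<and> admissible_basis_on \<A> \<P> U J1 J2 J3)"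

text \<open>The standard Lorentzian metric of \<open>\<P>\<^sub>p\<close>; it is meant for arguments in \<open>\<P>\<^sub>p\<close>, where the value does not
  depend on the admissible basis and the description is therefore unique.\<close>

definition lorentz ::
  "('a::{t2_space,second_countable_topology}, 'n::finite) chart set \<Rightarrow> ('a \<Rightarrow> 'a tend set) \<Rightarrow> 'a \<Rightarrow>
     'a tend \<Rightarrow> 'a tend \<Rightarrow> real" where
  "lorentz \<A> \<P> p A B = (THE r. \<exists>U J1 J2 J3 a1 a2 a3 b1 b2 b3.
     open U \<and> p \<in> U \<and> admissible_basis_on \<A> \<P> U J1 J2 J3 \<and>
     A = a1 *\<^sub>R J1 p + a2 *\<^sub>R J2 p + a3 *\<^sub>R J3 p \<and>
     B = b1 *\<^sub>R J1 p + b2 *\<^sub>R J2 p + b3 *\<^sub>R J3 p \<and>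
     r = - a1 * b1 + a2 * b2 + a3 * b3)"

definition nondegenerate_at ::
  "('a::{t2_space,second_countable_topology}, 'n::finite) chart set \<Rightarrow> ('a \<Rightarrow> 'a tend set) \<Rightarrow> 'a \<Rightarrow>
     'a tend set \<Rightarrow> bool" where
  "nondegenerate_at \<A> \<P> p W \<longleftrightarrow>
     (\<forall>A\<in>W. (\<forall>B\<in>W. lorentz \<A> \<P> p A B = 0) \<longrightarrow> A = 0)"

definition compatible :: "('a \<Rightarrow> 'a tend set) \<Rightarrow> ('a \<Rightarrow> 'a tend) \<Rightarrow> bool" where
  "compatible \<P> I \<longleftrightarrow> (\<forall>p. I p \<in> \<P> p)"

definition independent_structures :: "('a \<Rightarrow> 'a tend) \<Rightarrow> ('a \<Rightarrow> 'a tend) \<Rightarrow> bool" where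
  "independent_structures I J \<longleftrightarrow> (\<forall>p. I p \<noteq> J p \<and> I p \<noteq> - J p)"


section \<open>Connections\<close>

definition linear_connection ::
  "('a::{t2_space,second_countable_topology}, 'n::finite) chart set \<Rightarrow>
     (('a \<Rightarrow> 'a tvec) \<Rightarrow> ('a \<Rightarrow> 'a tvec) \<Rightarrow> 'a \<Rightarrow> 'a tvec) \<Rightarrow> bool" where
  "linear_connection \<A> D \<longleftrightarrow>
     (\<forall>X\<in>vector_fields \<A>. \<forall>Y\<in>vector_fields \<A>. D X Y \<in> vector_fields \<A>) \<and>
     (\<forall>X\<in>vector_fields \<A>. \<forall>Y\<in>vector_fields \<A>. \<forall>Z\<in>vector_fields \<A>.
        D (X + Y) Z = D X Z + D Y Z \<and> D X (Y + Z) = D X Y + D X Z) \<and>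
     (\<forall>f\<in>smooth_funs \<A>. \<forall>X\<in>vector_fields \<A>. \<forall>Y\<in>vector_fields \<A>.
        D (fscale f X) Y = fscale f (D X Y) \<and>
        D X (fscale f Y) = fscale (\<lambda>p. X p f) Y + fscale f (D X Y))"

definition sections ::
  "('a::{t2_space,second_countable_topology}, 'n::finite) chart set \<Rightarrow> ('a \<Rightarrow> 'a tend set) \<Rightarrow>
     ('a \<Rightarrow> 'a tend) set" where
  "sections \<A> \<P> = {S. smooth_end_on \<A> UNIV S \<and> (\<forall>p. S p \<in> \<P> p)}"

text \<open>The connection induced on \<open>End(TM)\<close> is \<open>(D\<^sub>X S) Y = D\<^sub>X (S Y) - S (D\<^sub>X Y)\<close>; \<open>D\<close> preserves \<open>\<P>\<close> if
  \<open>D\<^sub>X S\<close> is a section \<open>S'\<close> of \<open>\<P>\<close> whenever \<open>S\<close> is one.\<close>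

definition preserves ::
  "('a::{t2_space,second_countable_topology}, 'n::finite) chart set \<Rightarrow> ('a \<Rightarrow> 'a tend set) \<Rightarrow>
     (('a \<Rightarrow> 'a tvec) \<Rightarrow> ('a \<Rightarrow> 'a tvec) \<Rightarrow> 'a \<Rightarrow> 'a tvec) \<Rightarrow> bool" where
  "preserves \<A> \<P> D \<longleftrightarrow>
     (\<forall>X\<in>vector_fields \<A>. \<forall>S\<in>sections \<A> \<P>. \<exists>S'\<in>sections \<A> \<P>. \<forall>Y\<in>vector_fields \<A>.
        D X (app S Y) - app S (D X Y) = app S' Y)"

definition torsion_free ::
  "('a::{t2_space,second_countable_topology}, 'n::finite) chart set \<Rightarrow>
     (('a \<Rightarrow> 'a tvec) \<Rightarrow> ('a \<Rightarrow> 'a tvec) \<Rightarrow> 'a \<Rightarrow> 'a tvec) \<Rightarrow> bool" where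
  "torsion_free \<A> D \<longleftrightarrow>
     (\<forall>X\<in>vector_fields \<A>. \<forall>Y\<in>vector_fields \<A>. D X Y - D Y X - lie_bracket X Y = 0)"

definition para_quaternionic ::
  "('a::{t2_space,second_countable_topology}, 'n::finite) chart set \<Rightarrow> ('a \<Rightarrow> 'a tend set) \<Rightarrow> bool" where
  "para_quaternionic \<A> \<P> \<longleftrightarrow>
     (\<exists>D. linear_connection \<A> D \<and> preserves \<A> \<P> D \<and> torsion_free \<A> D)"

end

theory Submission
  imports Defs
begin

text \<open>
  A pair of anticommuting sections \<open>I\<close>, \<open>A\<close> of \<open>P\<close> with \<open>I\<^sup>2 = \<epsilon>\<close> and \<open>A\<^sup>2 = 1\<close>, where \<open>I\<close> is integrable, has an
  explicit Obata-type connection \<open>D\<close> with \<open>D I = D A = 0\<close>, whose torsion \<open>T\<close> is \<open>I\<close>-bilinear. Changing \<open>D\<close> by a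
  one-form with values in \<open>\<real> Id \<oplus> P\<close> keeps it para-quaternionic, so it is enough that \<open>T\<close> is the
  skew-symmetrisation \<open>S\<^sub>X Y - S\<^sub>Y X\<close> of such a form; call these skew forms removable.

  For an integrable section \<open>J\<close> of \<open>P\<close>, \<open>N\<^sub>J = 0\<close> says that
  \<open>J\<^sup>2 T(X, Y) + T(J X, J Y) - J (T(J X, Y) + T(X, J Y))\<close> is removable. Write \<open>J = \<alpha> I + C\<close> with \<open>C\<close>
  anticommuting with \<open>I\<close>. The \<open>I\<close>-bilinear part of this expression is \<open>C\<^sup>2 T(X, Y)\<close>, and \<open>C\<^sup>2\<close> is nowhere zero
  exactly when the planes spanned by \<open>I\<close> and \<open>J\<close> are non-degenerate. In the degenerate case \<open>C\<close> is a null section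
  \<open>N\<close> and the expression is \<open>T(N X, N Y) + 2 \<sigma> \<alpha> N T(X, Y)\<close> with \<open>I N = \<sigma> N\<close>. A second structure \<open>\<beta> I + s N\<close>
  gives an independent combination of the same two terms. Completing \<open>I\<close>, \<open>N\<close> to an \<open>sl\<^sub>2\<close>-triple with third
  member \<open>M\<close> recovers \<open>T(X, Y) = T(N M X, N M Y) + M N T(X, Y)\<close>.
\<close>

section \<open>Smooth maps and bump functions\<close>

text \<open>Admissible bases exist only near each point, but the connection must be global, so the
  pair \<open>I\<close>, \<open>A\<close> has to come from the given structures. Each fibre of
  \<open>P\<close> is a Lorentzian 3-space in which an element composed with itself is its norm
  times the identity: -1 for complex, 1 for para-complex structures. If the plane of
  \<open>I\<close> and \<open>J\<close> is non-degenerate, the part \<open>C\<close> of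
  \<open>J\<close> orthogonal to \<open>I\<close> can be normalised and taken as \<open>A\<close>;
  where its norm is negative, \<open>I\<close> composed with \<open>C\<close> is taken instead,
  which has positive norm when I^2 = 1. When I^2 = -1 the complement of \<open>I\<close> is positive
  definite, which is why independence suffices as soon as one structure is complex. In a degenerate
  plane \<open>C\<close> is null and cannot be normalised; there \<open>A\<close> is N + M, and the
  obstacle is to find \<open>M\<close> smoothly. Local choices come from the non-degeneracy of the
  metric and agree by uniqueness. Since sections are tested on global vector fields, local data
  enter only after multiplication by bump functions.\<close>

lemma Ck_on_cong:
  assumes "open S" "\<And>x. x \<in> S \<Longrightarrow> f x = g x" "Ck_on k f S"
  shows "Ck_on k g S"
  using assms(2,3)
proof (induction k arbitrary: f g)
  case 0
  then show ?case by (simp cong: continuous_on_cong)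
next
  case (Suc k)
  have d: "f differentiable (at x)" if "x \<in> S" for x
    using Suc.prems(2) that by simp
  have "g differentiable (at x)" if "x \<in> S" for x
    using has_derivative_transform_within_open[of f _ x UNIV, OF _ \<open>open S\<close> that Suc.prems(1)] d[OF that]
    unfolding differentiable_def by blast
  moreover have "Ck_on k (\<lambda>x. frechet_derivative g (at x) v) S" for v
  proof (rule Suc.IH)
    show "frechet_derivative f (at x) v = frechet_derivative g (at x) v" if "x \<in> S" for x
      using frechet_derivative_transform_within_open[OF d \<open>open S\<close>] that Suc.prems(1) by metis
  qed (use Suc.prems(2) in simp)
  ultimately show ?case by simp
qed

lemma Ck_on_SucI:
  assumes "open S" "\<And>x. x \<in> S \<Longrightarrow> (f has_derivative F x) (at x)" "\<And>v. Ck_on k (\<lambda>x. F x v) S"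
  shows "Ck_on (Suc k) f S"
proof -
  have "F x v = frechet_derivative f (at x) v" if "x \<in> S" for x v
    using frechet_derivative_at[OF assms(2)[OF that]] by simp
  then have "Ck_on k (\<lambda>x. frechet_derivative f (at x) v) S" for v
    by (rule Ck_on_cong[OF assms(1) _ assms(3)])
  then show ?thesis
    using assms(2) by (auto simp: differentiable_def)
qed

lemma Ck_on_SucD:
  assumes "Ck_on (Suc k) f S"
  shows "\<And>x. x \<in> S \<Longrightarrow> (f has_derivative frechet_derivative f (at x)) (at x)"
    and "\<And>v. Ck_on k (\<lambda>x. frechet_derivative f (at x) v) S"
  using assms by (auto simp: frechet_derivative_works)

lemma Ck_on_Suc_mono: "Ck_on (Suc k) f S \<Longrightarrow> Ck_on k f S"
proof (induction k arbitrary: f)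
  case 0
  then have "continuous_on S f"
    by (intro continuous_at_imp_continuous_on ballI differentiable_imp_continuous_within) simp
  then show ?case by simp
next
  case (Suc k)
  have "Ck_on k (\<lambda>x. frechet_derivative f (at x) v) S" for v
    using Suc.prems by (intro Suc.IH) simp
  then show ?case using Suc.prems by simp
qed

lemma Ck_on_subset: "Ck_on k f S \<Longrightarrow> T \<subseteq> S \<Longrightarrow> Ck_on k f T"
  by (induction k arbitrary: f) (auto intro: continuous_on_subset)

lemma Ck_on_local:
  assumes "\<And>x. x \<in> S \<Longrightarrow> \<exists>T. open T \<and> x \<in> T \<and> Ck_on k f T"
  shows "Ck_on k f S"
  using assms
proof (induction k arbitrary: f)
  case 0
  have "isCont f x" if x: "x \<in> S" for x
  proof -
    obtain T where "open T" "x \<in> T" "continuous_on T f" using 0[OF x] by auto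
    then show ?thesis by (simp add: continuous_on_eq_continuous_at)
  qed
  then show ?case by (simp add: continuous_at_imp_continuous_on)
next
  case (Suc k)
  have "Ck_on k (\<lambda>x. frechet_derivative f (at x) v) S" for v
  proof (rule Suc.IH)
    fix x assume "x \<in> S"
    then obtain T where "open T" "x \<in> T" "Ck_on (Suc k) f T" using Suc.prems by blast
    then show "\<exists>T. open T \<and> x \<in> T \<and> Ck_on k (\<lambda>x. frechet_derivative f (at x) v) T"
      using Ck_on_SucD(2) by blast
  qed
  moreover have "f differentiable (at x)" if "x \<in> S" for x
    using Suc.prems[OF that] by auto
  ultimately show ?case by simp
qed

lemma Ck_on_const: "open S \<Longrightarrow> Ck_on k (\<lambda>x. c) S"
  by (induction k arbitrary: c) auto

lemma Ck_on_linear: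
  assumes "bounded_linear L" "open S" "Ck_on k f S"
  shows "Ck_on k (\<lambda>x. L (f x)) S"
  using assms(3)
proof (induction k arbitrary: f)
  case 0
  then show ?case
    using assms(1) by (simp add: bounded_linear.continuous_on)
next
  case (Suc k)
  note D = Ck_on_SucD[OF Suc.prems]
  show ?case
    by (rule Ck_on_SucI[OF \<open>open S\<close> bounded_linear.has_derivative[OF assms(1) D(1)]])
      (use Suc.IH[OF D(2)] in auto)
qed

lemma Ck_on_ident: "open S \<Longrightarrow> Ck_on k (\<lambda>x. x) S"
proof (cases k)
  case (Suc l)
  assume "open S"
  then show ?thesis
    unfolding Suc by (intro Ck_on_SucI[where F = "\<lambda>_ v. v"]) (auto intro: Ck_on_const)
qed simp

lemma Ck_on_add:
  assumes "open S" "Ck_on k f S" "Ck_on k g S"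
  shows "Ck_on k (\<lambda>x. f x + g x) S"
  using assms(2,3)
proof (induction k arbitrary: f g)
  case (Suc k)
  note D = Ck_on_SucD[OF Suc.prems(1)] Ck_on_SucD[OF Suc.prems(2)]
  show ?case
    by (rule Ck_on_SucI[OF \<open>open S\<close> has_derivative_add[OF D(1) D(3)]])
      (use Suc.IH[OF D(2) D(4)] in auto)
qed (auto intro: continuous_intros)

lemma Ck_on_sum:
  assumes "open S" "\<And>i. i \<in> I \<Longrightarrow> Ck_on k (f i) S"
  shows "Ck_on k (\<lambda>x. \<Sum>i\<in>I. f i x) S"
  using assms(2)
  by (induction I rule: infinite_finite_induct) (auto intro: Ck_on_const Ck_on_add assms(1))

lemma Ck_on_mult:
  fixes f g :: "'v::real_normed_vector \<Rightarrow> real"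
  assumes "open S" "Ck_on k f S" "Ck_on k g S"
  shows "Ck_on k (\<lambda>x. f x * g x) S"
  using assms(2,3)
proof (induction k arbitrary: f g)
  case (Suc k)
  note D = Ck_on_SucD[OF Suc.prems(1)] Ck_on_SucD[OF Suc.prems(2)]
  show ?case
    by (rule Ck_on_SucI[OF \<open>open S\<close> has_derivative_mult[OF D(1) D(3)]])
      (auto intro!: Ck_on_add \<open>open S\<close> Suc.IH D(2,4) Ck_on_Suc_mono[OF Suc.prems(1)]
        Ck_on_Suc_mono[OF Suc.prems(2)])
qed (auto intro: continuous_intros)

lemma Ck_on_inverse:
  fixes f :: "'v::real_normed_vector \<Rightarrow> real"
  assumes "open S" "\<And>x. x \<in> S \<Longrightarrow> f x \<noteq> 0" "Ck_on k f S"
  shows "Ck_on k (\<lambda>x. inverse (f x)) S"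
  using assms(3)
proof (induction k)
  case 0
  then show ?case using assms(2) by (auto intro: continuous_intros)
next
  case (Suc k)
  note D = Ck_on_SucD[OF Suc.prems]
  have I: "Ck_on k (\<lambda>x. inverse (f x)) S"
    using Suc.IH Suc.prems Ck_on_Suc_mono by blast
  show ?case
  proof (rule Ck_on_SucI[OF \<open>open S\<close>])
    show "((\<lambda>x. inverse (f x)) has_derivative
      (\<lambda>v. (-1) * (inverse (f x) * inverse (f x)) * frechet_derivative f (at x) v)) (at x)" if "x \<in> S" for x
      using has_derivative_compose[OF D(1)[OF that] DERIV_inverse[OF assms(2)[OF that],
          unfolded has_field_derivative_def]] by (simp add: mult_ac)
  qed (intro Ck_on_mult Ck_on_const I D(2) \<open>open S\<close>)
qed

text \<open>The derivative of |t|^(-1/2) is -|t|^(-1/2) / (2 t) for either sign of t, so it contains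
  the function itself and the induction closes. The absolute value is there because the norm to be
  normalised may be positive at some points and negative at others.\<close>

lemma Ck_on_inverse_sqrt_abs:
  fixes f :: "'v::real_normed_vector \<Rightarrow> real"
  assumes "open S" "\<And>x. x \<in> S \<Longrightarrow> f x \<noteq> 0" "Ck_on k f S"
  shows "Ck_on k (\<lambda>x. inverse (sqrt \<bar>f x\<bar>)) S"
  using assms(3)
proof (induction k)
  case 0
  then show ?case using assms(2) by (auto intro!: continuous_intros)
next
  case (Suc k)
  note D = Ck_on_SucD[OF Suc.prems]
  have f: "Ck_on k f S" using Suc.prems by (rule Ck_on_Suc_mono)
  note I = Suc.IH[OF f] Ck_on_inverse[OF assms(1,2) f]
  have d: "((\<lambda>t. inverse (sqrt \<bar>t\<bar>)) has_real_derivative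
      (- 1 / 2) * inverse (sqrt \<bar>t\<bar>) * inverse t) (at t)" if "t \<noteq> 0" for t :: real
  proof (cases "t > 0")
    case True
    have "((\<lambda>t. inverse (sqrt t)) has_real_derivative - (inverse (sqrt t) / 2 * inverse (sqrt t) * inverse (sqrt t))) (at t)"
      using DERIV_inverse'[OF DERIV_real_sqrt[OF True]] True by simp
    also have "- (inverse (sqrt t) / 2 * inverse (sqrt t) * inverse (sqrt t)) = (- 1 / 2) * inverse (sqrt \<bar>t\<bar>) * inverse t"
      using True by (simp add: mult.assoc flip: inverse_mult_distrib)
    finally show ?thesis
      by (rule has_field_derivative_transform_within_open[where S = "{0<..}"]) (use True in auto)
  next
    case False
    then have t: "- t > 0" using that by simp
    have "((\<lambda>t. inverse (sqrt (- t))) has_real_derivative - (inverse (sqrt (- t)) * (inverse (sqrt (- t)) / 2 * (- 1)) * inverse (sqrt (- t)))) (at t)"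
      by (rule DERIV_inverse'[OF DERIV_chain2[OF DERIV_real_sqrt[OF t] DERIV_minus[OF DERIV_ident]]]) (use t in simp)
    also have "- (inverse (sqrt (- t)) * (inverse (sqrt (- t)) / 2 * (- 1)) * inverse (sqrt (- t))) = (- 1 / 2) * inverse (sqrt \<bar>t\<bar>) * inverse t"
      using t by (simp add: mult.assoc abs_if flip: inverse_mult_distrib)
    finally show ?thesis
      by (rule has_field_derivative_transform_within_open[where S = "{..<0}"]) (use t in auto)
  qed
  show ?case
  proof (rule Ck_on_SucI[OF \<open>open S\<close>])
    show "((\<lambda>x. inverse (sqrt \<bar>f x\<bar>)) has_derivative
      (\<lambda>v. (- 1 / 2) * inverse (sqrt \<bar>f x\<bar>) * inverse (f x) * frechet_derivative f (at x) v)) (at x)"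
      if "x \<in> S" for x
      using has_derivative_compose[OF D(1)[OF that] d[OF assms(2)[OF that],
          unfolded has_field_derivative_def]] by simp
  qed (intro Ck_on_mult Ck_on_const I D(2) \<open>open S\<close>)
qed

text \<open>The chain rule evaluates the derivative of \<open>g\<close> in a direction that varies
  with the point, where the induction hypothesis does not apply. Expanding that direction over
  \<open>Basis\<close> leaves a sum of products whose directions are fixed.\<close>

lemma Ck_on_compose:
  fixes g :: "'w::euclidean_space \<Rightarrow> real" and h :: "'v::real_normed_vector \<Rightarrow> 'w"
  assumes "open S" "open T" "h ` S \<subseteq> T" "Ck_on k g T" "Ck_on k h S"
  shows "Ck_on k (\<lambda>x. g (h x)) S"
  using assms(4,5)
proof (induction k arbitrary: g)
  case 0
  then show ?case using assms(3) by (auto intro: continuous_on_compose2)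
next
  case (Suc k)
  note D = Ck_on_SucD[OF Suc.prems(1)] Ck_on_SucD[OF Suc.prems(2)]
  let ?F = "\<lambda>x v. \<Sum>b\<in>Basis. (frechet_derivative h (at x) v \<bullet> b) * frechet_derivative g (at (h x)) b"
  show ?case
  proof (rule Ck_on_SucI[OF \<open>open S\<close>])
    fix x assume x: "x \<in> S"
    then have hx: "h x \<in> T" using assms(3) by auto
    have L: "linear (frechet_derivative g (at (h x)))"
      using D(1)[OF hx] has_derivative_linear by blast
    have "frechet_derivative g (at (h x)) (frechet_derivative h (at x) v) = ?F x v" for v
      using linear_scale[OF L]
      by (subst euclidean_representation[of "frechet_derivative h (at x) v", symmetric])
        (simp add: Real_Vector_Spaces.linear_sum[OF L])
    then show "((\<lambda>x. g (h x)) has_derivative ?F x) (at x)"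
      using has_derivative_compose[OF D(3)[OF x] D(1)[OF hx]] by presburger
  next
    fix v
    show "Ck_on k (\<lambda>x. ?F x v) S"
      by (intro Ck_on_sum Ck_on_mult \<open>open S\<close> Ck_on_linear[OF bounded_linear_inner_left] D
          Suc.IH Ck_on_Suc_mono[OF Suc.prems(2)])
  qed
qed

text \<open>Derivatives of members of this family are linear combinations of members, which makes smoothness
  at \<open>0\<close> an induction over the whole family.\<close>

definition flat :: "nat \<Rightarrow> real \<Rightarrow> real" where
  "flat n t = (if t > 0 then inverse t ^ n * exp (- inverse t) else 0)"

lemma flat_tendsto_0: "(flat n \<longlongrightarrow> 0) (at 0)"
proof -
  have "((\<lambda>t. inverse t ^ n / exp (inverse t)) \<longlongrightarrow> (0::real)) (at_right 0)"
    by (rule filterlim_compose[OF tendsto_power_div_exp_0 filterlim_inverse_at_top_right])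
  then have "(flat n \<longlongrightarrow> 0) (at_right 0)"
    by (rule Lim_transform_eventually)
      (auto simp: flat_def eventually_at_filter exp_minus field_simps)
  moreover have "(flat n \<longlongrightarrow> 0) (at_left 0)"
    by (rule Lim_transform_eventually[OF tendsto_const])
      (auto simp: flat_def eventually_at_filter)
  ultimately show ?thesis using filterlim_at_split by blast
qed

lemma flat_has_derivative:
  "(flat n has_real_derivative flat (n + 2) t - real n * flat (Suc n) t) (at t)"
proof -
  consider "t > 0" | "t < 0" | "t = 0" by linarith
  then show ?thesis
  proof cases
    case 1
    have "((\<lambda>t. inverse t ^ n * exp (- inverse t)) has_real_derivative
        flat (n + 2) t - real n * flat (Suc n) t) (at t)"
    proof (cases n)
      case 0
      show ?thesis unfolding 0
        by (rule derivative_eq_intros refl | use 1 in \<open>simp add: flat_def power2_eq_square\<close>)+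
    next
      case (Suc m)
      show ?thesis unfolding Suc
        by (rule derivative_eq_intros refl | use 1 in \<open>simp add: flat_def field_simps power2_eq_square\<close>)+
    qed
    then show ?thesis
      by (rule has_field_derivative_transform_within_open[where S = "{0<..}"])
        (use 1 in \<open>auto simp: flat_def\<close>)
  next
    case 2
    have "((\<lambda>t. 0) has_real_derivative flat (n + 2) t - real n * flat (Suc n) t) (at t)"
      using 2 by (simp add: flat_def)
    then show ?thesis
      by (rule has_field_derivative_transform_within_open[where S = "{..<0}"])
        (use 2 in \<open>auto simp: flat_def\<close>)
  next
    case 3
    \<comment> \<open>The difference quotient at 0 is the next member of the family, whose limit is
      already known.\<close>
    have "((\<lambda>y. (flat n y - flat n 0) / (y - 0)) \<longlongrightarrow> 0) (at 0)"
      by (rule Lim_transform_eventually[OF flat_tendsto_0[of "Suc n"]])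
        (auto simp: flat_def eventually_at_filter field_simps)
    then show ?thesis
      unfolding has_field_derivative_iff using 3 by (simp add: flat_def)
  qed
qed

lemma Ck_on_flat: "Ck_on k (flat n) UNIV"
proof (induction k arbitrary: n)
  case 0
  have "continuous_on UNIV (flat n)"
    by (rule continuous_at_imp_continuous_on) (rule ballI, rule DERIV_isCont, rule flat_has_derivative)
  then show ?case by simp
next
  case (Suc k)
  have d: "(flat n has_derivative (*) (flat (n + 2) t - real n * flat (Suc n) t)) (at t)" for t
    using flat_has_derivative by (simp only: has_field_derivative_def)
  have "Ck_on k (\<lambda>t. (flat (n + 2) t + (- real n) * flat (Suc n) t) * v) UNIV" for v
    by (intro Ck_on_mult Ck_on_add Ck_on_const Suc.IH) auto
  then show ?case
    by (intro Ck_on_SucI[OF open_UNIV d]) simp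
qed

lemma smooth_on_derivative:
  "smooth_on f S \<Longrightarrow> smooth_on (\<lambda>x. frechet_derivative f (at x) v) S"
  unfolding smooth_on_def using Ck_on_SucD(2) by blast

lemma smooth_on_subset: "smooth_on f S \<Longrightarrow> T \<subseteq> S \<Longrightarrow> smooth_on f T"
  unfolding smooth_on_def using Ck_on_subset by blast

lemma smooth_on_differentiable: "smooth_on f S \<Longrightarrow> x \<in> S \<Longrightarrow> f differentiable (at x)"
  unfolding smooth_on_def by (auto dest: spec[of _ "Suc 0"])

text \<open>The bump is a flat function of r^2 - |x - c|^2. Because of the last clause it serves
  twice: as a cutoff, and as a function with non-zero derivative in a known direction at every point
  of the ball other than the centre.\<close>

lemma smooth_bump:
  fixes c :: "'v::euclidean_space"
  assumes "r > 0"
  defines "g \<equiv> \<lambda>x. flat 0 (r\<^sup>2 - (x - c) \<bullet> (x - c))"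
  shows "smooth_on g UNIV"
    and "x \<in> ball c r \<Longrightarrow> g x > 0"
    and "x \<notin> ball c r \<Longrightarrow> g x = 0"
    and "x \<in> ball c r \<Longrightarrow> x \<noteq> c \<Longrightarrow> frechet_derivative g (at x) (c - x) \<noteq> 0"
proof -
  let ?h = "\<lambda>x. r\<^sup>2 - (x - c) \<bullet> (x - c)"
  have dh: "(?h has_derivative (\<lambda>v. (-2) * ((x + (- c)) \<bullet> v))) (at x)" for x
    by (rule derivative_eq_intros refl | simp add: inner_commute)+
  have "Ck_on k (\<lambda>x. (x + (- c)) \<bullet> v) UNIV" for k and v
    by (intro Ck_on_linear[OF bounded_linear_inner_left] Ck_on_add Ck_on_ident Ck_on_const) auto
  then have "Ck_on (Suc k) ?h UNIV" for k
    by (intro Ck_on_SucI[OF _ dh] Ck_on_mult Ck_on_const) auto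
  then have "Ck_on k ?h UNIV" for k using Ck_on_Suc_mono by blast
  then show "smooth_on g UNIV"
    unfolding smooth_on_def g_def
    by (intro allI Ck_on_compose[where g = "flat 0" and h = ?h and T = UNIV] Ck_on_flat) auto
  have *: "x \<in> ball c r \<longleftrightarrow> ?h x > 0" for x
  proof -
    have "(x - c) \<bullet> (x - c) = (dist c x)\<^sup>2"
      by (metis dist_commute dist_norm power2_norm_eq_inner)
    then show ?thesis
      using assms(1) power_strict_mono[of "dist c x" r 2] power_mono[of r "dist c x" 2]
      unfolding mem_ball by (metis diff_gt_0_iff_gt less_eq_real_def not_less pos2 zero_le_dist)
  qed
  show "x \<in> ball c r \<Longrightarrow> g x > 0" "x \<notin> ball c r \<Longrightarrow> g x = 0"
    using * by (auto simp: g_def flat_def)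
  assume x: "x \<in> ball c r" "x \<noteq> c"
  have "(g has_derivative (\<lambda>v. (flat 2 (?h x)) * ((-2) * ((x + (- c)) \<bullet> v)))) (at x)"
    using has_derivative_compose[OF dh flat_has_derivative[of 0, unfolded has_field_derivative_def]]
    by (simp add: g_def numeral_2_eq_2)
  then have "frechet_derivative g (at x) = (\<lambda>v. (flat 2 (?h x)) * ((-2) * ((x + (- c)) \<bullet> v)))"
    by (rule frechet_derivative_at[symmetric])
  moreover have "flat 2 (?h x) > 0"
    using x(1) * by (simp add: flat_def)
  moreover have "(x + (- c)) \<bullet> (c - x) = - ((x - c) \<bullet> (x - c))"
    by (simp add: inner_diff algebra_simps)
  ultimately show "frechet_derivative g (at x) (c - x) \<noteq> 0" using x(2) by simp
qed

section \<open>Smooth functions on a manifold\<close>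

locale smooth_manifold =
  fixes \<A> :: "('a::{t2_space,second_countable_topology}, 'n::finite) chart set"
  assumes atlas: "smooth_atlas \<A>"
begin

abbreviation "SF \<equiv> smooth_funs \<A>"
abbreviation "VF \<equiv> vector_fields \<A>"
abbreviation "TS \<equiv> tangent_space \<A>"

lemma chartD:
  assumes "(U, \<phi>) \<in> \<A>"
  shows "open U" "open (\<phi> ` U)" "inj_on \<phi> U" "homeomorphism U (\<phi> ` U) \<phi> (inv_into U \<phi>)"
  using atlas assms unfolding smooth_atlas_def by blast+

lemma chart_transition:
  assumes "(U, \<phi>) \<in> \<A>" "(V, \<psi>) \<in> \<A>"
  shows "smooth_on (\<psi> \<circ> inv_into U \<phi>) (\<phi> ` (U \<inter> V))"
  using atlas assms unfolding smooth_atlas_def by blast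

lemma chart_at: "\<exists>U \<phi>. (U, \<phi>) \<in> \<A> \<and> p \<in> U"
proof -
  have "p \<in> (\<Union>(U, \<phi>)\<in>\<A>. U)" using atlas unfolding smooth_atlas_def by simp
  then show ?thesis by blast
qed

lemma chart_image_open:
  assumes "(U, \<phi>) \<in> \<A>" "open W"
  shows "open (\<phi> ` (U \<inter> W))"
proof -
  note c = chartD[OF assms(1)]
  have "openin (top_of_set U) (U \<inter> W)"
    using assms(2) by (auto simp: openin_open)
  then have "openin (top_of_set (\<phi> ` U)) (\<phi> ` (U \<inter> W))"
    using homeomorphism_imp_open_map[OF c(4)] by blast
  then show ?thesis using c(2) openin_open_trans by blast
qed

lemma smooth_fun_onI:
  assumes "\<And>U \<phi> k. (U, \<phi>) \<in> \<A> \<Longrightarrow> Ck_on k (\<lambda>x. f (inv_into U \<phi> x)) (\<phi> ` (U \<inter> W))"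
  shows "smooth_fun_on \<A> W f"
  using assms unfolding smooth_fun_on_def smooth_on_def by (auto simp: comp_def)

lemma smooth_fun_onD:
  assumes "smooth_fun_on \<A> W f" "(U, \<phi>) \<in> \<A>"
  shows "Ck_on k (\<lambda>x. f (inv_into U \<phi> x)) (\<phi> ` (U \<inter> W))"
  using assms unfolding smooth_fun_on_def smooth_on_def by (auto simp: comp_def)

lemma chart_inv:
  assumes "(U, \<phi>) \<in> \<A>" "x \<in> \<phi> ` (U \<inter> W)"
  shows "inv_into U \<phi> x \<in> U \<inter> W"
  using assms chartD(3)[OF assms(1)] by auto

lemma smooth_fun_on_const: "open W \<Longrightarrow> smooth_fun_on \<A> W (\<lambda>p. c)"
  by (rule smooth_fun_onI, rule Ck_on_const, rule chart_image_open)

lemma smooth_fun_on_add: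
  assumes "open W" "smooth_fun_on \<A> W f" "smooth_fun_on \<A> W g"
  shows "smooth_fun_on \<A> W (\<lambda>p. f p + g p)"
proof (rule smooth_fun_onI)
  fix U \<phi> k assume c: "(U, \<phi>) \<in> \<A>"
  show "Ck_on k (\<lambda>x. f (inv_into U \<phi> x) + g (inv_into U \<phi> x)) (\<phi> ` (U \<inter> W))"
    by (rule Ck_on_add[OF chart_image_open[OF c assms(1)] smooth_fun_onD[OF assms(2) c]
          smooth_fun_onD[OF assms(3) c]])
qed

lemma smooth_fun_on_mult:
  assumes "open W" "smooth_fun_on \<A> W f" "smooth_fun_on \<A> W g"
  shows "smooth_fun_on \<A> W (\<lambda>p. f p * g p)"
proof (rule smooth_fun_onI)
  fix U \<phi> k assume c: "(U, \<phi>) \<in> \<A>"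
  show "Ck_on k (\<lambda>x. f (inv_into U \<phi> x) * g (inv_into U \<phi> x)) (\<phi> ` (U \<inter> W))"
    by (rule Ck_on_mult[OF chart_image_open[OF c assms(1)] smooth_fun_onD[OF assms(2) c]
          smooth_fun_onD[OF assms(3) c]])
qed

lemma smooth_fun_on_inverse:
  assumes "open W" "\<And>p. p \<in> W \<Longrightarrow> f p \<noteq> 0" "smooth_fun_on \<A> W f"
  shows "smooth_fun_on \<A> W (\<lambda>p. inverse (f p))"
proof (rule smooth_fun_onI)
  fix U \<phi> k assume c: "(U, \<phi>) \<in> \<A>"
  show "Ck_on k (\<lambda>x. inverse (f (inv_into U \<phi> x))) (\<phi> ` (U \<inter> W))"
    using chart_inv[OF c] assms(2)
    by (intro Ck_on_inverse chart_image_open[OF c assms(1)] smooth_fun_onD[OF assms(3) c]) blast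
qed

lemma smooth_fun_on_inverse_sqrt_abs:
  assumes "open W" "\<And>p. p \<in> W \<Longrightarrow> f p \<noteq> 0" "smooth_fun_on \<A> W f"
  shows "smooth_fun_on \<A> W (\<lambda>p. inverse (sqrt \<bar>f p\<bar>))"
proof (rule smooth_fun_onI)
  fix U \<phi> k assume c: "(U, \<phi>) \<in> \<A>"
  show "Ck_on k (\<lambda>x. inverse (sqrt \<bar>f (inv_into U \<phi> x)\<bar>)) (\<phi> ` (U \<inter> W))"
    using chart_inv[OF c] assms(2)
    by (intro Ck_on_inverse_sqrt_abs chart_image_open[OF c assms(1)] smooth_fun_onD[OF assms(3) c]) blast
qed

lemma smooth_fun_on_cong:
  assumes "open W" "\<And>p. p \<in> W \<Longrightarrow> f p = g p" "smooth_fun_on \<A> W f"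
  shows "smooth_fun_on \<A> W g"
proof (rule smooth_fun_onI)
  fix U \<phi> k assume c: "(U, \<phi>) \<in> \<A>"
  have "f (inv_into U \<phi> x) = g (inv_into U \<phi> x)" if "x \<in> \<phi> ` (U \<inter> W)" for x
    using chart_inv[OF c that] assms(2) by blast
  then show "Ck_on k (\<lambda>x. g (inv_into U \<phi> x)) (\<phi> ` (U \<inter> W))"
    by (rule Ck_on_cong[OF chart_image_open[OF c assms(1)] _ smooth_fun_onD[OF assms(3) c]])
qed

lemma smooth_fun_on_subset:
  assumes "smooth_fun_on \<A> W f" "W' \<subseteq> W"
  shows "smooth_fun_on \<A> W' f"
proof (rule smooth_fun_onI)
  fix U \<phi> k assume "(U, \<phi>) \<in> \<A>"
  then show "Ck_on k (\<lambda>x. f (inv_into U \<phi> x)) (\<phi> ` (U \<inter> W'))"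
    by (rule Ck_on_subset[OF smooth_fun_onD[OF assms(1)]]) (use assms(2) in auto)
qed

lemma smooth_fun_on_local:
  assumes "\<And>p. p \<in> W \<Longrightarrow> \<exists>W'. open W' \<and> p \<in> W' \<and> smooth_fun_on \<A> W' f"
  shows "smooth_fun_on \<A> W f"
proof (intro smooth_fun_onI Ck_on_local)
  fix U \<phi> k x assume c: "(U, \<phi>) \<in> \<A>" and "x \<in> \<phi> ` (U \<inter> W)"
  then obtain p where p: "p \<in> U" "p \<in> W" "x = \<phi> p" by blast
  obtain W' where W': "open W'" "p \<in> W'" "smooth_fun_on \<A> W' f" using assms p(2) by blast
  show "\<exists>T. open T \<and> x \<in> T \<and> Ck_on k (\<lambda>x. f (inv_into U \<phi> x)) T"
    using chart_image_open[OF c W'(1)] smooth_fun_onD[OF W'(3) c] p W'(2) by blast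
qed

lemma SF_iff: "f \<in> SF \<longleftrightarrow> smooth_fun_on \<A> UNIV f"
  by (simp add: smooth_funs_def)

lemma SF_const [simp]: "(\<lambda>p. c) \<in> SF"
  by (simp add: SF_iff smooth_fun_on_const)

lemma SF_add: "f \<in> SF \<Longrightarrow> g \<in> SF \<Longrightarrow> (\<lambda>p. f p + g p) \<in> SF"
  by (simp add: SF_iff smooth_fun_on_add)

lemma SF_mult: "f \<in> SF \<Longrightarrow> g \<in> SF \<Longrightarrow> (\<lambda>p. f p * g p) \<in> SF"
  by (simp add: SF_iff smooth_fun_on_mult)

lemma SF_cmult: "f \<in> SF \<Longrightarrow> (\<lambda>p. c * f p) \<in> SF"
  by (simp add: SF_mult)

lemma SF_minus: "f \<in> SF \<Longrightarrow> (\<lambda>p. - f p) \<in> SF"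
  using SF_cmult[of f "-1"] by simp

lemma SF_diff: "f \<in> SF \<Longrightarrow> g \<in> SF \<Longrightarrow> (\<lambda>p. f p - g p) \<in> SF"
  using SF_add[OF _ SF_minus] by simp

lemma SF_inverse: "f \<in> SF \<Longrightarrow> (\<And>p. f p \<noteq> 0) \<Longrightarrow> (\<lambda>p. inverse (f p)) \<in> SF"
  by (simp add: SF_iff smooth_fun_on_inverse)

lemma SF_inverse_sqrt_abs: "f \<in> SF \<Longrightarrow> (\<And>p. f p \<noteq> 0) \<Longrightarrow> (\<lambda>p. inverse (sqrt \<bar>f p\<bar>)) \<in> SF"
  by (simp add: SF_iff smooth_fun_on_inverse_sqrt_abs)

lemma SF_continuous: assumes "f \<in> SF" shows "continuous_on UNIV f"
proof -
  have "isCont f p" for p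
  proof -
    obtain U \<phi> where c: "(U, \<phi>) \<in> \<A>" "p \<in> U" using chart_at by blast
    note d = chartD[OF c(1)]
    have "continuous_on (\<phi> ` U) (\<lambda>x. f (inv_into U \<phi> x))"
      using smooth_fun_onD[OF assms[unfolded SF_iff] c(1), of 0] by simp
    then have "continuous_on U (\<lambda>q. f (inv_into U \<phi> (\<phi> q)))"
      using continuous_on_compose2[OF _ homeomorphism_cont1[OF d(4)]] by blast
    then have "continuous_on U f"
      by (rule continuous_on_eq) (use d(3) in simp)
    then show ?thesis using d(1) c(2) by (simp add: continuous_on_eq_continuous_at)
  qed
  then show ?thesis by (simp add: continuous_at_imp_continuous_on)
qed

lemma SF_nonzero_open: "f \<in> SF \<Longrightarrow> open {p. f p \<noteq> 0}"
  using open_Collect_neq[OF SF_continuous continuous_on_const] .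

lemma SF_local:
  assumes "\<And>p. \<exists>W. open W \<and> p \<in> W \<and> smooth_fun_on \<A> W f"
  shows "f \<in> SF"
  unfolding SF_iff using assms by (intro smooth_fun_on_local) blast

text \<open>Used for functions that are determined only after multiplication by a smooth
  denominator, with a different denominator near each point.\<close>

lemma SF_quotient_local:
  assumes "\<And>p. \<exists>g\<in>SF. \<exists>h\<in>SF. g p \<noteq> 0 \<and> (\<forall>q. g q \<noteq> 0 \<longrightarrow> g q * f q = h q)"
  shows "f \<in> SF"
proof (rule SF_local)
  fix p
  obtain g h where g: "g \<in> SF" "h \<in> SF" "g p \<noteq> 0" "\<And>q. g q \<noteq> 0 \<Longrightarrow> g q * f q = h q"
    using assms by blast
  let ?W = "{q. g q \<noteq> 0}"
  have o: "open ?W" using SF_nonzero_open g(1) by blast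
  have "smooth_fun_on \<A> ?W (\<lambda>q. inverse (g q) * h q)"
    using g(1,2) smooth_fun_on_subset[of UNIV _ ?W] o unfolding SF_iff
    by (intro smooth_fun_on_mult smooth_fun_on_inverse) auto
  then have "smooth_fun_on \<A> ?W f"
    by (rule smooth_fun_on_cong[OF o, rotated]) (use g(4) in \<open>auto simp: field_simps\<close>)
  then show "\<exists>W. open W \<and> p \<in> W \<and> smooth_fun_on \<A> W f"
    using o g(3) by blast
qed

section \<open>Extension by zero, bump functions and test vector fields\<close>

lemma SF_extend:
  assumes K: "closed K" "K \<subseteq> U" and "open U" "smooth_fun_on \<A> U g"
    and F: "\<And>q. q \<in> U \<Longrightarrow> F q = g q" "\<And>q. q \<notin> K \<Longrightarrow> F q = 0"
  shows "F \<in> SF"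
proof (rule SF_local)
  fix p
  have "smooth_fun_on \<A> U F"
    using smooth_fun_on_cong[OF assms(3) _ assms(4)] F(1) by metis
  moreover have "smooth_fun_on \<A> (- K) F"
    using smooth_fun_on_cong[OF open_Compl[OF K(1)] _ smooth_fun_on_const[OF open_Compl[OF K(1)]], of 0 F] F(2)
    by auto
  ultimately show "\<exists>W. open W \<and> p \<in> W \<and> smooth_fun_on \<A> W F"
    using K assms(3) by (cases "p \<in> K") blast+
qed

lemma smooth_fun_on_chart:
  fixes g :: "real ^ 'n \<Rightarrow> real"
  assumes c: "(U, \<phi>) \<in> \<A>" and g: "smooth_on g (\<phi> ` U)"
  shows "smooth_fun_on \<A> U (\<lambda>q. g (\<phi> q))"
proof (rule smooth_fun_onI)
  fix V \<psi> k assume d: "(V, \<psi>) \<in> \<A>"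
  show "Ck_on k (\<lambda>x. g (\<phi> (inv_into V \<psi> x))) (\<psi> ` (V \<inter> U))"
  proof (rule Ck_on_compose[where g = g and h = "\<lambda>x. \<phi> (inv_into V \<psi> x)" and T = "\<phi> ` U"])
    show "Ck_on k (\<lambda>x. \<phi> (inv_into V \<psi> x)) (\<psi> ` (V \<inter> U))"
      using chart_transition[OF d c] by (simp add: smooth_on_def comp_def)
    show "(\<lambda>x. \<phi> (inv_into V \<psi> x)) ` \<psi> ` (V \<inter> U) \<subseteq> \<phi> ` U"
      using chart_inv[OF d] by blast
  qed (use g c d chartD chart_image_open in \<open>auto simp: smooth_on_def\<close>)
qed

lemma chart_ball:
  assumes "open Q" "p \<in> Q"
  obtains U \<phi> c r where "(U, \<phi>) \<in> \<A>" "p \<in> U" "0 < r" "\<phi> p \<in> ball c r" "\<phi> p \<noteq> c"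
    "cball c r \<subseteq> \<phi> ` (U \<inter> Q)"
proof -
  obtain U \<phi> where c: "(U, \<phi>) \<in> \<A>" "p \<in> U" using chart_at by blast
  obtain e where e: "e > 0" "cball (\<phi> p) e \<subseteq> \<phi> ` (U \<inter> Q)"
    using chart_image_open[OF c(1) assms(1)] assms(2) c(2) open_contains_cball by blast
  \<comment> \<open>The bump has zero derivative at its centre, so the centre is moved off
    \<open>\<phi> p\<close>, in an arbitrary coordinate direction. At distance e/4 with radius e/2
    the ball still contains \<open>\<phi> p\<close> and stays within distance e of it.\<close>
  define z where "z = \<phi> p + (e / 4) *\<^sub>R axis undefined 1"
  have z: "dist z (\<phi> p) = e / 4"
    using e(1) by (simp add: z_def dist_norm norm_axis_1)
  show ?thesis
  proof (rule that[OF c, of "e / 2" z])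
    show "cball z (e / 2) \<subseteq> \<phi> ` (U \<inter> Q)"
    proof
      fix x assume "x \<in> cball z (e / 2)"
      then have "dist (\<phi> p) x \<le> e"
        using z e(1) dist_triangle[of "\<phi> p" x z] by (simp add: dist_commute)
      then show "x \<in> \<phi> ` (U \<inter> Q)" using e(2) by auto
    qed
  qed (use e z in auto)
qed

lemma chart_ball_preimage:
  assumes c: "(U, \<phi>) \<in> \<A>" and b: "cball c r \<subseteq> \<phi> ` (U \<inter> Q)"
  shows "closed (inv_into U \<phi> ` cball c r)" "inv_into U \<phi> ` cball c r \<subseteq> U \<inter> Q"
    and "\<And>q. q \<in> U \<Longrightarrow> q \<notin> inv_into U \<phi> ` cball c r \<Longrightarrow> \<phi> q \<notin> ball c r"
proof -
  note d = chartD[OF c]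
  have "continuous_on (cball c r) (inv_into U \<phi>)"
    using homeomorphism_cont2[OF d(4)] b continuous_on_subset by blast
  then show "closed (inv_into U \<phi> ` cball c r)"
    using compact_continuous_image compact_cball compact_imp_closed by blast
  show "inv_into U \<phi> ` cball c r \<subseteq> U \<inter> Q"
    using b chart_inv[OF c] by blast
  show "\<phi> q \<notin> ball c r" if "q \<in> U" "q \<notin> inv_into U \<phi> ` cball c r" for q
  proof
    assume "\<phi> q \<in> ball c r"
    then have "inv_into U \<phi> (\<phi> q) \<in> inv_into U \<phi> ` cball c r"
      using ball_subset_cball by blast
    then show False using that d(3) by simp
  qed
qed

lemma bump_function:
  assumes "open Q" "p \<in> Q"
  obtains \<rho> K where "\<rho> \<in> SF" "\<rho> p \<noteq> 0" "closed K" "K \<subseteq> Q" "\<forall>q. q \<notin> K \<longrightarrow> \<rho> q = 0"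
proof -
  obtain U \<phi> c r where c: "(U, \<phi>) \<in> \<A>" "p \<in> U" "0 < r" "\<phi> p \<in> ball c r"
    "cball c r \<subseteq> \<phi> ` (U \<inter> Q)" by (rule chart_ball[OF assms])
  let ?g = "\<lambda>x. flat 0 (r\<^sup>2 - (x - c) \<bullet> (x - c))"
  let ?K = "inv_into U \<phi> ` cball c r"
  define \<rho> where "\<rho> q = (if q \<in> U then ?g (\<phi> q) else 0)" for q
  note g = smooth_bump[OF c(3), where c = c]
  note K = chart_ball_preimage[OF c(1,5)]
  have z: "\<rho> q = 0" if "q \<notin> ?K" for q
    using K(3)[OF _ that, THEN g(3)] by (simp add: \<rho>_def)
  have "smooth_fun_on \<A> U (\<lambda>q. ?g (\<phi> q))"
    by (rule smooth_fun_on_chart[OF c(1) smooth_on_subset[OF g(1)]]) simp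
  then have "\<rho> \<in> SF"
    by (rule SF_extend[OF K(1) _ chartD(1)[OF c(1)], rotated])
      (use K(2) z in \<open>auto simp: \<rho>_def\<close>)
  moreover have "\<rho> p \<noteq> 0" using g(2)[OF c(4)] c(2) by (simp add: \<rho>_def)
  moreover have "?K \<subseteq> Q" using K(2) by blast
  ultimately show ?thesis by (rule that[OF _ _ K(1)]) (use z in blast)
qed

text \<open>In a chart the field is the derivative in the constant direction \<open>v\<close>,
  multiplied by a bump, and the function is the same bump. The value at \<open>p\<close> is the bump
  times its radial derivative; both are non-zero because \<open>\<phi> p\<close> is in the ball but
  not at its centre.\<close>

lemma nonvanishing_field:
  obtains X f where "X \<in> VF" "f \<in> SF" "X p f \<noteq> 0"
proof -
  obtain U \<phi> c r where c: "(U, \<phi>) \<in> \<A>" "p \<in> U" "0 < r" "\<phi> p \<in> ball c r" "\<phi> p \<noteq> c"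
    "cball c r \<subseteq> \<phi> ` (U \<inter> UNIV)" by (rule chart_ball[OF open_UNIV UNIV_I])
  let ?g = "\<lambda>x. flat 0 (r\<^sup>2 - (x - c) \<bullet> (x - c))"
  let ?K = "inv_into U \<phi> ` cball c r"
  let ?c = "\<lambda>f x. f (inv_into U \<phi> x)"
  define v where "v = c - \<phi> p"
  \<comment> \<open>The value 0 on non-smooth functions is forced by the convention in
    \<open>tangent_space\<close>.\<close>
  define X where "X q f = (if q \<in> U \<and> f \<in> SF then ?g (\<phi> q) * frechet_derivative (?c f) (at (\<phi> q)) v else 0)" for q f
  define \<rho> where "\<rho> q = (if q \<in> U then ?g (\<phi> q) else 0)" for q
  note g = smooth_bump[OF c(3), where c = c]
  note K = chart_ball_preimage[OF c(1,6)]
  note oU = chartD(1)[OF c(1)]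
  have KU: "?K \<subseteq> U" using K(2) by blast
  have inv: "inv_into U \<phi> (\<phi> q) = q" if "q \<in> U" for q using chartD(3)[OF c(1)] that by simp
  have gs: "smooth_fun_on \<A> U (\<lambda>q. ?g (\<phi> q))"
    by (rule smooth_fun_on_chart[OF c(1) smooth_on_subset[OF g(1)]]) simp
  have z: "?g (\<phi> q) = 0" if "q \<in> U" "q \<notin> ?K" for q
    using K(3)[OF that, THEN g(3)] .
  have \<rho>: "\<rho> \<in> SF"
    by (rule SF_extend[OF K(1) KU oU gs]) (use KU z in \<open>auto simp: \<rho>_def\<close>)
  have cs: "smooth_on (?c f) (\<phi> ` U)" if "f \<in> SF" for f
    using smooth_fun_onD[OF that[unfolded SF_iff] c(1)] by (simp add: smooth_on_def)
  have cd: "(?c f has_derivative frechet_derivative (?c f) (at (\<phi> q))) (at (\<phi> q))"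
    if "f \<in> SF" "q \<in> U" for f q
    using smooth_on_differentiable[OF cs[OF that(1)]] that(2) frechet_derivative_works by blast
  have "(\<lambda>q. X q f) \<in> SF" if f: "f \<in> SF" for f
  proof -
    have "smooth_fun_on \<A> U (\<lambda>q. frechet_derivative (?c f) (at (\<phi> q)) v)"
      by (rule smooth_fun_on_chart[OF c(1) smooth_on_derivative[OF cs[OF f]]])
    then have "smooth_fun_on \<A> U (\<lambda>q. ?g (\<phi> q) * frechet_derivative (?c f) (at (\<phi> q)) v)"
      by (rule smooth_fun_on_mult[OF oU gs])
    then show ?thesis
      by (rule SF_extend[OF K(1) KU oU]) (use KU z f in \<open>auto simp: X_def\<close>)
  qed
  moreover have "X q \<in> TS q" for q
  proof (cases "q \<in> U")
    case True
    have D: "frechet_derivative (?c (f + g)) (at (\<phi> q)) v =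
        frechet_derivative (?c f) (at (\<phi> q)) v + frechet_derivative (?c g) (at (\<phi> q)) v"
      "frechet_derivative (?c (f * g)) (at (\<phi> q)) v =
        f q * frechet_derivative (?c g) (at (\<phi> q)) v + g q * frechet_derivative (?c f) (at (\<phi> q)) v"
      if "f \<in> SF" "g \<in> SF" for f g
      using fun_cong[OF frechet_derivative_at[OF has_derivative_add[OF cd[OF that(1) True] cd[OF that(2) True]]], of v]
        fun_cong[OF frechet_derivative_at[OF has_derivative_mult[OF cd[OF that(1) True] cd[OF that(2) True]]], of v]
      by (simp_all add: plus_fun_def times_fun_def inv[OF True] mult.commute)
    have S: "frechet_derivative (?c (a *\<^sub>R f)) (at (\<phi> q)) v = a * frechet_derivative (?c f) (at (\<phi> q)) v"
      if "f \<in> SF" for f a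
      using fun_cong[OF frechet_derivative_at[OF has_derivative_mult_right[OF cd[OF that True], of a]], of v]
      by (simp add: scaleR_fun_def)
    have "f + g \<in> SF" "f * g \<in> SF" "a *\<^sub>R f \<in> SF" if "f \<in> SF" "g \<in> SF" for f g a
      using that SF_add SF_mult SF_cmult by (auto simp: plus_fun_def times_fun_def scaleR_fun_def)
    then show ?thesis
      using True D S by (simp add: tangent_space_def X_def algebra_simps)
  next
    case False
    then show ?thesis by (simp add: tangent_space_def X_def)
  qed
  ultimately have X: "X \<in> VF" by (simp add: vector_fields_def)
  have "frechet_derivative (?c \<rho>) (at (\<phi> p)) = frechet_derivative ?g (at (\<phi> p))"
  proof (rule frechet_derivative_transform_within_open)
    show "(?c \<rho>) differentiable (at (\<phi> p))" using cd[OF \<rho> c(2)] differentiable_def by blast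
    show "?c \<rho> x = ?g x" if "x \<in> \<phi> ` U" for x
      using that inv by (auto simp: \<rho>_def)
  qed (use chartD(2)[OF c(1)] c(2) in auto)
  then have "X p \<rho> \<noteq> 0"
    using g(2,4)[OF c(4)] c(2,5) \<rho> by (simp add: X_def v_def less_imp_neq)
  then show ?thesis using that X \<rho> by blast
qed

text \<open>Coefficients in identities between endomorphisms are visible only through their action
  on vector fields. Near a point where X f does not vanish, \<open>s\<close> is the quotient of s X
  f by X f.\<close>

lemma SF_scalar:
  assumes "\<And>X f. X \<in> VF \<Longrightarrow> f \<in> SF \<Longrightarrow> (\<lambda>p. s p * X p f) \<in> SF"
  shows "s \<in> SF"
proof (rule SF_quotient_local)
  fix p
  obtain X f where X: "X \<in> VF" "f \<in> SF" "X p f \<noteq> 0" by (rule nonvanishing_field)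
  then have "(\<lambda>q. X q f) \<in> SF" by (simp add: vector_fields_def)
  then show "\<exists>g\<in>SF. \<exists>h\<in>SF. g p \<noteq> 0 \<and> (\<forall>q. g q \<noteq> 0 \<longrightarrow> g q * s q = h q)"
    using assms[OF X(1,2)] X(3)
    by (intro bexI[of _ "\<lambda>q. X q f"] bexI[of _ "\<lambda>q. s q * X q f"]) (simp_all add: mult.commute)
qed

end

section \<open>Vector fields and endomorphism fields\<close>

definition ecomp :: "('a \<Rightarrow> 'a tend) \<Rightarrow> ('a \<Rightarrow> 'a tend) \<Rightarrow> 'a \<Rightarrow> 'a tend" where
  "ecomp E F = (\<lambda>p. E p \<circ> F p)"

definition escale :: "('a \<Rightarrow> real) \<Rightarrow> ('a \<Rightarrow> 'a tend) \<Rightarrow> 'a \<Rightarrow> 'a tend" where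
  "escale f E = (\<lambda>p. f p *\<^sub>R E p)"

lemma scaleR_apply [simp]: "(c *\<^sub>R f) x = c *\<^sub>R f x" for f :: "'a \<Rightarrow> 'b::real_vector"
  by (simp add: scaleR_fun_def)

text \<open>The function type is a ring, so the simplifier collects \<open>X + X\<close> to \<open>2 * X\<close>.\<close>

lemma numeral_times_fun:
  "numeral w * f = numeral w *\<^sub>R f" for f :: "'a \<Rightarrow> 'b \<Rightarrow> real"
proof -
  have "(numeral w :: 'a \<Rightarrow> 'b \<Rightarrow> real) x y = numeral w" for x y
    by (induction w) (simp_all add: numeral.simps)
  then show ?thesis by (simp add: fun_eq_iff times_fun_def)
qed

lemma app_combination [simp]:
  "app (E + F) X = app E X + app F X"
  "app (E - F) X = app E X - app F X"
  "app (- E) X = - app E X"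
  "app (c *\<^sub>R E) X = c *\<^sub>R app E X"
  "app (ecomp E F) X = app E (app F X)"
  "app (escale f E) X = fscale f (app E X)"
  by (simp_all add: app_def fun_eq_iff ecomp_def escale_def fscale_def)

context smooth_manifold
begin

lemma TS_simps:
  assumes "v \<in> TS p" "f \<in> SF" "g \<in> SF"
  shows TS_add: "v (\<lambda>x. f x + g x) = v f + v g"
    and TS_cmult: "v (\<lambda>x. c * f x) = c * v f"
    and TS_mult: "v (\<lambda>x. f x * g x) = f p * v g + g p * v f"
    and TS_minus: "v (\<lambda>x. - f x) = - v f"
    and TS_diff: "v (\<lambda>x. f x - g x) = v f - v g"
proof -
  have *: "\<forall>f\<in>SF. \<forall>g\<in>SF. v (f + g) = v f + v g"
    "\<forall>c. \<forall>f\<in>SF. v (c *\<^sub>R f) = c * v f"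
    "\<forall>f\<in>SF. \<forall>g\<in>SF. v (f * g) = f p * v g + g p * v f"
    using assms(1) unfolding tangent_space_def by blast+
  have add: "v (\<lambda>x. f x + g x) = v f + v g" if "f \<in> SF" "g \<in> SF" for f g
    using *(1) that by (simp add: plus_fun_def)
  have cm: "v (\<lambda>x. c * f x) = c * v f" if "f \<in> SF" for f c
    using *(2) that by (simp add: scaleR_fun_def)
  show "v (\<lambda>x. f x + g x) = v f + v g" "v (\<lambda>x. c * f x) = c * v f"
    using add cm assms by auto
  show "v (\<lambda>x. f x * g x) = f p * v g + g p * v f"
    using *(3) assms by (simp add: times_fun_def)
  show "v (\<lambda>x. - f x) = - v f" using cm[of f "-1"] assms by simp
  show "v (\<lambda>x. f x - g x) = v f - v g"
    using add[OF assms(2) SF_minus[OF assms(3)]] cm[of g "-1"] assms by simp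
qed

lemma TS_const: assumes "v \<in> TS p" shows "v (\<lambda>x. c) = 0"
proof -
  have "v (\<lambda>x. 1) = 0" using TS_mult[OF assms SF_const[of 1] SF_const[of 1]] by simp
  then show ?thesis using TS_cmult[OF assms SF_const[of 1] SF_const[of 1], of c] by simp
qed

lemma TS_outside: "v \<in> TS p \<Longrightarrow> f \<notin> SF \<Longrightarrow> v f = 0"
  by (simp add: tangent_space_def)

lemma TS_I:
  assumes "\<And>f g. f \<in> SF \<Longrightarrow> g \<in> SF \<Longrightarrow> v (\<lambda>x. f x + g x) = v f + v g"
    "\<And>c f. f \<in> SF \<Longrightarrow> v (\<lambda>x. c * f x) = c * v f"
    "\<And>f g. f \<in> SF \<Longrightarrow> g \<in> SF \<Longrightarrow> v (\<lambda>x. f x * g x) = f p * v g + g p * v f"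
    "\<And>f. f \<notin> SF \<Longrightarrow> v f = 0"
  shows "v \<in> TS p"
  using assms by (simp add: tangent_space_def plus_fun_def times_fun_def scaleR_fun_def)

lemma TS_subspace: "subspace (TS p)"
  by (auto simp: subspace_def tangent_space_def algebra_simps)

lemma TS_closed [simp]:
  "0 \<in> TS p" "v \<in> TS p \<Longrightarrow> w \<in> TS p \<Longrightarrow> v + w \<in> TS p" "v \<in> TS p \<Longrightarrow> c *\<^sub>R v \<in> TS p"
  "v \<in> TS p \<Longrightarrow> w \<in> TS p \<Longrightarrow> v - w \<in> TS p" "v \<in> TS p \<Longrightarrow> - v \<in> TS p"
  using TS_subspace[of p] by (auto simp: subspace_def intro: subspace_diff subspace_neg)

lemma VF_TS: "X \<in> VF \<Longrightarrow> X p \<in> TS p"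
  by (simp add: vector_fields_def)

lemma VF_SF: "X \<in> VF \<Longrightarrow> f \<in> SF \<Longrightarrow> (\<lambda>p. X p f) \<in> SF"
  by (simp add: vector_fields_def)

lemma VF_I: "(\<And>p. X p \<in> TS p) \<Longrightarrow> (\<And>f. f \<in> SF \<Longrightarrow> (\<lambda>p. X p f) \<in> SF) \<Longrightarrow> X \<in> VF"
  by (simp add: vector_fields_def)

lemma VF_closed [simp]:
  "X \<in> VF \<Longrightarrow> Y \<in> VF \<Longrightarrow> X + Y \<in> VF"
  "X \<in> VF \<Longrightarrow> Y \<in> VF \<Longrightarrow> X - Y \<in> VF"
  "X \<in> VF \<Longrightarrow> - X \<in> VF"
  "X \<in> VF \<Longrightarrow> c *\<^sub>R X \<in> VF"
  "X \<in> VF \<Longrightarrow> f \<in> SF \<Longrightarrow> fscale f X \<in> VF"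
  by (rule VF_I; simp add: fscale_def VF_TS[of X] VF_TS[of Y] SF_add SF_diff SF_minus SF_cmult SF_mult
      VF_SF[of X] VF_SF[of Y])+

lemma bracket_VF [simp]: assumes X: "X \<in> VF" and Y: "Y \<in> VF" shows "lie_bracket X Y \<in> VF"
proof (rule VF_I)
  show "(\<lambda>p. lie_bracket X Y p f) \<in> SF" if "f \<in> SF" for f
    by (simp add: lie_bracket_def SF_diff that VF_SF[OF X] VF_SF[OF Y])
  show "lie_bracket X Y p \<in> TS p" for p
  proof (rule TS_I)
    fix f g assume f: "f \<in> SF" and g: "g \<in> SF"
    note XY = VF_TS[OF X] VF_TS[OF Y]
    show "lie_bracket X Y p (\<lambda>x. f x + g x) = lie_bracket X Y p f + lie_bracket X Y p g"
      using f g by (simp add: lie_bracket_def TS_add[OF XY(1)] TS_add[OF XY(2)] VF_SF[OF X] VF_SF[OF Y])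
    show "lie_bracket X Y p (\<lambda>x. f x * g x) = f p * lie_bracket X Y p g + g p * lie_bracket X Y p f"
      using f g by (simp add: lie_bracket_def TS_mult[OF XY(1)] TS_mult[OF XY(2)] TS_add[OF XY(1)]
          TS_add[OF XY(2)] SF_mult VF_SF[OF X] VF_SF[OF Y] algebra_simps)
  next
    fix c f assume f: "f \<in> SF"
    note XY = VF_TS[OF X] VF_TS[OF Y]
    show "lie_bracket X Y p (\<lambda>x. c * f x) = c * lie_bracket X Y p f"
      using f
      by (simp add: lie_bracket_def TS_cmult[OF XY(1) _ f] TS_cmult[OF XY(2) _ f] VF_SF[OF X]
          VF_SF[OF Y] algebra_simps)
  next
    fix f assume f: "f \<notin> SF"
    have "X q f = 0" "Y q f = 0" for q
      using TS_outside[OF VF_TS f] X Y by auto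
    then show "lie_bracket X Y p f = 0"
      by (simp add: lie_bracket_def TS_const[OF VF_TS[OF X]] TS_const[OF VF_TS[OF Y]])
  qed
qed

lemma VF_deriv_outside: "X \<in> VF \<Longrightarrow> f \<notin> SF \<Longrightarrow> X p f = 0"
  by (rule TS_outside[OF VF_TS])

text \<open>Outside the smooth functions both sides of the following identities vanish, which is why they
  hold as equations between functions on all of \<^typ>\<open>'a \<Rightarrow> real\<close>.\<close>

lemma VF_eqI:
  assumes "X \<in> VF" "Y \<in> VF" "\<And>p f. f \<in> SF \<Longrightarrow> X p f = Y p f"
  shows "X = Y"
proof (intro ext)
  show "X p f = Y p f" for p f
    using assms(3) VF_deriv_outside[OF assms(1)] VF_deriv_outside[OF assms(2)] by (cases "f \<in> SF") auto
qed

lemma bracket_skew: "lie_bracket Y X = - lie_bracket X Y"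
  by (simp add: lie_bracket_def fun_eq_iff)

lemma bracket_simps [simp]:
  assumes "X \<in> VF" "Y \<in> VF" "Z \<in> VF"
  shows "lie_bracket (X + Y) Z = lie_bracket X Z + lie_bracket Y Z"
    and "lie_bracket (X - Y) Z = lie_bracket X Z - lie_bracket Y Z"
    and "lie_bracket X (Y + Z) = lie_bracket X Y + lie_bracket X Z"
    and "lie_bracket X (Y - Z) = lie_bracket X Y - lie_bracket X Z"
  by ((rule VF_eqI; (use assms in \<open>simp; fail\<close>)?),
      use assms in \<open>simp add: lie_bracket_def assms[THEN VF_TS, THEN TS_add] assms[THEN VF_TS, THEN TS_diff]
        assms[THEN VF_SF]\<close>)+

lemma bracket_scale [simp]:
  assumes "X \<in> VF" "Y \<in> VF"
  shows "lie_bracket (c *\<^sub>R X) Y = c *\<^sub>R lie_bracket X Y"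
    and "lie_bracket X (c *\<^sub>R Y) = c *\<^sub>R lie_bracket X Y"
    and "lie_bracket (- X) Y = - lie_bracket X Y"
    and "lie_bracket X (- Y) = - lie_bracket X Y"
  by ((rule VF_eqI; (use assms in \<open>simp; fail\<close>)?),
      use assms in \<open>simp add: lie_bracket_def algebra_simps
        assms[THEN VF_TS, THEN TS_cmult, OF _ SF_const[of 0]]
        assms[THEN VF_TS, THEN TS_minus, OF _ SF_const[of 0]] assms[THEN VF_SF]\<close>)+

lemma bracket_fscale [simp]:
  assumes "X \<in> VF" "Y \<in> VF" "f \<in> SF"
  shows "lie_bracket (fscale f X) Y = fscale f (lie_bracket X Y) - fscale (\<lambda>p. Y p f) X"
    and "lie_bracket X (fscale f Y) = fscale f (lie_bracket X Y) + fscale (\<lambda>p. X p f) Y"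
  by ((rule VF_eqI; (use assms in \<open>simp add: VF_SF; fail\<close>)?),
      use assms in \<open>simp add: lie_bracket_def fscale_def algebra_simps TS_mult[OF VF_TS[OF assms(1)]]
      TS_mult[OF VF_TS[OF assms(2)]] assms(1,2)[THEN VF_SF]\<close>)+

section \<open>Endomorphisms of tangent spaces and their smooth sections\<close>

lemma TE_simps:
  assumes "E \<in> tangent_end \<A> p"
  shows TE_closed: "v \<in> TS p \<Longrightarrow> E v \<in> TS p"
    and TE_add: "v \<in> TS p \<Longrightarrow> w \<in> TS p \<Longrightarrow> E (v + w) = E v + E w"
    and TE_scale: "v \<in> TS p \<Longrightarrow> E (c *\<^sub>R v) = c *\<^sub>R E v"
    and TE_minus: "v \<in> TS p \<Longrightarrow> E (- v) = - E v"
    and TE_diff: "v \<in> TS p \<Longrightarrow> w \<in> TS p \<Longrightarrow> E (v - w) = E v - E w"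
    and TE_zero: "E 0 = 0"
    and TE_outside: "v \<notin> TS p \<Longrightarrow> E v = 0"
proof -
  have *: "\<forall>v\<in>TS p. E v \<in> TS p" "\<forall>v\<in>TS p. \<forall>w\<in>TS p. E (v + w) = E v + E w"
    "\<forall>c. \<forall>v\<in>TS p. E (c *\<^sub>R v) = c *\<^sub>R E v" "\<forall>v. v \<notin> TS p \<longrightarrow> E v = 0"
    using assms unfolding tangent_end_def by blast+
  then show "v \<in> TS p \<Longrightarrow> E v \<in> TS p" "v \<in> TS p \<Longrightarrow> w \<in> TS p \<Longrightarrow> E (v + w) = E v + E w"
    "v \<in> TS p \<Longrightarrow> E (c *\<^sub>R v) = c *\<^sub>R E v" "v \<notin> TS p \<Longrightarrow> E v = 0" by auto
  show m: "E (- v) = - E v" if "v \<in> TS p" for v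
    using *(3)[rule_format, of v "-1"] that by simp
  show "v \<in> TS p \<Longrightarrow> w \<in> TS p \<Longrightarrow> E (v - w) = E v - E w"
    using *(2)[rule_format, of v "- w"] m by simp
  show "E 0 = 0" using *(3)[rule_format, of 0 0] by simp
qed

definition "EF = {E. smooth_end_on \<A> UNIV E}"

lemma EF_iff: "E \<in> EF \<longleftrightarrow> (\<forall>p. E p \<in> tangent_end \<A> p) \<and> (\<forall>X\<in>VF. app E X \<in> VF)"
proof -
  have "app E X \<in> VF \<longleftrightarrow> (\<forall>f\<in>SF. (\<lambda>p. app E X p f) \<in> SF)"
    if "\<forall>p. E p \<in> tangent_end \<A> p" "X \<in> VF" for X
  proof -
    have "app E X p \<in> TS p" for p
      using TE_closed[OF _ VF_TS[OF that(2)]] that(1) by (simp add: app_def)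
    then show ?thesis by (simp add: vector_fields_def)
  qed
  then show ?thesis
    by (auto simp: EF_def smooth_end_on_def SF_iff[symmetric])
qed

lemma EF_TE: "E \<in> EF \<Longrightarrow> E p \<in> tangent_end \<A> p"
  by (simp add: EF_iff)

lemma TE_eqI:
  assumes "E \<in> tangent_end \<A> p" "F \<in> tangent_end \<A> p" "\<And>v. v \<in> TS p \<Longrightarrow> E v = F v"
  shows "E = F"
proof (rule ext)
  show "E v = F v" for v
    using assms(3) TE_outside[OF assms(1)] TE_outside[OF assms(2)] by (cases "v \<in> TS p") auto
qed

lemma TE_subspace: "subspace (tangent_end \<A> p)"
  unfolding subspace_def tangent_end_def
  by (auto simp: algebra_simps)

lemma TE_ops:
  "E \<in> tangent_end \<A> p \<Longrightarrow> F \<in> tangent_end \<A> p \<Longrightarrow> E + F \<in> tangent_end \<A> p"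
  "E \<in> tangent_end \<A> p \<Longrightarrow> F \<in> tangent_end \<A> p \<Longrightarrow> E - F \<in> tangent_end \<A> p"
  "E \<in> tangent_end \<A> p \<Longrightarrow> - E \<in> tangent_end \<A> p"
  "E \<in> tangent_end \<A> p \<Longrightarrow> c *\<^sub>R E \<in> tangent_end \<A> p"
  "E \<in> tangent_end \<A> p \<Longrightarrow> F \<in> tangent_end \<A> p \<Longrightarrow> E \<circ> F \<in> tangent_end \<A> p"
proof -
  show "E \<in> tangent_end \<A> p \<Longrightarrow> F \<in> tangent_end \<A> p \<Longrightarrow> E + F \<in> tangent_end \<A> p"
    "E \<in> tangent_end \<A> p \<Longrightarrow> F \<in> tangent_end \<A> p \<Longrightarrow> E - F \<in> tangent_end \<A> p"
    "E \<in> tangent_end \<A> p \<Longrightarrow> - E \<in> tangent_end \<A> p"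
    "E \<in> tangent_end \<A> p \<Longrightarrow> c *\<^sub>R E \<in> tangent_end \<A> p"
    using TE_subspace[of p] subspace_add subspace_diff subspace_neg subspace_scale by blast+
  assume E: "E \<in> tangent_end \<A> p" and F: "F \<in> tangent_end \<A> p"
  show "E \<circ> F \<in> tangent_end \<A> p"
    by (subst tangent_end_def)
      (auto simp: TE_closed[OF E] TE_closed[OF F] TE_add[OF E] TE_add[OF F] TE_scale[OF E]
        TE_scale[OF F] TE_outside[OF F] TE_zero[OF E])
qed

text \<open>The identity function of HOL is not a member of \<open>tangent_end\<close>, whose
  members vanish off the tangent space.\<close>

definition idT :: "'a \<Rightarrow> 'a tend" where
  "idT p v = (if v \<in> TS p then v else 0)"

lemma idT_TE: "idT p \<in> tangent_end \<A> p"
  by (auto simp: tangent_end_def idT_def)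

lemma app_idT [simp]: "X \<in> VF \<Longrightarrow> app idT X = X"
  by (simp add: app_def idT_def VF_TS)

lemma app_VF: "E \<in> EF \<Longrightarrow> X \<in> VF \<Longrightarrow> app E X \<in> VF"
  using EF_iff by blast

lemma app_linear:
  assumes "E \<in> EF" "X \<in> VF" "Y \<in> VF"
  shows "app E (X + Y) = app E X + app E Y"
    and "app E (X - Y) = app E X - app E Y"
    and "app E (- X) = - app E X"
    and "app E (c *\<^sub>R X) = c *\<^sub>R app E X"
    and "app E (fscale f X) = fscale f (app E X)"
proof -
  note TE = TE_simps[OF EF_TE[OF assms(1)]]
  show "app E (X + Y) = app E X + app E Y" "app E (X - Y) = app E X - app E Y"
    "app E (- X) = - app E X" "app E (fscale f X) = fscale f (app E X)"
    "app E (c *\<^sub>R X) = c *\<^sub>R app E X"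
    using VF_TS[OF assms(2)] VF_TS[OF assms(3)] by (simp_all add: app_def fscale_def TE fun_eq_iff)
qed

lemma EF_ops:
  "E \<in> EF \<Longrightarrow> F \<in> EF \<Longrightarrow> E + F \<in> EF"
  "E \<in> EF \<Longrightarrow> F \<in> EF \<Longrightarrow> E - F \<in> EF"
  "E \<in> EF \<Longrightarrow> - E \<in> EF"
  "E \<in> EF \<Longrightarrow> c *\<^sub>R E \<in> EF"
  "E \<in> EF \<Longrightarrow> F \<in> EF \<Longrightarrow> ecomp E F \<in> EF"
  "E \<in> EF \<Longrightarrow> f \<in> SF \<Longrightarrow> escale f E \<in> EF"
  "idT \<in> EF"
proof -
  have *: "G \<in> EF" if "\<And>p. G p \<in> tangent_end \<A> p" "\<And>X. X \<in> VF \<Longrightarrow> app G X \<in> VF" for G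
    using that EF_iff by blast
  note app = app_VF[of E] app_VF[of F]
  show "E \<in> EF \<Longrightarrow> F \<in> EF \<Longrightarrow> E + F \<in> EF" "E \<in> EF \<Longrightarrow> F \<in> EF \<Longrightarrow> E - F \<in> EF"
    "E \<in> EF \<Longrightarrow> - E \<in> EF" "E \<in> EF \<Longrightarrow> c *\<^sub>R E \<in> EF" "E \<in> EF \<Longrightarrow> F \<in> EF \<Longrightarrow> ecomp E F \<in> EF"
    "E \<in> EF \<Longrightarrow> f \<in> SF \<Longrightarrow> escale f E \<in> EF" "idT \<in> EF"
    by (rule *; (simp add: app)?; simp add: TE_ops EF_TE ecomp_def escale_def idT_TE)+
qed

lemma EF_eqI:
  assumes "E \<in> EF" "F \<in> EF" "\<And>p v. v \<in> TS p \<Longrightarrow> E p v = F p v"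
  shows "E = F"
  by (rule ext) (rule TE_eqI[OF EF_TE[OF assms(1)] EF_TE[OF assms(2)] assms(3)])

end

section \<open>Bundles of quaternionic type and removable torsion\<close>

text \<open>\<open>P_mult\<close> is what the argument needs of the imaginary para-quaternions: the
  symmetric part of a product is a scalar and the skew part is again imaginary. It mentions no
  basis, so global sections can be handled without local choices.\<close>

locale quaternionic_bundle = smooth_manifold +
  fixes P :: "'a \<Rightarrow> 'a tend set"
  assumes P_TE: "S \<in> P p \<Longrightarrow> S \<in> tangent_end \<A> p"
    and P_subspace: "subspace (P p)"
    and P_mult: "S \<in> P p \<Longrightarrow> S' \<in> P p \<Longrightarrow>
      \<exists>r. \<exists>Z\<in>P p. \<forall>v\<in>TS p. S (S' v) = r *\<^sub>R v + Z v \<and> S' (S v) = r *\<^sub>R v - Z v"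
begin

abbreviation "PF \<equiv> sections \<A> P"

text \<open>Sections of the bundle of associative algebras generated by \<open>P\<close>. Including
  the identity makes them closed under composition, so removable forms can be composed with sections
  of \<open>P\<close>.\<close>

definition QF :: "('a \<Rightarrow> 'a tend) set" where
  "QF = {E \<in> EF. \<forall>p. \<exists>c. \<exists>S\<in>P p. E p = c *\<^sub>R idT p + S}"

lemma PF_iff: "S \<in> PF \<longleftrightarrow> S \<in> EF \<and> (\<forall>p. S p \<in> P p)"
  by (simp add: sections_def EF_def)

lemma PF_EF: "S \<in> PF \<Longrightarrow> S \<in> EF" and PF_P: "S \<in> PF \<Longrightarrow> S p \<in> P p"
  by (simp_all add: PF_iff)

lemma P_ops:
  "S \<in> P p \<Longrightarrow> S' \<in> P p \<Longrightarrow> S + S' \<in> P p"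
  "S \<in> P p \<Longrightarrow> S' \<in> P p \<Longrightarrow> S - S' \<in> P p"
  "S \<in> P p \<Longrightarrow> c *\<^sub>R S \<in> P p"
  "0 \<in> P p"
  using P_subspace subspace_add subspace_diff subspace_scale subspace_0 by blast+

lemma PF_ops:
  "S \<in> PF \<Longrightarrow> S' \<in> PF \<Longrightarrow> S + S' \<in> PF"
  "S \<in> PF \<Longrightarrow> S' \<in> PF \<Longrightarrow> S - S' \<in> PF"
  "S \<in> PF \<Longrightarrow> c *\<^sub>R S \<in> PF"
  "S \<in> PF \<Longrightarrow> f \<in> SF \<Longrightarrow> escale f S \<in> PF"
  by (simp_all add: PF_iff EF_ops P_ops escale_def[of f S]) (simp add: escale_def[symmetric] EF_ops)

lemma QF_EF: "E \<in> QF \<Longrightarrow> E \<in> EF"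
  by (simp add: QF_def)

lemma PF_QF: "S \<in> PF \<Longrightarrow> S \<in> QF"
  by (auto simp: PF_iff QF_def intro: exI[of _ 0])

lemma idT_QF: "idT \<in> QF"
  using P_ops(4) by (auto simp: QF_def EF_ops intro!: exI[of _ 1] bexI[of _ 0])

lemma QF_escale: assumes "E \<in> QF" "f \<in> SF" shows "escale f E \<in> QF"
proof -
  have "\<exists>c. \<exists>S\<in>P p. escale f E p = c *\<^sub>R idT p + S" for p
  proof -
    obtain c S where "S \<in> P p" "E p = c *\<^sub>R idT p + S" using assms(1) unfolding QF_def by blast
    then have "f p *\<^sub>R S \<in> P p" "escale f E p = (f p * c) *\<^sub>R idT p + f p *\<^sub>R S"
      by (simp_all add: P_ops escale_def scaleR_add_right)
    then show ?thesis by blast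
  qed
  then show ?thesis using assms by (simp add: QF_def EF_ops)
qed

lemma QF_scaleR: "E \<in> QF \<Longrightarrow> c *\<^sub>R E \<in> QF"
  using QF_escale[of E "\<lambda>_. c"] by (simp add: escale_def scaleR_fun_def)

lemma QF_add: assumes "E \<in> QF" "F \<in> QF" shows "E + F \<in> QF"
proof -
  have "\<exists>c. \<exists>S\<in>P p. (E + F) p = c *\<^sub>R idT p + S" for p
  proof -
    obtain c S d S' where "S \<in> P p" "E p = c *\<^sub>R idT p + S" "S' \<in> P p" "F p = d *\<^sub>R idT p + S'"
      using assms unfolding QF_def by blast
    then have "S + S' \<in> P p" "(E + F) p = (c + d) *\<^sub>R idT p + (S + S')"
      by (simp_all add: P_ops scaleR_add_left)
    then show ?thesis by blast
  qed
  then show ?thesis using assms by (simp add: QF_def EF_ops)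
qed

lemma QF_diff: "E \<in> QF \<Longrightarrow> F \<in> QF \<Longrightarrow> E - F \<in> QF"
  using QF_add[of E "- 1 *\<^sub>R F"] QF_scaleR[of F "-1"] by simp

lemma QF_ecomp: assumes "E \<in> QF" "F \<in> QF" shows "ecomp E F \<in> QF"
proof -
  have "\<exists>c. \<exists>S\<in>P p. ecomp E F p = c *\<^sub>R idT p + S" for p
  proof -
    obtain c S d S' where S: "S \<in> P p" "E p = c *\<^sub>R idT p + S" "S' \<in> P p" "F p = d *\<^sub>R idT p + S'"
      using assms unfolding QF_def by blast
    obtain r Z where Z: "Z \<in> P p" "\<And>v. v \<in> TS p \<Longrightarrow> S (S' v) = r *\<^sub>R v + Z v"
      using P_mult[OF S(1,3)] by blast
    let ?R = "c *\<^sub>R S' + d *\<^sub>R S + Z"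
    have R: "?R \<in> P p" using S Z by (intro P_ops)
    have "ecomp E F p = (c * d + r) *\<^sub>R idT p + ?R"
    proof (rule TE_eqI)
      show "ecomp E F p \<in> tangent_end \<A> p"
        using assms EF_TE[OF EF_ops(5)] QF_EF by blast
      show "(c * d + r) *\<^sub>R idT p + ?R \<in> tangent_end \<A> p"
        by (intro TE_ops idT_TE P_TE[OF R])
      fix v assume v: "v \<in> TS p"
      note S'v = TE_closed[OF P_TE[OF S(3)] v]
      show "ecomp E F p v = ((c * d + r) *\<^sub>R idT p + ?R) v"
        using v S'v Z(2)[OF v]
        by (simp add: ecomp_def S(2,4) idT_def TE_add[OF P_TE[OF S(1)]] TE_scale[OF P_TE[OF S(1)]]
            scaleR_add_right scaleR_add_left)
    qed
    then show ?thesis using R by blast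
  qed
  then show ?thesis using assms by (simp add: QF_def EF_ops)
qed

lemmas QF_ops = PF_QF idT_QF QF_escale QF_scaleR QF_add QF_diff QF_ecomp

text \<open>The scalar part drops out and twice the skew part of the product remains. This is why a
  one-form with values in \<open>QF\<close> can be subtracted from a connection that preserves
  \<open>P\<close>.\<close>

lemma commutator_PF: assumes "E \<in> QF" "F \<in> PF" shows "ecomp E F - ecomp F E \<in> PF"
proof -
  note FE = PF_EF[OF assms(2)]
  have "(ecomp E F - ecomp F E) p \<in> P p" for p
  proof -
    obtain c S where S: "S \<in> P p" "E p = c *\<^sub>R idT p + S"
      using assms unfolding QF_def by blast
    note F = PF_P[OF assms(2), of p]
    obtain r Z where Z: "Z \<in> P p"
      "\<And>v. v \<in> TS p \<Longrightarrow> S (F p v) = r *\<^sub>R v + Z v" "\<And>v. v \<in> TS p \<Longrightarrow> F p (S v) = r *\<^sub>R v - Z v"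
      using P_mult[OF S(1) F] by blast
    have "(ecomp E F - ecomp F E) p = 2 *\<^sub>R Z"
    proof (rule TE_eqI)
      show "(ecomp E F - ecomp F E) p \<in> tangent_end \<A> p"
        by (rule EF_TE) (intro EF_ops FE QF_EF assms)
      show "2 *\<^sub>R Z \<in> tangent_end \<A> p"
        by (intro TE_ops P_TE[OF Z(1)])
      fix v assume v: "v \<in> TS p"
      note Fv = TE_closed[OF P_TE[OF F] v]
      show "(ecomp E F - ecomp F E) p v = (2 *\<^sub>R Z) v"
        using v Fv Z(2,3)[OF v] TE_closed[OF P_TE[OF S(1)] v]
        by (simp add: ecomp_def S(2) idT_def TE_add[OF P_TE[OF F]] TE_scale[OF P_TE[OF F]] scaleR_2)
    qed
    then show ?thesis using P_ops(3)[OF Z(1)] by simp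
  qed
  then show ?thesis using assms FE QF_EF by (simp add: PF_iff EF_ops)
qed

text \<open>For anticommuting sections the composition is half the commutator.\<close>

lemma ecomp_PF:
  assumes S: "S \<in> PF" and S': "S' \<in> PF"
    and anti: "\<And>p v. v \<in> TS p \<Longrightarrow> S p (S' p v) = - S' p (S p v)"
  shows "ecomp S S' \<in> PF"
proof -
  have "ecomp S S' = (1/2) *\<^sub>R (ecomp S S' - ecomp S' S)"
  proof (rule EF_eqI)
    show "ecomp S S' p v = ((1/2) *\<^sub>R (ecomp S S' - ecomp S' S)) p v" if "v \<in> TS p" for p v
      using anti[OF that] by (simp add: ecomp_def fun_eq_iff)
  qed (intro EF_ops PF_EF S S')+
  then show ?thesis
    using PF_ops(3)[OF commutator_PF[OF PF_QF[OF S] S']] by metis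
qed

text \<open>The scalar is twice the Lorentzian product of the two sections. Its smoothness is
  obtained here from \<open>SF_scalar\<close>, without a local basis.\<close>

lemma anticommutator_SF:
  assumes "S \<in> PF" "S' \<in> PF"
  obtains s where "s \<in> SF" "\<And>p v. v \<in> TS p \<Longrightarrow> S p (S' p v) + S' p (S p v) = s p *\<^sub>R v"
proof -
  have "\<exists>r. \<forall>v\<in>TS p. S p (S' p v) + S' p (S p v) = r *\<^sub>R v" for p
  proof -
    obtain r Z where "\<And>v. v \<in> TS p \<Longrightarrow> S p (S' p v) = r *\<^sub>R v + Z v \<and> S' p (S p v) = r *\<^sub>R v - Z v"
      using P_mult[OF PF_P[OF assms(1)] PF_P[OF assms(2)]] by blast
    then have "\<forall>v\<in>TS p. S p (S' p v) + S' p (S p v) = (2 * r) *\<^sub>R v"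
      by (simp add: scaleR_2 flip: scaleR_scaleR)
    then show ?thesis by blast
  qed
  then obtain s where s: "\<And>p v. v \<in> TS p \<Longrightarrow> S p (S' p v) + S' p (S p v) = s p *\<^sub>R v"
    by metis
  have "s \<in> SF"
  proof (rule SF_scalar)
    fix X f assume X: "X \<in> VF" and f: "f \<in> SF"
    have "app S (app S' X) + app S' (app S X) \<in> VF"
      by (intro VF_closed app_VF PF_EF assms X)
    then have "(\<lambda>p. (app S (app S' X) + app S' (app S X)) p f) \<in> SF"
      using f by (rule VF_SF)
    moreover have "(app S (app S' X) + app S' (app S X)) p f = s p * X p f" for p
      using s[OF VF_TS[OF X], of p] by (simp add: app_def fun_eq_iff)
    ultimately show "(\<lambda>p. s p * X p f) \<in> SF" by simp
  qed
  then show ?thesis using that s by blast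
qed

text \<open>The torsion of a connection can be removed without leaving the connections that preserve
  \<^term>\<open>P\<close> if it is the skew-symmetrisation of a one-form with values in \<^term>\<open>QF\<close>.\<close>

definition QF_form :: "(('a \<Rightarrow> 'a tvec) \<Rightarrow> 'a \<Rightarrow> 'a tend) \<Rightarrow> bool" where
  "QF_form S \<longleftrightarrow> (\<forall>X\<in>VF. S X \<in> QF) \<and> (\<forall>X\<in>VF. \<forall>Y\<in>VF. S (X + Y) = S X + S Y) \<and>
     (\<forall>f\<in>SF. \<forall>X\<in>VF. S (fscale f X) = escale f (S X))"

definition removable :: "(('a \<Rightarrow> 'a tvec) \<Rightarrow> ('a \<Rightarrow> 'a tvec) \<Rightarrow> 'a \<Rightarrow> 'a tvec) \<Rightarrow> bool" where
  "removable F \<longleftrightarrow> (\<exists>S. QF_form S \<and> (\<forall>X\<in>VF. \<forall>Y\<in>VF. F X Y = app (S X) Y - app (S Y) X))"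

lemma removableI:
  assumes "\<And>X. X \<in> VF \<Longrightarrow> S X \<in> QF" "\<And>X Y. X \<in> VF \<Longrightarrow> Y \<in> VF \<Longrightarrow> S (X + Y) = S X + S Y"
    "\<And>f X. f \<in> SF \<Longrightarrow> X \<in> VF \<Longrightarrow> S (fscale f X) = escale f (S X)"
    "\<And>X Y. X \<in> VF \<Longrightarrow> Y \<in> VF \<Longrightarrow> F X Y = app (S X) Y - app (S Y) X"
  shows "removable F"
  using assms unfolding removable_def QF_form_def by blast

lemma QF_formD:
  assumes "QF_form S"
  shows "X \<in> VF \<Longrightarrow> S X \<in> QF" "X \<in> VF \<Longrightarrow> Y \<in> VF \<Longrightarrow> S (X + Y) = S X + S Y"
    "f \<in> SF \<Longrightarrow> X \<in> VF \<Longrightarrow> S (fscale f X) = escale f (S X)"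
  using assms unfolding QF_form_def by blast+

lemma removable_cong:
  assumes "removable F" "\<And>X Y. X \<in> VF \<Longrightarrow> Y \<in> VF \<Longrightarrow> G X Y = F X Y"
  shows "removable G"
  using assms unfolding removable_def by auto

lemma fscale_add: "fscale f (X + Y) = fscale f X + fscale f Y"
  and fscale_diff: "fscale f (X - Y) = fscale f X - fscale f Y"
  by (simp_all add: fscale_def fun_eq_iff algebra_simps)

lemma ecomp_add:
  assumes "K \<in> EF" "E \<in> EF" "F \<in> EF"
  shows "ecomp K (E + F) = ecomp K E + ecomp K F" "ecomp (E + F) K = ecomp E K + ecomp F K"
  by (rule EF_eqI; (intro EF_ops assms; assumption)?;
      simp add: ecomp_def TE_simps[OF EF_TE[OF assms(1)]] TE_closed[OF EF_TE[OF assms(2)]]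
        TE_closed[OF EF_TE[OF assms(3)]])+

lemma ecomp_escale:
  assumes "K \<in> EF" "E \<in> EF" "f \<in> SF"
  shows "ecomp K (escale f E) = escale f (ecomp K E)" "ecomp (escale f E) K = escale f (ecomp E K)"
  by (rule EF_eqI; (intro EF_ops assms; assumption)?;
      simp add: ecomp_def escale_def TE_simps[OF EF_TE[OF assms(1)]] TE_closed[OF EF_TE[OF assms(2)]])+

lemma escale_add: "escale f (E + F) = escale f E + escale f F"
  by (simp add: escale_def fun_eq_iff algebra_simps)

lemmas ecomp_linear = ecomp_add ecomp_escale escale_add

section \<open>Operations that preserve removability\<close>

lemma removable_add:
  assumes "removable F" "removable G" shows "removable (\<lambda>X Y. F X Y + G X Y)"
proof -
  obtain S where S: "QF_form S" "\<forall>X\<in>VF. \<forall>Y\<in>VF. F X Y = app (S X) Y - app (S Y) X"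
    using assms(1) unfolding removable_def by blast
  obtain R where R: "QF_form R" "\<forall>X\<in>VF. \<forall>Y\<in>VF. G X Y = app (R X) Y - app (R Y) X"
    using assms(2) unfolding removable_def by blast
  show ?thesis
    by (rule removableI[of "\<lambda>X. S X + R X"])
      (simp_all add: S R QF_formD[OF S(1)] QF_formD[OF R(1)] QF_ops escale_add)
qed

lemma removable_left:
  assumes "removable F" "K \<in> QF" shows "removable (\<lambda>X Y. app K (F X Y))"
proof -
  obtain S where S: "QF_form S" "\<forall>X\<in>VF. \<forall>Y\<in>VF. F X Y = app (S X) Y - app (S Y) X"
    using assms(1) unfolding removable_def by blast
  note E = QF_EF[OF assms(2)] QF_EF[OF QF_formD(1)[OF S(1)]]
  show ?thesis
    by (rule removableI[of "\<lambda>X. ecomp K (S X)"])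
      (simp_all add: S QF_formD[OF S(1)] assms QF_ops ecomp_linear E app_linear app_VF)
qed

lemma removable_fscale:
  assumes "removable F" "f \<in> SF" shows "removable (\<lambda>X Y. fscale f (F X Y))"
proof -
  have "F X Y \<in> VF" if "X \<in> VF" "Y \<in> VF" for X Y
    using assms(1) that QF_EF app_VF VF_closed(2) unfolding removable_def QF_form_def by auto
  then show ?thesis
    by (intro removable_cong[OF removable_left[OF assms(1) QF_escale[OF idT_QF assms(2)]]]) simp
qed

lemma removable_scaleR:
  assumes "removable F" shows "removable (\<lambda>X Y. c *\<^sub>R F X Y)"
  using removable_fscale[OF assms SF_const[of c]] by (simp add: fscale_def scaleR_fun_def)

lemma removable_diff:
  assumes "removable F" "removable G" shows "removable (\<lambda>X Y. F X Y - G X Y)"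
  using removable_add[OF assms(1) removable_scaleR[OF assms(2), of "-1"]] by simp

lemma removable_both:
  assumes "removable F" "K \<in> QF" shows "removable (\<lambda>X Y. F (app K X) (app K Y))"
proof -
  obtain S where S: "QF_form S" "\<forall>X\<in>VF. \<forall>Y\<in>VF. F X Y = app (S X) Y - app (S Y) X"
    using assms(1) unfolding removable_def by blast
  note E = QF_EF[OF assms(2)] QF_EF[OF QF_formD(1)[OF S(1)]]
  show ?thesis
    by (rule removableI[of "\<lambda>X. ecomp (S (app K X)) K"])
      (simp_all add: S QF_formD[OF S(1)] assms QF_ops ecomp_linear E app_linear app_VF)
qed

text \<open>Inserting \<open>K\<close> into one argument alone would destroy skew-symmetry; the sum
  over both arguments restores it.\<close>

lemma removable_sym:
  assumes "removable F" "K \<in> QF" shows "removable (\<lambda>X Y. F (app K X) Y + F X (app K Y))"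
proof -
  obtain S where S: "QF_form S" "\<forall>X\<in>VF. \<forall>Y\<in>VF. F X Y = app (S X) Y - app (S Y) X"
    using assms(1) unfolding removable_def by blast
  note E = QF_EF[OF assms(2)] QF_EF[OF QF_formD(1)[OF S(1)]]
  show ?thesis
    by (rule removableI[of "\<lambda>X. S (app K X) + ecomp (S X) K"])
      (simp_all add: S QF_formD[OF S(1)] assms QF_ops ecomp_linear E app_linear app_VF)
qed

end

section \<open>The Obata connection of an anticommuting pair\<close>

text \<open>The sign of I^2 is left open while A^2 = 1 is fixed: with one negative and two positive
  directions, the orthogonal complement of any non-null vector contains vectors of norm 1.\<close>

locale quaternionic_frame = quaternionic_bundle +
  fixes I A :: "'a \<Rightarrow> 'a tend" and \<epsilon> :: real
  assumes I_PF: "I \<in> PF" and A_PF: "A \<in> PF" and eps: "\<epsilon> = 1 \<or> \<epsilon> = - 1"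
    and I_I: "v \<in> TS p \<Longrightarrow> I p (I p v) = \<epsilon> *\<^sub>R v"
    and A_A: "v \<in> TS p \<Longrightarrow> A p (A p v) = v"
    and A_I: "v \<in> TS p \<Longrightarrow> A p (I p v) = - I p (A p v)"
    and nijenhuis_I: "X \<in> VF \<Longrightarrow> Y \<in> VF \<Longrightarrow> nijenhuis \<epsilon> I X Y = 0"
begin

abbreviation "i \<equiv> app I"
abbreviation "a \<equiv> app A"
abbreviation "br \<equiv> lie_bracket"

lemma eps_eps [simp]: "\<epsilon> * \<epsilon> = 1" "\<epsilon> * (\<epsilon> * x) = x"
  using eps by auto

lemma frame_VF [simp]: "X \<in> VF \<Longrightarrow> i X \<in> VF" "X \<in> VF \<Longrightarrow> a X \<in> VF"
  using I_PF A_PF PF_EF app_VF by blast+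

lemmas i_linear [simp] = app_linear[OF PF_EF[OF I_PF]]
lemmas a_linear [simp] = app_linear[OF PF_EF[OF A_PF]]

lemma frame_mult [simp]:
  assumes "X \<in> VF"
  shows "i (i X) = \<epsilon> *\<^sub>R X" "a (a X) = X" "a (i X) = - i (a X)"
  using VF_TS[OF assms] by (simp_all add: app_def fun_eq_iff I_I A_A A_I)

lemma bracket_i:
  assumes "X \<in> VF" "Y \<in> VF"
  shows "br (i X) (i Y) = i (br (i X) Y) + i (br X (i Y)) - \<epsilon> *\<^sub>R br X Y"
  using nijenhuis_I[OF assms] assms by (simp add: nijenhuis_def algebra_simps eq_neg_iff_add_eq_0)

definition B :: "'a \<Rightarrow> 'a tend" where "B = ecomp I A"

lemma B_PF: "B \<in> PF"
  unfolding B_def by (rule ecomp_PF[OF I_PF A_PF]) (simp add: A_I)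

lemma app_B [simp]: "app B X = i (a X)"
  by (simp add: B_def)

definition comb :: "('a \<Rightarrow> real) \<Rightarrow> ('a \<Rightarrow> real) \<Rightarrow> ('a \<Rightarrow> real) \<Rightarrow> 'a \<Rightarrow> 'a tend" where
  "comb f g h = escale f I + escale g A + escale h B"

lemma comb_PF: "f \<in> SF \<Longrightarrow> g \<in> SF \<Longrightarrow> h \<in> SF \<Longrightarrow> comb f g h \<in> PF"
  unfolding comb_def by (intro PF_ops I_PF A_PF B_PF)

lemma B_mult:
  assumes v: "v \<in> TS p"
  shows "B p v = I p (A p v)" "A p (B p v) = - I p v" "I p (B p v) = \<epsilon> *\<^sub>R A p v"
    "B p (A p v) = I p v" "B p (I p v) = - \<epsilon> *\<^sub>R A p v" "B p (B p v) = - \<epsilon> *\<^sub>R v"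
proof -
  note I = TE_simps[OF EF_TE[OF PF_EF[OF I_PF], of p]] and A = TE_simps[OF EF_TE[OF PF_EF[OF A_PF], of p]]
  show "B p v = I p (A p v)" "A p (B p v) = - I p v" "I p (B p v) = \<epsilon> *\<^sub>R A p v"
    "B p (A p v) = I p v" "B p (I p v) = - \<epsilon> *\<^sub>R A p v" "B p (B p v) = - \<epsilon> *\<^sub>R v"
    using v by (simp_all add: B_def ecomp_def A_I A_A I_I I A)
qed

text \<open>The coefficients are read off from anticommutators. The remainder anticommutes with \<^term>\<open>I\<close>, \<^term>\<open>A\<close>
  and \<^term>\<open>B\<close>, hence also commutes with \<^term>\<open>B\<close>, and so vanishes.\<close>

lemma PF_comb:
  assumes S: "S \<in> PF"
  obtains f g h where "f \<in> SF" "g \<in> SF" "h \<in> SF" "S = comb f g h"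
proof -
  obtain x where x: "x \<in> SF" "\<And>p v. v \<in> TS p \<Longrightarrow> S p (I p v) + I p (S p v) = x p *\<^sub>R v"
    using anticommutator_SF[OF S I_PF] by blast
  obtain y where y: "y \<in> SF" "\<And>p v. v \<in> TS p \<Longrightarrow> S p (A p v) + A p (S p v) = y p *\<^sub>R v"
    using anticommutator_SF[OF S A_PF] by blast
  obtain z where z: "z \<in> SF" "\<And>p v. v \<in> TS p \<Longrightarrow> S p (B p v) + B p (S p v) = z p *\<^sub>R v"
    using anticommutator_SF[OF S B_PF] by blast
  \<comment> \<open>The squares \<epsilon>, 1 and -\<epsilon> of \<open>I\<close>, \<open>A\<close>
    and \<open>B\<close> give the combination the anticommutators 2 \<epsilon> f, 2 g and -2
    \<epsilon> h with them. As \<epsilon> is its own inverse, solving for f, g and h gives these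
    values.\<close>
  let ?f = "\<lambda>p. \<epsilon> / 2 * x p" and ?g = "\<lambda>p. 1 / 2 * y p" and ?h = "\<lambda>p. - (\<epsilon> / 2) * z p"
  have sf: "?f \<in> SF" "?g \<in> SF" "?h \<in> SF" by (intro SF_cmult x y z)+
  have "S p v = comb ?f ?g ?h p v" if v: "v \<in> TS p" for p v
  proof -
    define W where "W = S p - comb ?f ?g ?h p"
    have W: "W \<in> tangent_end \<A> p"
      unfolding W_def by (intro TE_ops EF_TE PF_EF S comb_PF sf)
    note TE = TE_simps[OF EF_TE[OF PF_EF[OF I_PF], of p]] TE_simps[OF EF_TE[OF PF_EF[OF A_PF], of p]]
      TE_simps[OF EF_TE[OF PF_EF[OF B_PF], of p]] TE_closed[OF EF_TE[OF PF_EF[OF S], of p]]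
    have W_v: "W v = S p v - (?f p *\<^sub>R I p v + ?g p *\<^sub>R A p v + ?h p *\<^sub>R B p v)" for v
      by (simp add: W_def comb_def escale_def)
    have "W (I p v) = - I p (W v)" if v: "v \<in> TS p" for v
    proof -
      have "S p (I p v) = x p *\<^sub>R v - I p (S p v)" using x(2)[OF v] by (simp add: algebra_simps)
      then show ?thesis
        using v by (simp add: W_v TE I_I A_I B_mult(3,5) scaleR_add_right scaleR_diff_right)
            (simp add: fun_eq_iff field_simps)
    qed
    moreover have "W (A p v) = - A p (W v)" if v: "v \<in> TS p" for v
    proof -
      have "S p (A p v) = y p *\<^sub>R v - A p (S p v)" using y(2)[OF v] by (simp add: algebra_simps)
      then show ?thesis
        using v by (simp add: W_v TE A_A A_I B_mult(2,4) scaleR_add_right scaleR_diff_right)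
            (simp add: fun_eq_iff field_simps)
    qed
    moreover have "W (B p v) = - B p (W v)" if v: "v \<in> TS p" for v
    proof -
      have "S p (B p v) = z p *\<^sub>R v - B p (S p v)" using z(2)[OF v] by (simp add: algebra_simps)
      then show ?thesis
        using v by (simp add: W_v TE B_mult(2-) scaleR_add_right scaleR_diff_right)
            (simp add: fun_eq_iff field_simps)
    qed
    ultimately have "B p (W v) = - B p (W v)"
      using v by (simp add: B_mult(1) TE TE_closed[OF W])
    then have "2 *\<^sub>R B p (W v) = 0" unfolding scaleR_2 by (simp add: eq_neg_iff_add_eq_0)
    then have "B p (W v) = 0" by simp
    then have "B p (B p (W v)) = 0" using TE_zero[OF P_TE[OF PF_P[OF B_PF]]] by simp
    then have "W v = 0" using v TE_closed[OF W v] eps by (auto simp: B_mult(6))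
    then show ?thesis by (simp add: W_def)
  qed
  then have "S = comb ?f ?g ?h" by (intro EF_eqI PF_EF S comb_PF sf)
  then show ?thesis using that sf by blast
qed

section \<open>The Obata connection and its torsion\<close>

definition E :: "('a \<Rightarrow> 'a tvec) \<Rightarrow> ('a \<Rightarrow> 'a tvec) \<Rightarrow> 'a \<Rightarrow> 'a tvec" where
  "E X Y = (1/2) *\<^sub>R (br X Y - \<epsilon> *\<^sub>R i (br (i X) Y))"

text \<open>The Obata connection of \<^term>\<open>I\<close> and \<^term>\<open>A\<close>. For \<open>\<epsilon> = -1\<close>, \<^term>\<open>E X Y\<close> is the derivative of \<open>Y\<close> by the
  Dolbeault operator of the holomorphic tangent bundle, and conjugating it by \<^term>\<open>A\<close> supplies the
  missing part.\<close>

definition D :: "('a \<Rightarrow> 'a tvec) \<Rightarrow> ('a \<Rightarrow> 'a tvec) \<Rightarrow> 'a \<Rightarrow> 'a tvec" where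
  "D X Y = E X Y + a (E X (a Y))"

definition T :: "('a \<Rightarrow> 'a tvec) \<Rightarrow> ('a \<Rightarrow> 'a tvec) \<Rightarrow> 'a \<Rightarrow> 'a tvec" where
  "T X Y = D X Y - D Y X - br X Y"

lemma E_VF [simp]: "X \<in> VF \<Longrightarrow> Y \<in> VF \<Longrightarrow> E X Y \<in> VF"
  by (simp add: E_def)

lemma E_add [simp]:
  assumes "X \<in> VF" "Y \<in> VF" "Z \<in> VF"
  shows "E (X + Y) Z = E X Z + E Y Z" "E X (Y + Z) = E X Y + E X Z"
  using assms by (simp_all add: E_def scaleR_add_right scaleR_diff_right)

lemma E_minus [simp]:
  assumes "X \<in> VF" "Y \<in> VF"
  shows "E (- X) Y = - E X Y" "E X (- Y) = - E X Y"
  using assms by (simp_all add: E_def scaleR_diff_right)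

text \<open>The first rule is algebra; the second is where the vanishing of the Nijenhuis tensor of
  \<open>I\<close> enters.\<close>

lemma E_i [simp]:
  assumes "X \<in> VF" "Y \<in> VF"
  shows "E (i X) Y = - i (E X Y)" "E X (i Y) = i (E X Y)"
  using assms by (simp_all add: E_def bracket_i scaleR_add_right scaleR_diff_right)

text \<open>\<open>E\<close> carries only half of the Leibniz term, together with an error along
  \<open>i X\<close>. In \<open>D\<close> the conjugate by \<open>A\<close> supplies the other half,
  and the errors cancel because \<open>A\<close> anticommutes with \<open>I\<close>.\<close>

lemma E_fscale:
  assumes "X \<in> VF" "Y \<in> VF" "f \<in> SF"
  shows "E (fscale f X) Y = fscale f (E X Y)"
    "E X (fscale f Y) = fscale f (E X Y)
      + (1/2) *\<^sub>R (fscale (\<lambda>p. X p f) Y - \<epsilon> *\<^sub>R fscale (\<lambda>p. i X p f) (i Y))"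
  using assms by (simp_all add: E_def VF_SF fscale_add fscale_diff)
    (simp_all add: fun_eq_iff fscale_def algebra_simps)

lemma D_VF [simp]: "X \<in> VF \<Longrightarrow> Y \<in> VF \<Longrightarrow> D X Y \<in> VF"
  by (simp add: D_def)

lemma D_add [simp]:
  assumes "X \<in> VF" "Y \<in> VF" "Z \<in> VF"
  shows "D (X + Y) Z = D X Z + D Y Z" "D X (Y + Z) = D X Y + D X Z"
  using assms by (simp_all add: D_def)

lemma D_minus [simp]:
  assumes "X \<in> VF" "Y \<in> VF"
  shows "D (- X) Y = - D X Y" "D X (- Y) = - D X Y"
  using assms by (simp_all add: D_def)

lemma D_fscale [simp]:
  assumes "X \<in> VF" "Y \<in> VF" "f \<in> SF"
  shows "D (fscale f X) Y = fscale f (D X Y)"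
    "D X (fscale f Y) = fscale (\<lambda>p. X p f) Y + fscale f (D X Y)"
  using assms by (simp_all add: D_def E_fscale VF_SF fscale_add fscale_diff scaleR_add_right scaleR_diff_right)
    (simp_all add: fun_eq_iff fscale_def algebra_simps)

lemma D_frame [simp]:
  assumes "X \<in> VF" "Y \<in> VF"
  shows "D X (i Y) = i (D X Y)" "D X (a Y) = a (D X Y)"
  using assms by (simp_all add: D_def)

lemma T_VF [simp]: "X \<in> VF \<Longrightarrow> Y \<in> VF \<Longrightarrow> T X Y \<in> VF"
  by (simp add: T_def)

lemma T_skew: "T Y X = - T X Y"
  by (simp add: T_def bracket_skew[of X Y])

lemma T_add_left:
  assumes "X \<in> VF" "Y \<in> VF" "Z \<in> VF"
  shows "T (X + Y) Z = T X Z + T Y Z"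
  using assms by (simp add: T_def)

lemma T_fscale_left:
  assumes "X \<in> VF" "Y \<in> VF" "f \<in> SF"
  shows "T (fscale f X) Y = fscale f (T X Y)"
  using assms by (simp add: T_def fscale_diff)

lemma T_i_left:
  assumes "X \<in> VF" "Y \<in> VF"
  shows "T (i X) Y = i (T X Y)"
proof -
  \<comment> \<open>Written this way, the two terms with \<open>E\<close> are
    \<open>i\<close>-linear in the first argument by \<open>E_i\<close>, and the bracket term is so
    by \<open>bracket_i\<close>.\<close>
  have "T X Y = a (E X (a Y)) - a (E Y (a X)) - (\<epsilon> / 2) *\<^sub>R i (br (i X) Y + br X (i Y))"
    if "X \<in> VF" "Y \<in> VF" for X Y
    using that by (simp add: T_def D_def E_def[of X Y] E_def[of Y X] bracket_skew[of Y X] bracket_skew[of "i Y" X])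
      (simp add: fun_eq_iff field_simps)
  then show ?thesis
    using assms by (simp add: bracket_i scaleR_add_right scaleR_diff_right)
qed

lemma T_simps [simp]:
  assumes "X \<in> VF" "Y \<in> VF"
  shows "Z \<in> VF \<Longrightarrow> T (X + Z) Y = T X Y + T Z Y" "Z \<in> VF \<Longrightarrow> T X (Y + Z) = T X Y + T X Z"
    "f \<in> SF \<Longrightarrow> T (fscale f X) Y = fscale f (T X Y)" "f \<in> SF \<Longrightarrow> T X (fscale f Y) = fscale f (T X Y)"
    "T (i X) Y = i (T X Y)" "T X (i Y) = i (T X Y)"
    "T (- X) Y = - T X Y" "T X (- Y) = - T X Y"
  using assms T_skew[of X] T_skew[of "- X"]
  by (simp_all add: T_add_left T_fscale_left T_i_left) (simp_all add: T_def fun_eq_iff fscale_def algebra_simps)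

section \<open>From removable torsion to a para-quaternionic connection\<close>

lemma D_comb:
  assumes "X \<in> VF" "Y \<in> VF" "f \<in> SF" "g \<in> SF" "h \<in> SF"
  shows "D X (app (comb f g h) Y) = app (comb (\<lambda>p. X p f) (\<lambda>p. X p g) (\<lambda>p. X p h)) Y
    + app (comb f g h) (D X Y)"
  using assms by (simp add: comb_def algebra_simps)

theorem para_quaternionic_if_removable:
  assumes "removable T"
  shows "para_quaternionic \<A> P"
proof -
  obtain S where S: "QF_form S" "\<forall>X\<in>VF. \<forall>Y\<in>VF. T X Y = app (S X) Y - app (S Y) X"
    using assms unfolding removable_def by blast
  note Q = QF_formD[OF S(1)]
  note SE = QF_EF[OF Q(1)]
  note SV [simp] = app_VF[OF SE] app_linear[OF SE]
  define N where "N X Y = D X Y - app (S X) Y" for X Y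
  have "linear_connection \<A> N"
    unfolding linear_connection_def
    by (auto simp: N_def Q fscale_diff VF_SF algebra_simps)
  moreover have "torsion_free \<A> N"
    unfolding torsion_free_def
  proof (intro ballI)
    fix X Y assume "X \<in> VF" "Y \<in> VF"
    then have "T X Y = app (S X) Y - app (S Y) X" using S(2) by blast
    then show "N X Y - N Y X - br X Y = 0" by (simp add: N_def T_def algebra_simps)
  qed
  moreover have "preserves \<A> P N"
    unfolding preserves_def
  proof (intro ballI)
    fix X J assume X: "X \<in> VF" and J: "J \<in> PF"
    obtain f g h where f: "f \<in> SF" "g \<in> SF" "h \<in> SF" "J = comb f g h"
      using PF_comb[OF J] by blast
    \<comment> \<open>As the frame is parallel, \<open>D\<close> differentiates only the
      coefficients of \<open>J\<close>; the correction by \<open>S X\<close> contributes the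
      commutator.\<close>
    let ?K = "comb (\<lambda>p. X p f) (\<lambda>p. X p g) (\<lambda>p. X p h) - (ecomp (S X) J - ecomp J (S X))"
    have "?K \<in> PF"
      by (intro PF_ops(2) comb_PF[OF VF_SF[OF X f(1)] VF_SF[OF X f(2)] VF_SF[OF X f(3)]]
          commutator_PF[OF Q(1)[OF X] J])
    moreover have "N X (app J Y) - app J (N X Y) = app ?K Y" if Y: "Y \<in> VF" for Y
      using X Y J D_comb[OF X Y f(1-3)] PF_EF[OF J]
      by (simp add: N_def f(4)[symmetric] app_linear[OF PF_EF[OF J]] app_VF[OF PF_EF[OF J]])
    ultimately show "\<exists>S'\<in>PF. \<forall>Y\<in>VF. N X (app J Y) - app J (N X Y) = app S' Y" by blast
  qed
  ultimately show ?thesis unfolding para_quaternionic_def by blast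
qed

text \<open>Brackets are replaced by the antisymmetrised \<open>D\<close> minus \<open>T\<close>. In
  the Nijenhuis tensor the derivatives of vector fields then cancel. Besides the expression in
  \<open>T\<close> only the derivative \<open>J'\<close> of \<open>J\<close> remains; it lies in
  \<open>P\<close> and enters as the skew-symmetrisation of a one-form with values in
  \<open>QF\<close>.\<close>

lemma removable_nijenhuis:
  assumes J: "J \<in> PF" and JJ: "\<And>p v. v \<in> TS p \<Longrightarrow> J p (J p v) = \<eta> *\<^sub>R v"
    and N: "\<And>X Y. X \<in> VF \<Longrightarrow> Y \<in> VF \<Longrightarrow> nijenhuis \<eta> J X Y = 0"
  shows "removable (\<lambda>X Y. \<eta> *\<^sub>R T X Y + T (app J X) (app J Y)
    - app J (T (app J X) Y + T X (app J Y)))"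
proof -
  obtain f g h where f: "f \<in> SF" "g \<in> SF" "h \<in> SF" "J = comb f g h"
    using PF_comb[OF J] by blast
  define J' where "J' X = comb (\<lambda>p. X p f) (\<lambda>p. X p g) (\<lambda>p. X p h)" for X
  have J'_PF: "J' X \<in> PF" if "X \<in> VF" for X
    unfolding J'_def by (rule comb_PF[OF VF_SF[OF that f(1)] VF_SF[OF that f(2)] VF_SF[OF that f(3)]])
  have J'_add: "J' (X + Y) = J' X + J' Y" for X Y
    by (simp add: J'_def comb_def escale_def fun_eq_iff algebra_simps)
  have J'_fscale: "J' (fscale k X) = escale k (J' X)" for k X
    by (simp add: J'_def comb_def escale_def fscale_def fun_eq_iff algebra_simps)
  have D_J: "D X (app J Y) = app (J' X) Y + app J (D X Y)" if "X \<in> VF" "Y \<in> VF" for X Y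
    using D_comb[OF that f(1-3)] by (simp add: f(4) J'_def)
  note JE = PF_EF[OF J]
  note J_VF [simp] = app_VF[OF JE] app_linear[OF JE]
  have J_J: "app J (app J X) = \<eta> *\<^sub>R X" if "X \<in> VF" for X
    using VF_TS[OF that] by (simp add: app_def fun_eq_iff JJ)
  have br: "br X Y = D X Y - D Y X - T X Y" for X Y
    by (simp add: T_def)
  have E: "J' X \<in> EF" if "X \<in> VF" for X using PF_EF J'_PF that by blast
  show ?thesis
  proof (rule removableI[of "\<lambda>X. J' (app J X) - ecomp J (J' X)"])
    fix X Y assume X: "X \<in> VF" and Y: "Y \<in> VF"
    show "\<eta> *\<^sub>R T X Y + T (app J X) (app J Y) - app J (T (app J X) Y + T X (app J Y)) =
      app (J' (app J X) - ecomp J (J' X)) Y - app (J' (app J Y) - ecomp J (J' Y)) X"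
      using N[OF X Y] X Y app_VF[OF E]
      by (simp add: nijenhuis_def br D_J J_J scaleR_diff_right algebra_simps)
  qed (simp_all add: J'_add J'_fscale ecomp_linear E JE QF_ops J J'_PF,
       simp_all add: escale_def fun_eq_iff algebra_simps)
qed

text \<open>As \<^term>\<open>T\<close> is \<^term>\<open>I\<close>-bilinear, projecting the removable form of \<open>removable_nijenhuis\<close> to its
  \<^term>\<open>I\<close>-bilinear part leaves a multiple of \<^term>\<open>T\<close>.\<close>

theorem para_quaternionic_nondegenerate:
  assumes C: "C \<in> PF" "\<alpha> \<in> SF" "\<mu> \<in> SF"
    and C_I: "\<And>p v. v \<in> TS p \<Longrightarrow> C p (I p v) = - I p (C p v)"
    and C_C: "\<And>p v. v \<in> TS p \<Longrightarrow> C p (C p v) = \<mu> p *\<^sub>R v"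
    and nz: "\<And>p. \<mu> p \<noteq> 0"
    and J_def: "J = escale \<alpha> I + C"
    and JJ: "\<And>p v. v \<in> TS p \<Longrightarrow> J p (J p v) = \<eta> *\<^sub>R v"
    and N: "\<And>X Y. X \<in> VF \<Longrightarrow> Y \<in> VF \<Longrightarrow> nijenhuis \<eta> J X Y = 0"
  shows "para_quaternionic \<A> P"
proof -
  have J: "J \<in> PF" unfolding J_def by (intro PF_ops C I_PF)
  define G where "G X Y = \<eta> *\<^sub>R T X Y + T (app J X) (app J Y) - app J (T (app J X) Y + T X (app J Y))" for X Y
  have G: "removable G"
    by (rule removable_cong[OF removable_nijenhuis[OF J JJ N]]) (simp_all add: G_def)
  define c where "c = app C"
  note CE = PF_EF[OF C(1)]
  have c_VF [simp]: "c X \<in> VF" if "X \<in> VF" for X using that by (simp add: c_def app_VF[OF CE])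
  have J_app: "app J X = fscale \<alpha> (i X) + c X" for X
    by (simp add: J_def c_def)
  have c_linear [simp]: "c (X + Y) = c X + c Y" "c (X - Y) = c X - c Y" "c (- X) = - c X"
    "c (r *\<^sub>R X) = r *\<^sub>R c X" "c (fscale f X) = fscale f (c X)"
    if "X \<in> VF" "Y \<in> VF" for X Y r f
    using app_linear[OF CE that] by (simp_all add: c_def)
  have c_mult [simp]: "c (i X) = - i (c X)" "c (c X) = fscale \<mu> X" if "X \<in> VF" for X
    using VF_TS[OF that] by (simp_all add: c_def app_def fun_eq_iff C_I C_C fscale_def)
  \<comment> \<open>J^2 = \<epsilon> \<alpha>^2 + C^2; in this form the terms of \<open>G\<close>
    quadratic in \<alpha> cancel.\<close>
  have eta: "\<eta> *\<^sub>R X = fscale (\<lambda>p. \<epsilon> * (\<alpha> p * \<alpha> p) + \<mu> p) X" if "X \<in> VF" for X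
  proof -
    have "\<eta> *\<^sub>R X = app J (app J X)"
      using VF_TS[OF that] by (simp add: app_def fun_eq_iff JJ)
    also have "\<dots> = fscale (\<lambda>p. \<epsilon> * (\<alpha> p * \<alpha> p) + \<mu> p) X"
      using that C by (simp add: J_app) (simp add: fun_eq_iff fscale_def algebra_simps)
    finally show ?thesis .
  qed
  \<comment> \<open>The \<open>I\<close>-linear part of F in its first argument is (F(X, Y) +
    \<epsilon> i F(i X, Y)) / 2. \<open>H\<close> is four times the result of taking this part in
    both arguments.\<close>
  define H where "H X Y = G X Y + \<epsilon> *\<^sub>R i (G (i X) Y + G X (i Y)) + \<epsilon> *\<^sub>R G (i X) (i Y)" for X Y
  have H: "removable H"
    unfolding H_def
    by (intro removable_add removable_scaleR removable_left removable_sym removable_both G PF_QF I_PF)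
  have "removable (\<lambda>X Y. fscale (\<lambda>p. inverse (4 * \<mu> p)) (H X Y))"
    using nz by (intro removable_fscale H SF_inverse SF_cmult C) simp
  moreover have "T X Y = fscale (\<lambda>p. inverse (4 * \<mu> p)) (H X Y)" if "X \<in> VF" "Y \<in> VF" for X Y
  proof -
    \<comment> \<open>Apart from \<mu> T, every term is \<open>I\<close>-antilinear in at least one
      argument, since \<open>c\<close> anticommutes with \<open>i\<close>. These terms drop out of
      \<open>H\<close>.\<close>
    have "G X Y = fscale \<mu> (T X Y) + T (c X) (c Y) - 2 *\<^sub>R fscale \<alpha> (c (i (T X Y)))
      - c (T (c X) Y) - c (T X (c Y))" if "X \<in> VF" "Y \<in> VF" for X Y
      using that C by (simp add: G_def J_app eta numeral_times_fun) (simp add: fun_eq_iff fscale_def algebra_simps)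
    then have "H X Y = fscale (\<lambda>p. 4 * \<mu> p) (T X Y)"
      using that C by (simp add: H_def numeral_times_fun) (simp add: fun_eq_iff fscale_def algebra_simps)
    then show ?thesis using nz by (simp add: fun_eq_iff fscale_def)
  qed
  ultimately show ?thesis
    using removable_cong para_quaternionic_if_removable by blast
qed

text \<open>\<alpha> and \<beta> are signs because \<open>J\<close> and \<open>K\<close> have square
  1 while \<open>N\<close> is null and orthogonal to \<open>I\<close>. The condition
  \<open>\<beta> p \<noteq> s p * \<alpha> p\<close> says that \<open>K\<close> is not a multiple of
  \<open>J\<close>, which makes their two torsion equations independent.\<close>

theorem para_quaternionic_degenerate:
  assumes eps1: "\<epsilon> = 1" and \<sigma>: "\<sigma> \<in> SF" "\<And>p. \<sigma> p * \<sigma> p = 1"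
    and N_def: "N = (1/2) *\<^sub>R (A + escale \<sigma> B)"
    and \<alpha>: "\<alpha> \<in> SF" "\<And>p. \<alpha> p * \<alpha> p = 1" and \<beta>: "\<beta> \<in> SF" "\<And>p. \<beta> p * \<beta> p = 1"
    and s: "s \<in> SF" "\<And>p. s p \<noteq> 0" "\<And>p. \<beta> p \<noteq> s p * \<alpha> p"
    and J_def: "J = escale \<alpha> I + N" and K_def: "K = escale \<beta> I + escale s N"
    and NJ: "\<And>X Y. X \<in> VF \<Longrightarrow> Y \<in> VF \<Longrightarrow> nijenhuis 1 J X Y = 0"
    and NK: "\<And>X Y. X \<in> VF \<Longrightarrow> Y \<in> VF \<Longrightarrow> nijenhuis 1 K X Y = 0"
    and JJ: "\<And>p v. v \<in> TS p \<Longrightarrow> J p (J p v) = 1 *\<^sub>R v"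
    and KK: "\<And>p v. v \<in> TS p \<Longrightarrow> K p (K p v) = 1 *\<^sub>R v"
  shows "para_quaternionic \<A> P"
proof -
  define M where "M = (1/2) *\<^sub>R (A - escale \<sigma> B)"
  have N: "N \<in> PF" and M: "M \<in> PF"
    unfolding N_def M_def by (intro PF_ops A_PF B_PF \<sigma>)+
  have J: "J \<in> PF" and K: "K \<in> PF"
    unfolding J_def K_def by (intro PF_ops N I_PF \<alpha> \<beta> s)+
  note NE = PF_EF[OF N] and ME = PF_EF[OF M]
  define n where "n = app N"
  define m where "m = app M"
  have n_VF [simp]: "n X \<in> VF" "m X \<in> VF" if "X \<in> VF" for X
    using that by (simp_all add: n_def m_def app_VF[OF NE] app_VF[OF ME])
  have n_linear [simp]: "n (X + Y) = n X + n Y" "n (X - Y) = n X - n Y" "n (- X) = - n X"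
    "n (r *\<^sub>R X) = r *\<^sub>R n X" "n (fscale f X) = fscale f (n X)"
    if "X \<in> VF" "Y \<in> VF" for X Y r f
    using app_linear[OF NE that] by (simp_all add: n_def)
  have sg [simp]: "\<sigma> p * (\<sigma> p * x) = x" for p x
    using \<sigma>(2)[of p] by (metis mult.assoc mult_1)
  have n_eq: "n X = (1/2) *\<^sub>R (a X + fscale \<sigma> (i (a X)))" for X
    by (simp add: n_def N_def)
  have m_eq: "m X = (1/2) *\<^sub>R (a X - fscale \<sigma> (i (a X)))" for X
    by (simp add: m_def M_def)
  have i_n: "i (n X) = fscale \<sigma> (n X)" "n (i X) = - fscale \<sigma> (n X)" "n (n X) = 0"
      "m (n X) = X - n (m X)" if "X \<in> VF" for X
    using that \<sigma> by (simp_all add: n_eq m_eq eps1)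
      (simp_all add: fun_eq_iff fscale_def algebra_simps)
  have e: "\<epsilon> *\<^sub>R X = X" for X :: "'a \<Rightarrow> 'a tvec"
    by (simp add: eps1)
  \<comment> \<open>The image of \<open>n\<close> lies in the eigenspace of \<open>I\<close> for
    \<sigma>. \<open>T\<close> takes values there as soon as one argument does, and \<open>n\<close>
    vanishes there because n i = -\<sigma> n.\<close>
  have i_T: "i (T (n X) Y) = fscale \<sigma> (T (n X) Y)" "i (T Y (n X)) = fscale \<sigma> (T Y (n X))"
    if "X \<in> VF" "Y \<in> VF" for X Y
    using T_simps(5)[of "n X" Y] T_simps(6)[of Y "n X"] that \<sigma>(1) by (simp_all add: i_n)
  have n_T: "n (T (n X) Y) = 0" "n (T Y (n X)) = 0" if "X \<in> VF" "Y \<in> VF" for X Y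
  proof -
    have *: "n V = 0" if V: "V \<in> VF" "i V = fscale \<sigma> V" for V
    proof -
      have "fscale \<sigma> (n V) = - fscale \<sigma> (n V)"
        using i_n(2)[OF V(1)] V by simp
      then have "\<sigma> p * n V p f = 0" for p f by (auto simp: fun_eq_iff fscale_def)
      then show ?thesis using \<sigma>(2) by (simp add: fun_eq_iff) (metis mult_eq_0_iff zero_neq_one)
    qed
    show "n (T (n X) Y) = 0" "n (T Y (n X)) = 0" using that by (simp_all add: * i_T)
  qed
  have al: "\<alpha> p * (\<alpha> p * x) = x" "\<beta> p * (\<beta> p * x) = x" for p x
    using \<alpha>(2)[of p] \<beta>(2)[of p] by (metis mult.assoc mult_1)+
  define G where "G X Y = 1 *\<^sub>R T X Y + T (app J X) (app J Y) - app J (T (app J X) Y + T X (app J Y))" for X Y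
  define G' where "G' X Y = 1 *\<^sub>R T X Y + T (app K X) (app K Y) - app K (T (app K X) Y + T X (app K Y))" for X Y
  have G: "removable G"
    by (rule removable_cong[OF removable_nijenhuis[OF J JJ NJ]]) (simp_all add: G_def)
  have G': "removable G'"
    by (rule removable_cong[OF removable_nijenhuis[OF K KK NK]]) (simp_all add: G'_def)
  have J_app: "app J X = fscale \<alpha> (i X) + n X" for X
    by (simp add: J_def n_def)
  have K_app: "app K X = fscale \<beta> (i X) + fscale s (n X)" for X
    by (simp add: K_def n_def)
  \<comment> \<open>The terms without \<open>n\<close> cancel because \<alpha>^2 = \<beta>^2 = 1,
    and the terms with \<open>n\<close> inside a single argument of \<open>T\<close> because
    \<open>T\<close> is \<open>I\<close>-bilinear or because \<open>n\<close> kills them. The rule n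
    i = -\<sigma> n produces the coefficient of the last term.\<close>
  have G_eq: "G X Y = T (n X) (n Y) + 2 *\<^sub>R fscale (\<lambda>p. \<alpha> p * \<sigma> p) (n (T X Y))"
    "G' X Y = fscale (\<lambda>p. s p * s p) (T (n X) (n Y)) + 2 *\<^sub>R fscale (\<lambda>p. \<beta> p * s p * \<sigma> p) (n (T X Y))"
    if "X \<in> VF" "Y \<in> VF" for X Y
    using that \<alpha> \<beta> s by (simp_all add: G_def G'_def J_app K_app i_n n_T i_T e numeral_times_fun)
      (simp_all add: fun_eq_iff fscale_def algebra_simps al)
  \<comment> \<open>Eliminating T(n X, n Y) gives s G - G' / s = 2 \<sigma> (s \<alpha> - \<beta>) n
    T; \<open>k\<close> inverts this factor up to \<sigma>, which is its own inverse.\<close>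
  define k where "k p = inverse (2 * (s p * \<alpha> p - \<beta> p))" for p
  have nz: "s p * \<alpha> p - \<beta> p \<noteq> 0" for p using s(3)[of p] by simp
  have k: "k \<in> SF"
    unfolding k_def using nz by (intro SF_inverse SF_cmult SF_diff SF_mult \<alpha> \<beta> s) simp
  have "removable (\<lambda>X Y. fscale (\<lambda>p. \<sigma> p * k p) (fscale s (G X Y) - fscale (\<lambda>p. inverse (s p)) (G' X Y)))"
    using s(2) by (intro removable_fscale removable_diff G G' SF_mult SF_inverse k \<sigma>(1) s(1)) simp
  then have nT: "removable (\<lambda>X Y. app N (T X Y))"
  proof (rule removable_cong)
    fix X Y assume X: "X \<in> VF" and Y: "Y \<in> VF"
    have "\<sigma> p * k p * (s p * (t + 2 * (\<alpha> p * \<sigma> p) * u) - inverse (s p) * (s p * s p * t + 2 * (\<beta> p * s p * \<sigma> p) * u)) = u"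
      for p t u
    proof -
      have "s p * (t + 2 * (\<alpha> p * \<sigma> p) * u) - inverse (s p) * (s p * s p * t + 2 * (\<beta> p * s p * \<sigma> p) * u) =
        \<sigma> p * (2 * (s p * \<alpha> p - \<beta> p)) * u"
        using s(2)[of p] by (simp add: field_simps)
      then show ?thesis using nz[of p] \<sigma>(2)[of p] by (simp add: k_def mult_ac)
    qed
    then show "app N (T X Y) = fscale (\<lambda>p. \<sigma> p * k p) (fscale s (G X Y) - fscale (\<lambda>p. inverse (s p)) (G' X Y))"
      using X Y by (simp add: G_eq n_def[symmetric]) (simp add: fun_eq_iff fscale_def)
  qed
  have "removable (\<lambda>X Y. G X Y - 2 *\<^sub>R fscale (\<lambda>p. \<alpha> p * \<sigma> p) (app N (T X Y)))"
    by (intro removable_diff removable_scaleR removable_fscale G nT SF_mult \<alpha>(1) \<sigma>(1))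
  then have "removable (\<lambda>X Y. T (n X) (n Y))"
    by (rule removable_cong) (simp add: G_eq n_def)
  then have "removable (\<lambda>X Y. T (n (app M X)) (n (app M Y)))"
    by (rule removable_both[OF _ PF_QF[OF M]])
  then have "removable (\<lambda>X Y. T (n (app M X)) (n (app M Y)) + app M (app N (T X Y)))"
    by (intro removable_add removable_left nT PF_QF[OF M])
  then have "removable T"
  proof (rule removable_cong)
    fix X Y assume X: "X \<in> VF" and Y: "Y \<in> VF"
    have nm: "n (m Z) = (1/2) *\<^sub>R (Z + fscale \<sigma> (i Z))" if "Z \<in> VF" for Z
      using that \<sigma> by (simp add: n_eq m_eq eps1) (simp add: fun_eq_iff fscale_def algebra_simps)
    have sc: "T (r *\<^sub>R U) V = r *\<^sub>R T U V" "T U (r *\<^sub>R V) = r *\<^sub>R T U V" if "U \<in> VF" "V \<in> VF" for r U V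
      using T_simps(3,4)[OF that SF_const[of r]] by (simp_all add: fscale_def fun_eq_iff scaleR_fun_def)
    \<comment> \<open>n m and m n are the projections to the eigenspaces of \<open>I\<close> for
      \<sigma> and -\<sigma>. By \<open>I\<close>-bilinearity \<open>T\<close> vanishes on arguments
      from different eigenspaces and maps pairs from one eigenspace into it. So \<open>T X Y\<close>
      is the value on the \<sigma>-parts plus the (-\<sigma>)-part of \<open>T X Y\<close>.\<close>
    have "T X Y = T (n (m X)) (n (m Y)) + m (n (T X Y))"
      using X Y \<sigma>(1) by (simp add: i_n(4)) (simp add: nm sc e, simp add: fun_eq_iff fscale_def algebra_simps)
    then show "T X Y = T (n (app M X)) (n (app M Y)) + app M (app N (T X Y))"
      by (simp add: n_def m_def)
  qed
  then show ?thesis by (rule para_quaternionic_if_removable)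
qed

end

section \<open>Pointwise algebra of almost para-quaternionic structures\<close>

locale almost_para_quaternionic_manifold = smooth_manifold +
  fixes P :: "'a \<Rightarrow> 'a tend set"
  assumes almost_para_quaternionic: "almost_para_quaternionic \<A> P"
begin

definition admissible_at :: "'a \<Rightarrow> 'a tend \<Rightarrow> 'a tend \<Rightarrow> 'a tend \<Rightarrow> bool" where
  "admissible_at p J1 J2 J3 \<longleftrightarrow>
    J1 \<in> tangent_end \<A> p \<and> J2 \<in> tangent_end \<A> p \<and> J3 \<in> tangent_end \<A> p \<and>
    P p = span {J1, J2, J3} \<and>
    (\<forall>v\<in>TS p. J1 (J1 v) = - v \<and> J2 (J2 v) = v \<and> J3 (J3 v) = v \<and>
      J1 (J2 v) = J3 v \<and> J2 (J1 v) = - J3 v \<and> J1 (J3 v) = - J2 v \<and> J3 (J1 v) = J2 v \<and>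
      J2 (J3 v) = - J1 v \<and> J3 (J2 v) = J1 v)"

lemma admissible_basis_at:
  assumes b: "admissible_basis_on \<A> P U K1 K2 K3" and p: "p \<in> U"
  shows "admissible_at p (K1 p) (K2 p) (K3 p)"
proof -
  note d = b[unfolded admissible_basis_on_def almost_eps_complex_on_def smooth_end_on_def]
  have TE: "K1 p \<in> tangent_end \<A> p" "K2 p \<in> tangent_end \<A> p" "K3 p \<in> tangent_end \<A> p"
    using d p by blast+
  note c = TE(1)[THEN TE_closed] TE(2)[THEN TE_closed] TE(3)[THEN TE_closed]
  note m = TE(1)[THEN TE_minus] TE(2)[THEN TE_minus] TE(3)[THEN TE_minus]
  have sq: "K1 p (K1 p v) = - v" "K2 p (K2 p v) = v" "K3 p (K3 p v) = v" if "v \<in> TS p" for v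
  proof -
    have "K1 p (K1 p v) = (- 1) *\<^sub>R v" "K2 p (K2 p v) = 1 *\<^sub>R v" "K3 p (K3 p v) = 1 *\<^sub>R v"
      using d p that by blast+
    then show "K1 p (K1 p v) = - v" "K2 p (K2 p v) = v" "K3 p (K3 p v) = v" by simp_all
  qed
  have "K2 p \<circ> K3 p = - (K3 p \<circ> K2 p)" "K3 p = K1 p \<circ> K2 p" and sp: "P p = span {K1 p, K2 p, K3 p}"
    using d p by blast+
  then have k: "K2 p (K3 p v) = - K3 p (K2 p v)" "K1 p (K2 p v) = K3 p v" for v
    by (metis comp_apply uminus_apply)+
  have "K3 p (K2 p v) = K1 p v" if "v \<in> TS p" for v
    using k(2)[of "K2 p v"] sq(2)[OF that] by simp
  moreover have "K1 p (K3 p v) = - K2 p v" if "v \<in> TS p" for v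
    using k(2)[of v] sq(1)[OF c(2)[OF that]] by simp
  \<comment> \<open>The definition makes only the second and third member anticommute. Since J3 J2 =
    J1, this gives J1 = -J2 J3, and composing with J2 on the left yields the claim.\<close>
  moreover have k21: "K2 p (K1 p v) = - K3 p v" if "v \<in> TS p" for v
    using k(1)[of v] calculation(1)[OF that] sq(2)[OF c(3)[OF that]] m(2)[OF c(1)[OF that]] by (metis minus_minus)
  moreover have "K3 p (K1 p v) = K2 p v" if "v \<in> TS p" for v
    using k(2)[of "K1 p v"] k21[OF that] m(1)[OF c(3)[OF that]] calculation(2)[OF that] by simp
  ultimately show ?thesis
    using TE sp sq k by (simp add: admissible_at_def)
qed

lemma admissible_ex: "\<exists>J1 J2 J3. admissible_at p J1 J2 J3"
  using almost_para_quaternionic admissible_basis_at unfolding almost_para_quaternionic_def by meson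

lemma admissible_coords:
  assumes "admissible_at p J1 J2 J3" "S \<in> P p"
  obtains x y z where "S = x *\<^sub>R J1 + y *\<^sub>R J2 + z *\<^sub>R J3"
proof -
  have "S \<in> span {J1, J2, J3}" using assms by (simp add: admissible_at_def)
  then obtain x y z where "S - x *\<^sub>R J1 - y *\<^sub>R J2 - z *\<^sub>R J3 = 0"
    unfolding span_insert span_empty by auto
  then have "S = x *\<^sub>R J1 + y *\<^sub>R J2 + z *\<^sub>R J3" by (simp add: algebra_simps)
  then show ?thesis using that by blast
qed

text \<open>The scalar part is the standard Lorentzian metric in coordinates; the rest is the cross
  product of imaginary para-quaternions.\<close>

lemma admissible_mult:
  assumes adm: "admissible_at p J1 J2 J3" and v: "v \<in> TS p"
  shows "(x1 *\<^sub>R J1 + x2 *\<^sub>R J2 + x3 *\<^sub>R J3) ((y1 *\<^sub>R J1 + y2 *\<^sub>R J2 + y3 *\<^sub>R J3) v) =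
    (- x1 * y1 + x2 * y2 + x3 * y3) *\<^sub>R v + ((x3 * y2 - x2 * y3) *\<^sub>R J1
      + (x3 * y1 - x1 * y3) *\<^sub>R J2 + (x1 * y2 - x2 * y1) *\<^sub>R J3) v"
proof -
  note d = adm[unfolded admissible_at_def]
  have TE: "J1 \<in> tangent_end \<A> p" "J2 \<in> tangent_end \<A> p" "J3 \<in> tangent_end \<A> p"
    using d by blast+
  note simps = TE_simps[OF TE(1)] TE_simps[OF TE(2)] TE_simps[OF TE(3)]
  have m: "J1 (J1 v) = - v" "J2 (J2 v) = v" "J3 (J3 v) = v" "J1 (J2 v) = J3 v" "J2 (J1 v) = - J3 v"
    "J1 (J3 v) = - J2 v" "J3 (J1 v) = J2 v" "J2 (J3 v) = - J1 v" "J3 (J2 v) = J1 v"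
    using d v by blast+
  show ?thesis
    using v by (simp add: simps m) (simp add: fun_eq_iff algebra_simps)
qed

lemma admissible_P:
  assumes "admissible_at p J1 J2 J3"
  shows "x *\<^sub>R J1 + y *\<^sub>R J2 + z *\<^sub>R J3 \<in> P p" "x *\<^sub>R J1 + y *\<^sub>R J2 + z *\<^sub>R J3 \<in> tangent_end \<A> p"
proof -
  note d = assms[unfolded admissible_at_def]
  have P: "P p = span {J1, J2, J3}" using d by blast
  have TE: "J1 \<in> tangent_end \<A> p" "J2 \<in> tangent_end \<A> p" "J3 \<in> tangent_end \<A> p"
    using d by blast+
  show "x *\<^sub>R J1 + y *\<^sub>R J2 + z *\<^sub>R J3 \<in> P p"
    unfolding P by (intro span_add span_scale span_base) auto
  show "x *\<^sub>R J1 + y *\<^sub>R J2 + z *\<^sub>R J3 \<in> tangent_end \<A> p"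
    by (intro TE_ops TE)
qed

sublocale quaternionic_bundle \<A> P
proof
  fix p S
  show "subspace (P p)"
    using admissible_ex[of p] by (auto simp: admissible_at_def)
  assume S: "S \<in> P p"
  obtain J1 J2 J3 where adm: "admissible_at p J1 J2 J3" using admissible_ex by blast
  obtain x1 x2 x3 where x: "S = x1 *\<^sub>R J1 + x2 *\<^sub>R J2 + x3 *\<^sub>R J3"
    using admissible_coords[OF adm S] .
  show "S \<in> tangent_end \<A> p" unfolding x by (rule admissible_P[OF adm])
  fix S' assume S': "S' \<in> P p"
  obtain y1 y2 y3 where y: "S' = y1 *\<^sub>R J1 + y2 *\<^sub>R J2 + y3 *\<^sub>R J3"
    using admissible_coords[OF adm S'] .
  let ?Z = "(x3 * y2 - x2 * y3) *\<^sub>R J1 + (x3 * y1 - x1 * y3) *\<^sub>R J2 + (x1 * y2 - x2 * y1) *\<^sub>R J3"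
  have "S (S' v) = (- x1 * y1 + x2 * y2 + x3 * y3) *\<^sub>R v + ?Z v \<and>
    S' (S v) = (- x1 * y1 + x2 * y2 + x3 * y3) *\<^sub>R v - ?Z v" if v: "v \<in> TS p" for v
    unfolding x y admissible_mult[OF adm v] by (simp add: fun_eq_iff algebra_simps)
  then show "\<exists>r. \<exists>Z\<in>P p. \<forall>v\<in>TS p. S (S' v) = r *\<^sub>R v + Z v \<and> S' (S v) = r *\<^sub>R v - Z v"
    using admissible_P(1)[OF adm] by blast
qed

section \<open>The Lorentzian metric as an anticommutator\<close>

lemma TS_nontrivial: obtains v where "v \<in> TS p" "v \<noteq> 0"
proof (cases "\<exists>v\<in>TS p. v \<noteq> 0")
  case False
  \<comment> \<open>Without non-zero tangent vectors every member of \<open>tangent_end\<close> is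
    0, against the dimension 3 of \<open>P p\<close>. The dimension of the tangent space itself need
    not be computed.\<close>
  have "P p \<subseteq> {0}"
  proof
    fix S assume "S \<in> P p"
    then have S: "S \<in> tangent_end \<A> p" by (rule P_TE)
    have "S v = 0" for v
      using TE_closed[OF S] TE_outside[OF S] False by (cases "v \<in> TS p") auto
    then show "S \<in> {0}" by (simp add: fun_eq_iff)
  qed
  then have "P p = {0}" using P_ops(4)[of p] by blast
  then have "dim (P p) = card ({} :: 'a tend set)"
    by (intro dim_eq_card) (simp_all add: independent_empty)
  then show ?thesis using almost_para_quaternionic by (simp add: almost_para_quaternionic_def)
qed (use that in blast)

lemma scalar_unique:
  assumes "\<And>v. v \<in> TS p \<Longrightarrow> r *\<^sub>R v = s *\<^sub>R v" shows "r = s"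
  using TS_nontrivial[of p] assms scaleR_cancel_right by metis

text \<open>By the multiplication table the metric is half the anticommutator in every admissible
  basis. That characterisation names no basis, so the definite description in \<open>lorentz\<close>
  is unique.\<close>

lemma lorentz_eqI:
  assumes A: "A \<in> P p" and B: "B \<in> P p" and r: "\<And>v. v \<in> TS p \<Longrightarrow> A (B v) + B (A v) = (2 * r) *\<^sub>R v"
  shows "lorentz \<A> P p A B = r"
  unfolding lorentz_def
proof (rule the_equality)
  obtain U K1 K2 K3 where U: "open U" "p \<in> U" "admissible_basis_on \<A> P U K1 K2 K3"
    using almost_para_quaternionic unfolding almost_para_quaternionic_def by meson
  have unique: "- x1 * y1 + x2 * y2 + x3 * y3 = r"
    if adm: "admissible_at p J1 J2 J3" and x: "A = x1 *\<^sub>R J1 + x2 *\<^sub>R J2 + x3 *\<^sub>R J3"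
      and y: "B = y1 *\<^sub>R J1 + y2 *\<^sub>R J2 + y3 *\<^sub>R J3" for J1 J2 J3 x1 x2 x3 y1 y2 y3
  proof -
    have "2 * (- x1 * y1 + x2 * y2 + x3 * y3) = 2 * r"
    proof (rule scalar_unique)
      fix v assume v: "v \<in> TS p"
      have "A (B v) + B (A v) = (2 * (- x1 * y1 + x2 * y2 + x3 * y3)) *\<^sub>R v"
        unfolding x y admissible_mult[OF adm v] by (simp add: fun_eq_iff algebra_simps)
      from this[symmetric] r[OF v]
      show "(2 * (- x1 * y1 + x2 * y2 + x3 * y3)) *\<^sub>R v = (2 * r) *\<^sub>R v" by (rule trans)
    qed
    then show ?thesis by simp
  qed
  note adm = admissible_basis_at[OF U(3,2)]
  obtain x1 x2 x3 where x: "A = x1 *\<^sub>R K1 p + x2 *\<^sub>R K2 p + x3 *\<^sub>R K3 p"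
    using admissible_coords[OF adm A] .
  obtain y1 y2 y3 where y: "B = y1 *\<^sub>R K1 p + y2 *\<^sub>R K2 p + y3 *\<^sub>R K3 p"
    using admissible_coords[OF adm B] .
  show "\<exists>U J1 J2 J3 a1 a2 a3 b1 b2 b3. open U \<and> p \<in> U \<and> admissible_basis_on \<A> P U J1 J2 J3 \<and>
     A = a1 *\<^sub>R J1 p + a2 *\<^sub>R J2 p + a3 *\<^sub>R J3 p \<and> B = b1 *\<^sub>R J1 p + b2 *\<^sub>R J2 p + b3 *\<^sub>R J3 p \<and>
     r = - a1 * b1 + a2 * b2 + a3 * b3"
    using U x y unique[OF adm x y] by blast
  show "s = r" if "\<exists>U J1 J2 J3 a1 a2 a3 b1 b2 b3. open U \<and> p \<in> U \<and> admissible_basis_on \<A> P U J1 J2 J3 \<and>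
     A = a1 *\<^sub>R J1 p + a2 *\<^sub>R J2 p + a3 *\<^sub>R J3 p \<and> B = b1 *\<^sub>R J1 p + b2 *\<^sub>R J2 p + b3 *\<^sub>R J3 p \<and>
     s = - a1 * b1 + a2 * b2 + a3 * b3" for s
    using that unique admissible_basis_at by metis
qed

lemma lorentz_anticommutator:
  assumes "A \<in> P p" "B \<in> P p" "v \<in> TS p"
  shows "A (B v) + B (A v) = (2 * lorentz \<A> P p A B) *\<^sub>R v"
proof -
  obtain r Z where "\<forall>v\<in>TS p. A (B v) = r *\<^sub>R v + Z v \<and> B (A v) = r *\<^sub>R v - Z v"
    using P_mult[OF assms(1,2)] by blast
  then have r: "A (B v) + B (A v) = (2 * r) *\<^sub>R v" if "v \<in> TS p" for v
    using that by (simp add: fun_eq_iff)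
  show ?thesis using lorentz_eqI[OF assms(1,2) r] r[OF assms(3)] by simp
qed

text \<open>The orthogonal complement of a vector of norm -1 is positive definite, by
  Cauchy-Schwarz. If c were not positive, orthogonality would bound y1^2 x1^2 by (y2^2 + y3^2) (x2^2
  + x3^2) and hence by y1^2 (x1^2 - 1), which forces y1 = 0 and then \<open>C\<close> = 0.\<close>

lemma timelike_orthogonal:
  assumes I: "I \<in> P p" "\<And>v. v \<in> TS p \<Longrightarrow> I (I v) = - v"
    and C: "C \<in> P p" "\<And>v. v \<in> TS p \<Longrightarrow> C (I v) = - I (C v)" "C \<noteq> 0"
    and c: "\<And>v. v \<in> TS p \<Longrightarrow> C (C v) = c *\<^sub>R v"
  shows "c > 0"
proof (rule ccontr)
  assume "\<not> c > 0"
  obtain J1 J2 J3 where adm: "admissible_at p J1 J2 J3" using admissible_ex by blast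
  obtain x1 x2 x3 where x: "I = x1 *\<^sub>R J1 + x2 *\<^sub>R J2 + x3 *\<^sub>R J3"
    using admissible_coords[OF adm I(1)] .
  obtain y1 y2 y3 where y: "C = y1 *\<^sub>R J1 + y2 *\<^sub>R J2 + y3 *\<^sub>R J3"
    using admissible_coords[OF adm C(1)] .
  have xx: "- x1 * x1 + x2 * x2 + x3 * x3 = - 1"
  proof (rule scalar_unique[of p])
    fix v assume v: "v \<in> TS p"
    have "I (I v) = (- x1 * x1 + x2 * x2 + x3 * x3) *\<^sub>R v"
      unfolding x admissible_mult[OF adm v] by (simp add: fun_eq_iff algebra_simps)
    from this[symmetric] I(2)[OF v]
    show "(- x1 * x1 + x2 * x2 + x3 * x3) *\<^sub>R v = (- 1) *\<^sub>R v" by simp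
  qed
  have yy: "- y1 * y1 + y2 * y2 + y3 * y3 = c"
  proof (rule scalar_unique[of p])
    fix v assume v: "v \<in> TS p"
    have "C (C v) = (- y1 * y1 + y2 * y2 + y3 * y3) *\<^sub>R v"
      unfolding y admissible_mult[OF adm v] by (simp add: fun_eq_iff algebra_simps)
    from this[symmetric] c[OF v]
    show "(- y1 * y1 + y2 * y2 + y3 * y3) *\<^sub>R v = c *\<^sub>R v" by (rule trans)
  qed
  have "2 * (- x1 * y1 + x2 * y2 + x3 * y3) = 0"
  proof (rule scalar_unique[of p])
    fix v assume v: "v \<in> TS p"
    have "I (C v) + C (I v) = (2 * (- x1 * y1 + x2 * y2 + x3 * y3)) *\<^sub>R v"
      unfolding x y admissible_mult[OF adm v] by (simp add: fun_eq_iff algebra_simps)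
    then show "(2 * (- x1 * y1 + x2 * y2 + x3 * y3)) *\<^sub>R v = 0 *\<^sub>R v" using C(2)[OF v] by simp
  qed
  then have xy: "y1 * x1 = y2 * x2 + y3 * x3" by (simp add: algebra_simps)
  have "y1\<^sup>2 * x1\<^sup>2 = (y2 * x2 + y3 * x3)\<^sup>2" using xy by (metis power_mult_distrib)
  also have "\<dots> \<le> (y2\<^sup>2 + y3\<^sup>2) * (x2\<^sup>2 + x3\<^sup>2)"
    using zero_le_power2[of "y2 * x3 - y3 * x2"] by (simp add: power2_eq_square algebra_simps)
  also have "\<dots> \<le> y1\<^sup>2 * (x1\<^sup>2 - 1)"
    using \<open>\<not> c > 0\<close> xx yy by (intro mult_mono) (auto simp: power2_eq_square)
  finally have "y1 = 0" by (simp add: algebra_simps)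
  then have "y2\<^sup>2 + y3\<^sup>2 \<le> 0" using yy \<open>\<not> c > 0\<close> by (simp add: power2_eq_square)
  then have "y2 = 0" "y3 = 0" by (simp_all add: sum_power2_le_zero_iff)
  then show False using C(3) \<open>y1 = 0\<close> by (simp add: y)
qed

section \<open>Pairs and triples of integrable structures\<close>

text \<open>\<open>x\<close> is twice the product of \<open>I\<close> and \<open>J\<close>, and
  \<eta> - \<epsilon> x^2 / 4 is the norm of the part of \<open>J\<close> orthogonal to
  \<open>I\<close>. It vanishes at a point exactly when the Gram determinant of \<open>I\<close> and
  \<open>J\<close> does.\<close>

lemma two_structures:
  assumes I: "I \<in> PF" and J: "J \<in> PF" and eps: "\<epsilon> = 1 \<or> \<epsilon> = - 1" and x: "x \<in> SF"
    and II: "\<And>p v. v \<in> TS p \<Longrightarrow> I p (I p v) = \<epsilon> *\<^sub>R v"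
    and JJ: "\<And>p v. v \<in> TS p \<Longrightarrow> J p (J p v) = \<eta> *\<^sub>R v"
    and NI: "\<And>X Y. X \<in> VF \<Longrightarrow> Y \<in> VF \<Longrightarrow> nijenhuis \<epsilon> I X Y = 0"
    and NJ: "\<And>X Y. X \<in> VF \<Longrightarrow> Y \<in> VF \<Longrightarrow> nijenhuis \<eta> J X Y = 0"
    and IJ: "\<And>p v. v \<in> TS p \<Longrightarrow> I p (J p v) + J p (I p v) = x p *\<^sub>R v"
    and nz: "\<And>p. \<eta> - \<epsilon> / 4 * (x p * x p) \<noteq> 0"
    and pos: "\<And>p. \<epsilon> = - 1 \<Longrightarrow> \<eta> - \<epsilon> / 4 * (x p * x p) > 0"
  shows "para_quaternionic \<A> P"
proof -
  \<comment> \<open>The orthogonal projection of \<open>J\<close> to \<open>I\<close> has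
    coefficient (x / 2) / \<epsilon>, and 1 / \<epsilon> = \<epsilon>.\<close>
  define \<alpha> where "\<alpha> p = \<epsilon> / 2 * x p" for p
  define \<mu> where "\<mu> p = \<eta> - \<epsilon> / 4 * (x p * x p)" for p
  define C where "C = J - escale \<alpha> I"
  have \<alpha>: "\<alpha> \<in> SF" unfolding \<alpha>_def by (intro SF_cmult x)
  have \<mu>: "\<mu> \<in> SF" unfolding \<mu>_def by (intro SF_diff SF_const SF_cmult SF_mult x)
  have C: "C \<in> PF" unfolding C_def by (intro PF_ops I J \<alpha>)
  have TE: "I p \<in> tangent_end \<A> p" "J p \<in> tangent_end \<A> p" "C p \<in> tangent_end \<A> p" for p
    using P_TE PF_P I J C by blast+
  note simps = TE_simps[OF TE(1)] TE_simps[OF TE(2)] TE_simps[OF TE(3)]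
  have C_v: "C p v = J p v - \<alpha> p *\<^sub>R I p v" for p v
    by (simp add: C_def escale_def)
  have J_I: "J p (I p v) = x p *\<^sub>R v - I p (J p v)" if "v \<in> TS p" for p v
    using IJ[OF that] by (simp add: algebra_simps)
  have C_I: "C p (I p v) = - I p (C p v)" if "v \<in> TS p" for p v
    using that eps by (auto simp: C_v simps II J_I \<alpha>_def fun_eq_iff algebra_simps)
  have C_C: "C p (C p v) = \<mu> p *\<^sub>R v" if "v \<in> TS p" for p v
    using that eps by (auto simp: C_v simps II JJ J_I \<alpha>_def \<mu>_def fun_eq_iff algebra_simps)
  have IC: "ecomp I C \<in> PF"
    by (rule ecomp_PF[OF I C]) (simp add: C_I)
  define h where "h p = inverse (sqrt \<bar>\<mu> p\<bar>)" for p
  define \<delta> where "\<delta> p = \<mu> p * (h p * h p)" for p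
  have mu_nz: "\<mu> p \<noteq> 0" for p using nz by (simp add: \<mu>_def)
  have h: "h \<in> SF" unfolding h_def using mu_nz by (intro SF_inverse_sqrt_abs \<mu>)
  have \<delta>: "\<delta> \<in> SF" unfolding \<delta>_def by (intro SF_mult \<mu> h)
  have hh: "h p * h p = inverse \<bar>\<mu> p\<bar>" for p
    by (simp add: h_def flip: inverse_mult_distrib)
  \<comment> \<open>\<delta> is the sign of \<mu>, so this selects \<open>C\<close> where \<mu> > 0
    and \<open>I\<close> composed with \<open>C\<close>, whose square is -\<epsilon> \<mu>, where
    \<mu> < 0. Since \<delta> is a smooth function the selection is smooth even if the sign differs
    between components. The second choice occurs only for \<epsilon> = 1.\<close>
  define A where "A = escale h (escale (\<lambda>p. 1/2 * (1 + \<delta> p)) C + escale (\<lambda>p. 1/2 * (1 - \<delta> p)) (ecomp I C))"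
  have A: "A \<in> PF"
    unfolding A_def by (intro PF_ops C IC h SF_cmult SF_add SF_diff \<delta> SF_const)
  have A_v: "A p v = h p *\<^sub>R (if \<mu> p > 0 then C p v else I p (C p v))" for p v
  proof -
    have "\<delta> p = (if \<mu> p > 0 then 1 else - 1)" using mu_nz[of p] by (simp add: \<delta>_def hh)
    then show ?thesis by (simp add: A_def escale_def ecomp_def)
  qed
  interpret quaternionic_frame \<A> P I A \<epsilon>
  proof
    fix p v assume v: "v \<in> TS p"
    show "I p (I p v) = \<epsilon> *\<^sub>R v" using II[OF v] .
    show "A p (I p v) = - I p (A p v)"
      using v by (simp add: A_v simps C_I)
    show "A p (A p v) = v"
    proof (cases "\<mu> p > 0")
      case True
      then have "A p (A p v) = (h p * h p * \<mu> p) *\<^sub>R v"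
        using v by (simp add: A_v simps C_C mult.assoc)
      then show ?thesis using True by (simp add: hh)
    next
      case False
      have "\<epsilon> = 1" using eps pos[of p] False by (auto simp: \<mu>_def)
      then have "A p (A p v) = (- (h p * h p * \<mu> p)) *\<^sub>R v"
        using v False by (simp add: A_v simps C_C C_I II mult.assoc)
      then show ?thesis using False mu_nz[of p] by (simp add: hh)
    qed
  qed (use I A eps NI in auto)
  show ?thesis
    by (rule para_quaternionic_nondegenerate[OF C \<alpha> \<mu> C_I C_C mu_nz _ JJ NJ]) (simp_all add: C_def fun_eq_iff)
qed

section \<open>Null sections and their completion to sl2-triples\<close>

lemma section_pairing:
  assumes N: "N \<in> P p" "N \<noteq> 0"
  obtains K \<gamma> where "K \<in> PF" "\<gamma> \<noteq> 0" "\<And>v. v \<in> TS p \<Longrightarrow> N (K p v) + K p (N v) = \<gamma> *\<^sub>R v"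
proof -
  obtain U K1 K2 K3 where U: "open U" "p \<in> U" and b: "admissible_basis_on \<A> P U K1 K2 K3"
    using almost_para_quaternionic unfolding almost_para_quaternionic_def by meson
  note adm = admissible_basis_at[OF b U(2)]
  obtain \<rho> F where \<rho>: "\<rho> \<in> SF" "\<rho> p \<noteq> 0" "closed F" "F \<subseteq> U" "\<forall>q. q \<notin> F \<longrightarrow> \<rho> q = 0"
    using bump_function[OF U] .
  \<comment> \<open>A bump supported in \<open>U\<close> turns members of the local admissible basis
    into global sections.\<close>
  have K_PF: "(\<lambda>q. \<rho> q *\<^sub>R K q) \<in> PF"
    if s: "smooth_end_on \<A> U K" and K: "\<And>q. q \<in> U \<Longrightarrow> K q \<in> P q" for K
  proof -
    have P: "\<rho> q *\<^sub>R K q \<in> P q" for q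
      using \<rho>(4,5) K P_ops(3,4) by (cases "q \<in> F") auto
    have "app (\<lambda>q. \<rho> q *\<^sub>R K q) X \<in> VF" if X: "X \<in> VF" for X
    proof (rule VF_I)
      show "app (\<lambda>q. \<rho> q *\<^sub>R K q) X q \<in> TS q" for q
        using TE_closed[OF P_TE[OF P] VF_TS[OF X]] by (simp only: app_def)
      fix f assume f: "f \<in> SF"
      have "smooth_fun_on \<A> U (\<lambda>q. app K X q f)"
        using s X f unfolding smooth_end_on_def by blast
      with smooth_fun_on_subset[OF \<rho>(1)[unfolded SF_iff] subset_UNIV]
      have "smooth_fun_on \<A> U (\<lambda>q. \<rho> q * app K X q f)"
        by (rule smooth_fun_on_mult[OF U(1)])
      then show "(\<lambda>q. app (\<lambda>q. \<rho> q *\<^sub>R K q) X q f) \<in> SF"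
        by (rule SF_extend[OF \<rho>(3,4) U(1)]) (use \<rho>(5) in \<open>auto simp: app_def\<close>)
    qed
    then show ?thesis using P P_TE by (auto simp: PF_iff EF_iff)
  qed
  have s: "smooth_end_on \<A> U K1" "smooth_end_on \<A> U K2" "smooth_end_on \<A> U K3"
    using b unfolding admissible_basis_on_def almost_eps_complex_on_def by blast+
  have KP: "K1 q \<in> P q" "K2 q \<in> P q" "K3 q \<in> P q" if "q \<in> U" for q
  proof -
    have "P q = span {K1 q, K2 q, K3 q}" using b that unfolding admissible_basis_on_def by blast
    then show "K1 q \<in> P q" "K2 q \<in> P q" "K3 q \<in> P q" by (auto intro: span_base)
  qed
  obtain y1 y2 y3 where y: "N = y1 *\<^sub>R K1 p + y2 *\<^sub>R K2 p + y3 *\<^sub>R K3 p"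
    using admissible_coords[OF adm N(1)] .
  have pair: "N ((\<rho> p *\<^sub>R (z1 *\<^sub>R K1 p + z2 *\<^sub>R K2 p + z3 *\<^sub>R K3 p)) v)
      + (\<rho> p *\<^sub>R (z1 *\<^sub>R K1 p + z2 *\<^sub>R K2 p + z3 *\<^sub>R K3 p)) (N v)
      = \<rho> p *\<^sub>R ((2 * (- y1 * z1 + y2 * z2 + y3 * z3)) *\<^sub>R v)" if v: "v \<in> TS p" for v z1 z2 z3
  proof -
    let ?Z = "z1 *\<^sub>R K1 p + z2 *\<^sub>R K2 p + z3 *\<^sub>R K3 p"
    have "N ((\<rho> p *\<^sub>R ?Z) v) + (\<rho> p *\<^sub>R ?Z) (N v) = \<rho> p *\<^sub>R (N (?Z v) + ?Z (N v))"
      unfolding scaleR_apply[of "\<rho> p" ?Z]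
      by (subst TE_scale[OF P_TE[OF N(1)] TE_closed[OF admissible_P(2)[OF adm] v]])
        (rule scaleR_add_right[symmetric])
    also have "N (?Z v) + ?Z (N v) = (2 * (- y1 * z1 + y2 * z2 + y3 * z3)) *\<^sub>R v"
      unfolding y admissible_mult[OF adm v] by (simp add: fun_eq_iff algebra_simps)
    finally show ?thesis .
  qed
  \<comment> \<open>An admissible basis is orthogonal with no null members, so a non-zero
    \<open>N\<close> pairs non-trivially with one of them.\<close>
  have "y1 \<noteq> 0 \<or> y2 \<noteq> 0 \<or> y3 \<noteq> 0" using N(2) y by auto
  then consider "y1 \<noteq> 0" | "y2 \<noteq> 0" | "y3 \<noteq> 0" by blast
  then show ?thesis
  proof cases
    case 1
    show ?thesis
      by (rule that[OF K_PF[OF s(1) KP(1)], of "\<rho> p * (2 * - y1)"])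
        (use 1 \<rho>(2) pair[where ?z1.0 = 1 and ?z2.0 = 0 and ?z3.0 = 0] in auto)
  next
    case 2
    show ?thesis
      by (rule that[OF K_PF[OF s(2) KP(2)], of "\<rho> p * (2 * y2)"])
        (use 2 \<rho>(2) pair[where ?z1.0 = 0 and ?z2.0 = 1 and ?z3.0 = 0] in auto)
  next
    case 3
    show ?thesis
      by (rule that[OF K_PF[OF s(3) KP(3)], of "\<rho> p * (2 * y3)"])
        (use 3 \<rho>(2) pair[where ?z1.0 = 0 and ?z2.0 = 0 and ?z3.0 = 1] in auto)
  qed
qed

text \<open>Removing the \<open>I\<close>-component of a section does not change its pairing with
  \<open>N\<close>, which is orthogonal to \<open>I\<close>. The quotient t / \<gamma> will turn out
  to be the eigenvalue of \<open>I\<close> on the image of \<open>N\<close>.\<close>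

lemma null_section_pairing:
  assumes I: "I \<in> PF" and N: "N \<in> PF"
    and II: "\<And>p v. v \<in> TS p \<Longrightarrow> I p (I p v) = v"
    and NI: "\<And>p v. v \<in> TS p \<Longrightarrow> N p (I p v) = - I p (N p v)"
    and N0: "N p \<noteq> 0"
  obtains K \<gamma> t where "K \<in> PF" "\<gamma> \<in> SF" "t \<in> SF" "\<gamma> p \<noteq> 0"
    "\<forall>q. \<forall>v\<in>TS q. N q (K q v) + K q (N q v) = \<gamma> q *\<^sub>R v \<and> K q (I q v) = - I q (K q v) \<and>
      N q (K q v) - K q (N q v) = t q *\<^sub>R I q v"
proof -
  obtain K0 g where K0: "K0 \<in> PF" and g: "g \<noteq> 0" "\<And>v. v \<in> TS p \<Longrightarrow> N p (K0 p v) + K0 p (N p v) = g *\<^sub>R v"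
    using section_pairing[OF PF_P[OF N] N0] by metis
  obtain \<gamma> where \<gamma>: "\<gamma> \<in> SF" "\<And>p v. v \<in> TS p \<Longrightarrow> N p (K0 p v) + K0 p (N p v) = \<gamma> p *\<^sub>R v"
    using anticommutator_SF[OF N K0] by blast
  obtain \<kappa> where \<kappa>: "\<kappa> \<in> SF" "\<And>p v. v \<in> TS p \<Longrightarrow> I p (K0 p v) + K0 p (I p v) = \<kappa> p *\<^sub>R v"
    using anticommutator_SF[OF I K0] by blast
  define K where "K = K0 - escale (\<lambda>p. 1/2 * \<kappa> p) I"
  have K: "K \<in> PF" unfolding K_def by (intro PF_ops K0 I SF_cmult \<kappa>)
  note TE = P_TE[OF PF_P[OF I]] P_TE[OF PF_P[OF N]] P_TE[OF PF_P[OF K0]]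
  note simps = TE_simps[OF TE(1)] TE_simps[OF TE(2)] TE_simps[OF TE(3)]
  have K_v: "K q v = K0 q v - (1/2 * \<kappa> q) *\<^sub>R I q v" for q v
    by (simp add: K_def escale_def)
  have NK: "N q (K q v) + K q (N q v) = \<gamma> q *\<^sub>R v" if v: "v \<in> TS q" for q v
    using v NI[OF v] by (simp add: K_v simps flip: \<gamma>(2))
  have KI: "K q (I q v) = - I q (K q v)" if v: "v \<in> TS q" for q v
  proof -
    have "K0 q (I q v) = \<kappa> q *\<^sub>R v - I q (K0 q v)" using \<kappa>(2)[OF v] by (simp add: algebra_simps)
    then show ?thesis using v by (simp add: K_v simps II) (simp add: fun_eq_iff algebra_simps)
  qed
  define W where "W = ecomp N K - ecomp K N"
  have W: "W \<in> PF" unfolding W_def by (rule commutator_PF[OF PF_QF[OF N] K])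
  obtain w where w: "w \<in> SF" "\<And>p v. v \<in> TS p \<Longrightarrow> I p (W p v) + W p (I p v) = w p *\<^sub>R v"
    using anticommutator_SF[OF I W] by blast
  have W_v: "W q v = N q (K q v) - K q (N q v)" for q v by (simp add: W_def ecomp_def)
  note TEK = TE_simps[OF P_TE[OF PF_P[OF K]]]
  have "W q v = (1/2 * w q) *\<^sub>R I q v" if v: "v \<in> TS q" for q v
  proof -
    \<comment> \<open>A commutator of two sections that anticommute with \<open>I\<close> commutes
      with \<open>I\<close>. Being a section of \<open>P\<close>, it is then a multiple of
      \<open>I\<close>, as its anticommutator with \<open>I\<close> is both 2 I W and a
      scalar.\<close>
    have "W q (I q v) = I q (W q v)"
      using v by (simp add: W_v simps TEK KI NI)
    then have "I q (W q v) + I q (W q v) = w q *\<^sub>R v" using w(2)[OF v] by simp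
    then have "I q (W q v) = (1/2 * w q) *\<^sub>R v" by (simp add: fun_eq_iff field_simps)
    then have "I q (I q (W q v)) = I q ((1/2 * w q) *\<^sub>R v)" by simp
    then show ?thesis
      using v TE_closed[OF P_TE[OF PF_P[OF W]] v] by (simp add: II simps)
  qed
  then have t: "N q (K q v) - K q (N q v) = (1/2 * w q) *\<^sub>R I q v" if "v \<in> TS q" for q v
    using that by (simp add: W_v)
  have "\<gamma> p \<noteq> 0"
  proof -
    have "\<gamma> p = g" by (rule scalar_unique[of p]) (use \<gamma>(2) g(2) in metis)
    then show ?thesis using g(1) by simp
  qed
  then show ?thesis using that[OF K \<gamma>(1) SF_cmult[OF w(1)]] NK KI t by blast
qed

text \<open>A null section orthogonal to \<^term>\<open>I\<close> completes to a standard \<open>sl\<^sub>2\<close>-triple. Its third member is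
  unique, so that local constructions of it agree.\<close>

lemma null_section_triple:
  assumes I: "I \<in> PF" and N: "N \<in> PF"
    and II: "\<And>p v. v \<in> TS p \<Longrightarrow> I p (I p v) = v"
    and NI: "\<And>p v. v \<in> TS p \<Longrightarrow> N p (I p v) = - I p (N p v)"
    and NN: "\<And>p v. v \<in> TS p \<Longrightarrow> N p (N p v) = 0"
    and N0: "\<And>p. N p \<noteq> 0"
  obtains \<sigma> M where "\<sigma> \<in> SF" "M \<in> PF" "\<forall>p. \<sigma> p * \<sigma> p = 1"
    "\<forall>p. \<forall>v\<in>TS p. I p (N p v) = \<sigma> p *\<^sub>R N p v \<and> I p (M p v) = - \<sigma> p *\<^sub>R M p v \<and>
      M p (I p v) = - I p (M p v) \<and> N p (M p v) + M p (N p v) = v \<and> M p (M p v) = 0"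
proof -
  note TE = P_TE[OF PF_P[OF I]] P_TE[OF PF_P[OF N]]
  note simps = TE_simps[OF TE(1)] TE_simps[OF TE(2)]
  have pairing: "\<exists>K\<in>PF. \<exists>\<gamma>\<in>SF. \<exists>t\<in>SF. \<gamma> p \<noteq> 0 \<and>
    (\<forall>q. \<forall>v\<in>TS q. N q (K q v) + K q (N q v) = \<gamma> q *\<^sub>R v \<and> K q (I q v) = - I q (K q v) \<and>
      N q (K q v) - K q (N q v) = t q *\<^sub>R I q v)" for p
    by (rule null_section_pairing[OF I N II NI N0[of p]]) blast+
  have nonzero: "\<exists>v\<in>TS p. N p v \<noteq> 0" for p
  proof (rule ccontr)
    assume "\<not> (\<exists>v\<in>TS p. N p v \<noteq> 0)"
    then have "N p v = 0" for v using TE_outside[OF TE(2)] by blast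
    then show False using N0[of p] by (simp add: fun_eq_iff)
  qed
  \<comment> \<open>The sum of the two relations is 2 N K = \<gamma> + t I. Applying
    \<open>N\<close> kills the left-hand side and leaves \<gamma> N = t I N.\<close>
  have key: "\<gamma> *\<^sub>R N q v = t *\<^sub>R I q (N q v)"
    if K: "K \<in> tangent_end \<A> q" "\<forall>v\<in>TS q. N q (K v) + K (N q v) = \<gamma> *\<^sub>R v \<and> N q (K v) - K (N q v) = t *\<^sub>R I q v"
      and v: "v \<in> TS q" for K \<gamma> t q v
  proof -
    have "(N q (K v) + K (N q v)) + (N q (K v) - K (N q v)) = \<gamma> *\<^sub>R v + t *\<^sub>R I q v"
      using K(2) v by simp
    then have "2 *\<^sub>R N q (K v) = \<gamma> *\<^sub>R v + t *\<^sub>R I q v" by (simp add: scaleR_2)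
    then have "N q (2 *\<^sub>R N q (K v)) = N q (\<gamma> *\<^sub>R v + t *\<^sub>R I q v)" by simp
    then show ?thesis using v TE_closed[OF K(1) v] by (simp add: simps NN NI)
  qed
  have "\<exists>s. s * s = 1 \<and> (\<forall>v\<in>TS p. I p (N p v) = s *\<^sub>R N p v)" for p
  proof -
    obtain K \<gamma> t where K: "K \<in> PF" "\<gamma> p \<noteq> 0" "\<forall>q. \<forall>v\<in>TS q. N q (K q v) + K q (N q v) = \<gamma> q *\<^sub>R v \<and>
      K q (I q v) = - I q (K q v) \<and> N q (K q v) - K q (N q v) = t q *\<^sub>R I q v"
      using pairing[of p] by blast
    have *: "\<gamma> p *\<^sub>R N p v = t p *\<^sub>R I p (N p v)" if "v \<in> TS p" for v
      by (rule key[OF P_TE[OF PF_P[OF K(1)]] _ that]) (use K(3) in blast)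
    have **: "\<gamma> p *\<^sub>R I p (N p v) = t p *\<^sub>R N p v" if v: "v \<in> TS p" for v
    proof -
      have "I p (\<gamma> p *\<^sub>R N p v) = I p (t p *\<^sub>R I p (N p v))" using *[OF v] by simp
      then show ?thesis using v by (simp add: simps II)
    qed
    obtain v where v: "v \<in> TS p" "N p v \<noteq> 0" using nonzero by blast
    have "(\<gamma> p * \<gamma> p) *\<^sub>R N p v = (t p * t p) *\<^sub>R N p v"
    proof -
      have "(\<gamma> p * \<gamma> p) *\<^sub>R N p v = \<gamma> p *\<^sub>R (t p *\<^sub>R I p (N p v))"
        by (simp only: *[OF v(1), symmetric] scaleR_scaleR)
      also have "\<dots> = t p *\<^sub>R (\<gamma> p *\<^sub>R I p (N p v))" by (simp only: scaleR_scaleR mult.commute)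
      finally show ?thesis by (simp only: **[OF v(1)] scaleR_scaleR)
    qed
    then have "\<gamma> p * \<gamma> p = t p * t p" using v(2) by simp
    moreover have "I p (N p v) = (t p / \<gamma> p) *\<^sub>R N p v" if v: "v \<in> TS p" for v
    proof -
      have "inverse (\<gamma> p) *\<^sub>R (\<gamma> p *\<^sub>R I p (N p v)) = inverse (\<gamma> p) *\<^sub>R (t p *\<^sub>R N p v)"
        using **[OF v] by simp
      then show ?thesis using K(2) by (simp add: divide_inverse mult.commute)
    qed
    ultimately show ?thesis using K(2) by (intro exI[of _ "t p / \<gamma> p"]) (auto simp: field_simps)
  qed
  then obtain \<sigma> where \<sigma>: "\<And>p. \<sigma> p * \<sigma> p = 1" "\<And>p v. v \<in> TS p \<Longrightarrow> I p (N p v) = \<sigma> p *\<^sub>R N p v"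
    by metis
  have \<sigma>_SF: "\<sigma> \<in> SF"
  proof (rule SF_quotient_local)
    fix p
    obtain K \<gamma> t where K: "K \<in> PF" "\<gamma> \<in> SF" "t \<in> SF" "\<gamma> p \<noteq> 0"
      "\<forall>q. \<forall>v\<in>TS q. N q (K q v) + K q (N q v) = \<gamma> q *\<^sub>R v \<and>
        K q (I q v) = - I q (K q v) \<and> N q (K q v) - K q (N q v) = t q *\<^sub>R I q v"
      using pairing[of p] by blast
    have "\<gamma> q * \<sigma> q = t q" for q
    proof -
      obtain v where v: "v \<in> TS q" "N q v \<noteq> 0" using nonzero by blast
      have "\<gamma> q *\<^sub>R N q v = t q *\<^sub>R I q (N q v)"
        by (rule key[OF P_TE[OF PF_P[OF K(1)]] _ v(1)]) (use K(5) in blast)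
      then have "\<gamma> q = t q * \<sigma> q" using v \<sigma>(2) by simp
      then show ?thesis using \<sigma>(1)[of q] by (simp add: mult.assoc)
    qed
    then show "\<exists>g\<in>SF. \<exists>h\<in>SF. g p \<noteq> 0 \<and> (\<forall>q. g q \<noteq> 0 \<longrightarrow> g q * \<sigma> q = h q)"
      using K by blast
  qed
  \<comment> \<open>The remaining null direction orthogonal to \<open>I\<close>, scaled so that its
    anticommutator with \<open>N\<close> is 1.\<close>
  define dual where "dual q M \<longleftrightarrow> M \<in> P q \<and> (\<forall>v\<in>TS q. I q (M v) = - \<sigma> q *\<^sub>R M v \<and>
    M (I q v) = - I q (M v) \<and> N q (M v) + M (N q v) = v)" for q M
  \<comment> \<open>The witness is K N K / \<gamma>^2, which inherits the required eigenvalue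
    because \<open>K\<close> anticommutes with \<open>I\<close>. It lies in \<open>P q\<close> since
    K N K = \<gamma> K - k N with K^2 = k.\<close>
  have dual_ex: "dual q (inverse (\<gamma> * \<gamma>) *\<^sub>R (\<gamma> *\<^sub>R K - k *\<^sub>R N q))"
    and dual_eq: "\<And>v. v \<in> TS q \<Longrightarrow> (\<gamma> *\<^sub>R K - k *\<^sub>R N q) v = K (N q (K v))"
    if K: "K \<in> P q" "\<forall>v\<in>TS q. N q (K v) + K (N q v) = \<gamma> *\<^sub>R v \<and> K (I q v) = - I q (K v)"
      and k: "\<forall>v\<in>TS q. K (K v) = k *\<^sub>R v" and g: "\<gamma> \<noteq> 0" for K \<gamma> k q
  proof -
    note KT = TE_simps[OF P_TE[OF K(1)]]
    have KN: "K (N q v) = \<gamma> *\<^sub>R v - N q (K v)" and KI: "K (I q v) = - I q (K v)"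
      and KK: "K (K v) = k *\<^sub>R v" if "v \<in> TS q" for v
      using K(2) k that by (simp_all add: eq_diff_eq add.commute)
    show *: "(\<gamma> *\<^sub>R K - k *\<^sub>R N q) v = K (N q (K v))" if v: "v \<in> TS q" for v
      using v by (simp add: KN KT KK simps)
    let ?M = "inverse (\<gamma> * \<gamma>) *\<^sub>R (\<gamma> *\<^sub>R K - k *\<^sub>R N q)"
    have M: "?M v = inverse (\<gamma> * \<gamma>) *\<^sub>R K (N q (K v))" if "v \<in> TS q" for v
      by (simp only: scaleR_apply *[OF that])
    have "?M \<in> P q" by (intro P_ops K PF_P N)
    moreover have "I q (?M v) = - \<sigma> q *\<^sub>R ?M v \<and> ?M (I q v) = - I q (?M v) \<and> N q (?M v) + ?M (N q v) = v"
      if v: "v \<in> TS q" for v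
    proof (intro conjI)
      have w: "K v \<in> TS q" "N q (K v) \<in> TS q" "K (N q (K v)) \<in> TS q" "N q v \<in> TS q" "I q v \<in> TS q"
        using v by (simp_all add: KT simps)
      have "I q (K (N q (K v))) = - K (I q (N q (K v)))" using KI[OF w(2)] by simp
      also have "\<dots> = - \<sigma> q *\<^sub>R K (N q (K v))" using w by (simp add: \<sigma>(2) KT)
      finally show "I q (?M v) = - \<sigma> q *\<^sub>R ?M v"
        unfolding M[OF v] using w by (simp add: simps)
      show "?M (I q v) = - I q (?M v)"
        unfolding M[OF v] M[OF w(5)] using v w by (simp add: KI NI KT simps)
      have "N q (K (N q (K v))) = \<gamma> *\<^sub>R N q (K v)"
        unfolding KN[OF w(1)] using w(1) KT(1)[OF w(1)] by (simp add: simps NN)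
      note NKNK = this
      have KNKN: "K (N q (K (N q v))) = \<gamma> *\<^sub>R K (N q v)"
        using v w by (subst KN[OF v]) (simp add: simps NN KT)
      have "N q (K v) + K (N q v) = \<gamma> *\<^sub>R v" using K(2) v by blast
      then have "N q (K (N q (K v))) + K (N q (K (N q v))) = (\<gamma> * \<gamma>) *\<^sub>R v"
        by (simp only: NKNK KNKN scaleR_add_right[symmetric] scaleR_scaleR)
      then have "inverse (\<gamma> * \<gamma>) *\<^sub>R (N q (K (N q (K v))) + K (N q (K (N q v)))) = v"
        using g by (simp only: scaleR_scaleR) (simp add: field_simps)
      then show "N q (?M v) + ?M (N q v) = v"
        unfolding M[OF v] M[OF w(4)] using w by (simp only: TE_scale[OF TE(2)] scaleR_add_right)
    qed
    ultimately show "dual q ?M" by (simp add: dual_def)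
  qed
  have dual_unique: "M = M'" if M: "dual q M" "dual q M'" for q M M'
  proof (rule TE_eqI)
    show T: "M \<in> tangent_end \<A> q" "M' \<in> tangent_end \<A> q"
      using M P_TE by (auto simp: dual_def)
    note MT = TE_simps[OF T(1)] TE_simps[OF T(2)]
    have m: "I q (M v) = - \<sigma> q *\<^sub>R M v" "M (I q v) = - I q (M v)" "N q (M v) + M (N q v) = v"
      "I q (M' v) = - \<sigma> q *\<^sub>R M' v" "N q (M' v) + M' (N q v) = v" if "v \<in> TS q" for v
      using M that unfolding dual_def by blast+
    define d where "d v = M v - M' v" for v
    \<comment> \<open>\<open>d\<close> takes values in the (-\<sigma>)-eigenspace of
      \<open>I\<close>. There \<open>M\<close> vanishes, since it anticommutes with \<open>I\<close>
      and itself takes values in that eigenspace. With N d = -d N this gives d = N M d + M N d =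
      0.\<close>
    have Md: "M (d v) = 0" if v: "v \<in> TS q" for v
    proof -
      have dT: "d v \<in> TS q" using v by (simp add: d_def MT)
      have "I q (d v) = - \<sigma> q *\<^sub>R d v"
        using v by (simp add: d_def simps MT m scaleR_diff_right)
      then have "- \<sigma> q *\<^sub>R M (d v) = - (- \<sigma> q *\<^sub>R M (d v))"
        using m(1,2)[OF dT] dT by (simp add: MT)
      then have "\<sigma> q *\<^sub>R M (d v) = 0" by (simp add: fun_eq_iff)
      then show ?thesis using \<sigma>(1)[of q] by auto
    qed
    fix v assume v: "v \<in> TS q"
    have w: "d v \<in> TS q" "N q v \<in> TS q" "d (N q v) \<in> TS q" "N q (d v) \<in> TS q"
      using v by (simp_all add: d_def MT simps)
    have "N q (d v) = - d (N q v)"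
    proof -
      have "N q (M v) + M (N q v) = N q (M' v) + M' (N q v)" using m(3,5)[OF v] by simp
      then show ?thesis using v by (simp add: d_def simps MT algebra_simps)
    qed
    then have "M (N q (d v)) = 0" using Md[OF w(2)] w by (simp add: MT)
    then have "d v = 0" using m(3)[OF w(1)] Md[OF v] by (simp add: simps)
    then show "M v = M' v" by (simp add: d_def)
  qed
  have local: "\<exists>K\<in>PF. \<exists>\<gamma>\<in>SF. \<gamma> p \<noteq> 0 \<and> (\<forall>q. \<gamma> q \<noteq> 0 \<longrightarrow>
    (\<exists>M. dual q M \<and> (\<forall>v\<in>TS q. (\<gamma> q * \<gamma> q) *\<^sub>R M v = K q (N q (K q v)))))" for p
  proof -
    obtain K \<gamma> t where K: "K \<in> PF" "\<gamma> \<in> SF" "\<gamma> p \<noteq> 0" "\<forall>q. \<forall>v\<in>TS q.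
      N q (K q v) + K q (N q v) = \<gamma> q *\<^sub>R v \<and> K q (I q v) = - I q (K q v) \<and>
      N q (K q v) - K q (N q v) = t q *\<^sub>R I q v"
      using pairing[of p] by blast
    obtain k where k: "\<And>q v. v \<in> TS q \<Longrightarrow> K q (K q v) + K q (K q v) = k q *\<^sub>R v"
      using anticommutator_SF[OF K(1) K(1)] by metis
    have "\<exists>M. dual q M \<and> (\<forall>v\<in>TS q. (\<gamma> q * \<gamma> q) *\<^sub>R M v = K q (N q (K q v)))" if g: "\<gamma> q \<noteq> 0" for q
    proof -
      have k2: "\<forall>v\<in>TS q. K q (K q v) = (1/2 * k q) *\<^sub>R v"
      proof
        fix v assume "v \<in> TS q"
        then have "(1/2) *\<^sub>R (2 *\<^sub>R K q (K q v)) = (1/2) *\<^sub>R (k q *\<^sub>R v)"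
          using k by (simp only: scaleR_2)
        then show "K q (K q v) = (1/2 * k q) *\<^sub>R v" by simp
      qed
      have K4: "\<forall>v\<in>TS q. N q (K q v) + K q (N q v) = \<gamma> q *\<^sub>R v \<and> K q (I q v) = - I q (K q v)"
        using K(4) by blast
      note d = dual_ex[OF PF_P[OF K(1)] K4 k2 g] dual_eq[OF PF_P[OF K(1)] K4 k2 g]
      show ?thesis
      proof (rule exI, rule conjI[OF d(1)], rule ballI)
        have gg: "\<gamma> q * \<gamma> q * inverse (\<gamma> q * \<gamma> q) = 1" by (rule right_inverse) (simp add: g)
        show "(\<gamma> q * \<gamma> q) *\<^sub>R (inverse (\<gamma> q * \<gamma> q) *\<^sub>R (\<gamma> q *\<^sub>R K q - (1/2 * k q) *\<^sub>R N q)) v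
          = K q (N q (K q v))" if "v \<in> TS q" for v
          by (simp only: scaleR_apply scaleR_scaleR gg scaleR_one d(2)[OF that])
      qed
    qed
    then show ?thesis using K(1-3) by blast
  qed
  then have "\<exists>M. dual q M" for q by meson
  then obtain M where M: "\<And>q. dual q (M q)" by metis
  have MP: "M q \<in> P q" for q using M by (simp add: dual_def)
  have M_PF: "M \<in> PF"
  proof -
    have "app M X \<in> VF" if X: "X \<in> VF" for X
    proof (rule VF_I)
      show "app M X q \<in> TS q" for q
        using TE_closed[OF P_TE[OF MP] VF_TS[OF X]] by (simp add: app_def)
      fix f assume f: "f \<in> SF"
      show "(\<lambda>q. app M X q f) \<in> SF"
      proof (rule SF_quotient_local)
        fix p
        obtain K \<gamma> where K: "K \<in> PF" "\<gamma> \<in> SF" "\<gamma> p \<noteq> 0" "\<forall>q. \<gamma> q \<noteq> 0 \<longrightarrow>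
          (\<exists>M. dual q M \<and> (\<forall>v\<in>TS q. (\<gamma> q * \<gamma> q) *\<^sub>R M v = K q (N q (K q v))))"
          using local[of p] by blast
        have "(\<gamma> q * \<gamma> q) * app M X q f = app K (app N (app K X)) q f" if g: "\<gamma> q \<noteq> 0" for q
        proof -
          obtain M' where M': "dual q M'" "\<forall>v\<in>TS q. (\<gamma> q * \<gamma> q) *\<^sub>R M' v = K q (N q (K q v))"
            using K(4) g by blast
          then have "(\<gamma> q * \<gamma> q) *\<^sub>R M q (X q) = K q (N q (K q (X q)))"
            using dual_unique[OF M M'(1)] VF_TS[OF X] by simp
          then show ?thesis by (simp add: app_def fun_eq_iff)
        qed
        moreover have "(\<lambda>q. app K (app N (app K X)) q f) \<in> SF"
          by (intro VF_SF[OF app_VF[OF PF_EF[OF K(1)] app_VF[OF PF_EF[OF N] app_VF[OF PF_EF[OF K(1)] X]]] f])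
        moreover have "(\<lambda>q. \<gamma> q * \<gamma> q) \<in> SF" by (intro SF_mult K)
        ultimately show "\<exists>g\<in>SF. \<exists>h\<in>SF. g p \<noteq> 0 \<and> (\<forall>q. g q \<noteq> 0 \<longrightarrow> g q * app M X q f = h q)"
          using K(3) by (intro bexI[of _ "\<lambda>q. \<gamma> q * \<gamma> q"] bexI[of _ "\<lambda>q. app K (app N (app K X)) q f"]) auto
      qed
    qed
    then show ?thesis using MP P_TE by (simp add: PF_iff EF_iff)
  qed
  have m: "I p (M p v) = - \<sigma> p *\<^sub>R M p v" "M p (I p v) = - I p (M p v)" "N p (M p v) + M p (N p v) = v"
    if "v \<in> TS p" for p v
    using M that unfolding dual_def by blast+
  have "M p (M p v) = 0" if v: "v \<in> TS p" for p v
  proof -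
    note MT = TE_simps[OF P_TE[OF MP]]
    have w: "M p v \<in> TS p" using v by (simp add: MT)
    have "- \<sigma> p *\<^sub>R M p (M p v) = - (- \<sigma> p *\<^sub>R M p (M p v))"
      using m(1)[OF v] m(1,2)[OF w] w by (simp add: MT)
    then have "\<sigma> p *\<^sub>R M p (M p v) = 0" by (simp add: fun_eq_iff)
    then show ?thesis using \<sigma>(1)[of p] by auto
  qed
  then show ?thesis using that[OF \<sigma>_SF M_PF] \<sigma> m by blast
qed

section \<open>The three situations of the theorem\<close>

lemma eps_complexD:
  assumes "eps_complex \<A> \<epsilon> I" "compatible P I"
  shows "I \<in> PF" "\<And>p v. v \<in> TS p \<Longrightarrow> I p (I p v) = \<epsilon> *\<^sub>R v" "\<epsilon> = 1 \<or> \<epsilon> = - 1"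
    "\<And>X Y. X \<in> VF \<Longrightarrow> Y \<in> VF \<Longrightarrow> nijenhuis \<epsilon> I X Y = 0"
  using assms unfolding eps_complex_def almost_eps_complex_on_def compatible_def sections_def by auto

text \<open>Comparing squares gives c^2 \<epsilon> = \<eta>, hence c^2 = 1 over the reals. So
  structures that differ by more than a sign are linearly independent.\<close>

lemma proportional_units:
  assumes I: "I \<in> P p" "\<And>v. v \<in> TS p \<Longrightarrow> I (I v) = \<epsilon> *\<^sub>R v" and \<epsilon>: "\<epsilon> = 1 \<or> \<epsilon> = - 1"
    and J: "J \<in> P p" "\<And>v. v \<in> TS p \<Longrightarrow> J (J v) = \<eta> *\<^sub>R v" and \<eta>: "\<eta> = 1 \<or> \<eta> = - 1"
    and eq: "J = c *\<^sub>R I"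
  shows "I = J \<or> I = - J"
proof -
  have "c * c * \<epsilon> = \<eta>"
  proof (rule scalar_unique[of p])
    fix v assume v: "v \<in> TS p"
    have "J (J v) = (c * c * \<epsilon>) *\<^sub>R v"
      using v by (simp add: eq TE_simps[OF P_TE[OF I(1)]] I(2) mult.assoc)
    from this[symmetric] J(2)[OF v] show "(c * c * \<epsilon>) *\<^sub>R v = \<eta> *\<^sub>R v" by (rule trans)
  qed
  moreover have "c * c \<noteq> - 1" using zero_le_square[of c] by linarith
  ultimately have "c * c = 1" using \<epsilon> \<eta> by auto
  then have "c = 1 \<or> c = - 1" by (simp add: square_eq_1_iff)
  then show ?thesis using eq by auto
qed

text \<open>A complex \<open>I\<close> is timelike, so the part of \<open>J\<close> orthogonal to
  it, non-zero by independence, has positive norm. As \<open>I\<close> has norm -1, that part is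
  \<open>J\<close> plus x / 2 times \<open>I\<close>.\<close>

theorem complex_case:
  assumes I: "complex_structure \<A> I" "compatible P I" and J: "eps_complex \<A> \<eta> J" "compatible P J"
    and ind: "\<And>p. I p \<noteq> J p \<and> I p \<noteq> - J p"
  shows "para_quaternionic \<A> P"
proof -
  note I = eps_complexD[OF I] and J = eps_complexD[OF J]
  obtain x where x: "x \<in> SF" "\<And>p v. v \<in> TS p \<Longrightarrow> I p (J p v) + J p (I p v) = x p *\<^sub>R v"
    using anticommutator_SF[OF I(1) J(1)] by blast
  have pos: "\<eta> + x p * x p / 4 > 0" for p
  proof -
    define C where "C = J p + (1/2 * x p) *\<^sub>R I p"
    have C: "C \<in> P p" unfolding C_def by (intro P_ops PF_P I J)
    note TE = TE_simps[OF P_TE[OF PF_P[OF I(1)]]] TE_simps[OF P_TE[OF PF_P[OF J(1)]]]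
    have J_I: "J p (I p v) = x p *\<^sub>R v - I p (J p v)" if "v \<in> TS p" for v
      using x(2)[OF that] by (simp add: algebra_simps)
    show ?thesis
    proof (rule timelike_orthogonal[OF PF_P[OF I(1)] _ C])
      show "I p (I p v) = - v" if "v \<in> TS p" for v using I(2)[OF that] by simp
      show "C (I p v) = - I p (C v)" if "v \<in> TS p" for v
        using that by (simp add: C_def TE I(2) J_I) (simp add: fun_eq_iff algebra_simps)
      show "C (C v) = (\<eta> + x p * x p / 4) *\<^sub>R v" if "v \<in> TS p" for v
        using that by (simp add: C_def TE I(2) J(2) J_I) (simp add: fun_eq_iff algebra_simps)
      show "C \<noteq> 0"
      proof
        assume "C = 0"
        then have "J p = (- (1/2 * x p)) *\<^sub>R I p" by (simp add: C_def eq_neg_iff_add_eq_0)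
        from proportional_units[OF PF_P[OF I(1)] I(2,3) PF_P[OF J(1)] J(2,3) this] ind[of p]
        show False by blast
      qed
    qed
  qed
  show ?thesis
    by (rule two_structures[OF I(1) J(1) I(3) x(1) I(2) J(2) I(4) J(4) x(2)])
      (use pos in \<open>simp_all add: less_imp_neq[symmetric]\<close>)
qed

text \<open>1 - x^2 / 4 is the Gram determinant of \<open>I\<close> and \<open>J\<close>. If it
  vanished, the part of \<open>J\<close> orthogonal to \<open>I\<close> would be orthogonal to the
  whole plane, hence 0.\<close>

theorem nondegenerate_para_complex_case:
  assumes I: "para_complex_structure \<A> I" "compatible P I" and J: "para_complex_structure \<A> J" "compatible P J"
    and ind: "\<And>p. I p \<noteq> J p \<and> I p \<noteq> - J p"
    and nd: "\<And>p. nondegenerate_at \<A> P p (span {I p, J p})"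
  shows "para_quaternionic \<A> P"
proof -
  note I = eps_complexD[OF I] and J = eps_complexD[OF J]
  obtain x where x: "x \<in> SF" "\<And>p v. v \<in> TS p \<Longrightarrow> I p (J p v) + J p (I p v) = x p *\<^sub>R v"
    using anticommutator_SF[OF I(1) J(1)] by blast
  have nz: "1 - x p * x p / 4 \<noteq> 0" for p
  proof
    assume xx: "1 - x p * x p / 4 = 0"
    define C where "C = J p - (1/2 * x p) *\<^sub>R I p"
    have C: "C \<in> P p" unfolding C_def by (intro P_ops PF_P I J)
    have C_span: "C \<in> span {I p, J p}"
      unfolding C_def by (intro span_diff span_scale span_base) auto
    note TE = TE_simps[OF P_TE[OF PF_P[OF I(1)]]] TE_simps[OF P_TE[OF PF_P[OF J(1)]]]
    have J_I: "J p (I p v) = x p *\<^sub>R v - I p (J p v)" if "v \<in> TS p" for v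
      using x(2)[OF that] by (simp add: algebra_simps)
    have "lorentz \<A> P p C B = 0" if B_span: "B \<in> span {I p, J p}" for B
    proof (rule lorentz_eqI[OF C])
      obtain b c where "B - b *\<^sub>R I p - c *\<^sub>R J p = 0"
        using B_span unfolding span_insert span_empty by auto
      then have B: "B = b *\<^sub>R I p + c *\<^sub>R J p" by (simp add: algebra_simps)
      show "B \<in> P p" unfolding B by (intro P_ops PF_P I J)
      fix v assume v: "v \<in> TS p"
      have "C (B v) + B (C v) = (2 * c * (1 - x p * x p / 4)) *\<^sub>R v"
        using v by (simp add: B C_def TE I(2) J(2) J_I) (simp add: fun_eq_iff algebra_simps)
      then show "C (B v) + B (C v) = (2 * 0) *\<^sub>R v" by (simp add: xx)
    qed
    then have "C = 0" using nd[of p] C_span unfolding nondegenerate_at_def by blast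
    then have "J p = (1/2 * x p) *\<^sub>R I p" by (simp add: C_def)
    from proportional_units[OF PF_P[OF I(1)] I(2,3) PF_P[OF J(1)] J(2,3) this] ind[of p]
    show False by blast
  qed
  show ?thesis
    by (rule two_structures[OF I(1) J(1) I(3) x(1) I(2) J(2) I(4) J(4) x(2)])
      (use nz in simp_all)
qed

text \<open>A vector b I + c J in the radical of the plane solves the homogeneous system with matrix
  (2, r; r, 2), whose determinant 4 - r^2 must vanish.\<close>

lemma degenerate_pair:
  assumes I: "I \<in> PF" and J: "J \<in> PF"
    and II: "\<And>v. v \<in> TS p \<Longrightarrow> I p (I p v) = v" and JJ: "\<And>v. v \<in> TS p \<Longrightarrow> J p (J p v) = v"
    and IJ: "\<And>v. v \<in> TS p \<Longrightarrow> I p (J p v) + J p (I p v) = r *\<^sub>R v"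
    and deg: "\<not> nondegenerate_at \<A> P p (span {I p, J p})"
  shows "r * r = 4"
proof -
  obtain W where W: "W \<in> span {I p, J p}" "W \<noteq> 0"
    and W0: "\<And>B. B \<in> span {I p, J p} \<Longrightarrow> lorentz \<A> P p W B = 0"
    using deg unfolding nondegenerate_at_def by blast
  obtain b c where "W - b *\<^sub>R I p - c *\<^sub>R J p = 0"
    using W(1) unfolding span_insert span_empty by auto
  then have W_eq: "W = b *\<^sub>R I p + c *\<^sub>R J p" by (simp add: algebra_simps)
  have WP: "W \<in> P p" unfolding W_eq by (intro P_ops PF_P I J)
  note TE = TE_simps[OF P_TE[OF PF_P[OF I]]] TE_simps[OF P_TE[OF PF_P[OF J]]]
  have J_I: "J p (I p v) = r *\<^sub>R v - I p (J p v)" if "v \<in> TS p" for v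
    using IJ[OF that] by (simp add: algebra_simps)
  have "2 * b + c * r = 0"
  proof (rule scalar_unique[of p])
    fix v assume v: "v \<in> TS p"
    have "W (I p v) + I p (W v) = (2 * b + c * r) *\<^sub>R v"
      using v by (simp add: W_eq TE II J_I) (simp add: fun_eq_iff algebra_simps)
    moreover have "I p \<in> span {I p, J p}" by (simp add: span_base)
    ultimately show "(2 * b + c * r) *\<^sub>R v = 0 *\<^sub>R v"
      using lorentz_anticommutator[OF WP PF_P[OF I] v] W0 by simp
  qed
  moreover have "b * r + 2 * c = 0"
  proof (rule scalar_unique[of p])
    fix v assume v: "v \<in> TS p"
    have "W (J p v) + J p (W v) = (b * r + 2 * c) *\<^sub>R v"
      using v by (simp add: W_eq TE JJ J_I) (simp add: fun_eq_iff algebra_simps)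
    moreover have "J p \<in> span {I p, J p}" by (simp add: span_base)
    ultimately show "(b * r + 2 * c) *\<^sub>R v = 0 *\<^sub>R v"
      using lorentz_anticommutator[OF WP PF_P[OF J] v] W0 by simp
  qed
  moreover have "b \<noteq> 0 \<or> c \<noteq> 0" using W(2) W_eq by auto
  ultimately show ?thesis by algebra
qed

theorem degenerate_para_complex_case:
  assumes I: "para_complex_structure \<A> I" "compatible P I" and J: "para_complex_structure \<A> J" "compatible P J"
    and K: "para_complex_structure \<A> K" "compatible P K"
    and ind: "\<And>p. I p \<noteq> J p \<and> I p \<noteq> - J p" "\<And>p. I p \<noteq> K p \<and> I p \<noteq> - K p" "\<And>p. J p \<noteq> K p \<and> J p \<noteq> - K p"
    and dep: "\<And>p. \<exists>c1 c2 c3 :: real. (c1, c2, c3) \<noteq> (0, 0, 0) \<and>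
      c1 *\<^sub>R I p + c2 *\<^sub>R J p + c3 *\<^sub>R K p = 0"
    and deg: "\<And>p. \<not> nondegenerate_at \<A> P p (span {I p, J p})" "\<And>p. \<not> nondegenerate_at \<A> P p (span {I p, K p})"
  shows "para_quaternionic \<A> P"
proof -
  note I = eps_complexD[OF I] and J = eps_complexD[OF J] and K = eps_complexD[OF K]
  have II: "I p (I p v) = v" and JJ: "J p (J p v) = v" and KK: "K p (K p v) = v" if "v \<in> TS p" for p v
    using I(2)[OF that] J(2)[OF that] K(2)[OF that] by simp_all
  obtain x where x: "x \<in> SF" "\<And>p v. v \<in> TS p \<Longrightarrow> I p (J p v) + J p (I p v) = x p *\<^sub>R v"
    using anticommutator_SF[OF I(1) J(1)] by blast
  obtain y where y: "y \<in> SF" "\<And>p v. v \<in> TS p \<Longrightarrow> I p (K p v) + K p (I p v) = y p *\<^sub>R v"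
    using anticommutator_SF[OF I(1) K(1)] by blast
  have xx: "x p * x p = 4" for p by (rule degenerate_pair[OF I(1) J(1) II JJ x(2) deg(1)])
  have yy: "y p * y p = 4" for p by (rule degenerate_pair[OF I(1) K(1) II KK y(2) deg(2)])
  define \<alpha> where "\<alpha> p = 1/2 * x p" for p
  define \<beta> where "\<beta> p = 1/2 * y p" for p
  have \<alpha>: "\<alpha> \<in> SF" "\<And>p. \<alpha> p * \<alpha> p = 1" and \<beta>: "\<beta> \<in> SF" "\<And>p. \<beta> p * \<beta> p = 1"
    using xx yy x(1) y(1) SF_cmult[of x "1/2"] SF_cmult[of y "1/2"] by (auto simp: \<alpha>_def[abs_def] \<beta>_def[abs_def])
  define N where "N = J - escale \<alpha> I"
  define L where "L = K - escale \<beta> I"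
  have N: "N \<in> PF" and L: "L \<in> PF"
    unfolding N_def L_def by (intro PF_ops I J K \<alpha> \<beta>)+
  note TE = TE_simps[OF P_TE[OF PF_P[OF I(1)]]] TE_simps[OF P_TE[OF PF_P[OF J(1)]]]
    TE_simps[OF P_TE[OF PF_P[OF K(1)]]]
  have J_I: "J p (I p v) = (2 * \<alpha> p) *\<^sub>R v - I p (J p v)" if "v \<in> TS p" for p v
    using x(2)[OF that] by (simp add: algebra_simps \<alpha>_def)
  have K_I: "K p (I p v) = (2 * \<beta> p) *\<^sub>R v - I p (K p v)" if "v \<in> TS p" for p v
    using y(2)[OF that] by (simp add: algebra_simps \<beta>_def)
  have N_v: "N p v = J p v - \<alpha> p *\<^sub>R I p v" and L_v: "L p v = K p v - \<beta> p *\<^sub>R I p v" for p v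
    by (simp_all add: N_def L_def escale_def)
  have NI: "N p (I p v) = - I p (N p v)" and NN: "N p (N p v) = 0" if "v \<in> TS p" for p v
    using that \<alpha>(2)[of p] by (simp_all add: N_v TE II JJ J_I) (simp_all add: fun_eq_iff algebra_simps)
  have LI: "L p (I p v) = - I p (L p v)" if "v \<in> TS p" for p v
    using that by (simp add: L_v TE II KK K_I) (simp add: fun_eq_iff algebra_simps)
  have N0: "N p \<noteq> 0" for p
  proof
    assume "N p = 0"
    then have "J p = \<alpha> p *\<^sub>R I p" by (simp add: N_def escale_def)
    from proportional_units[OF PF_P[OF I(1)] I(2,3) PF_P[OF J(1)] J(2,3) this] ind(1)[of p]
    show False by blast
  qed
  have L0: "L p \<noteq> 0" for p
  proof
    assume "L p = 0"
    then have "K p = \<beta> p *\<^sub>R I p" by (simp add: L_def escale_def)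
    from proportional_units[OF PF_P[OF I(1)] I(2,3) PF_P[OF K(1)] K(2,3) this] ind(2)[of p]
    show False by blast
  qed
  have "\<exists>s. s \<noteq> 0 \<and> L p = s *\<^sub>R N p" for p
  proof -
    obtain c1 c2 c3 where c: "(c1, c2, c3) \<noteq> (0, 0, 0)" "c1 *\<^sub>R I p + c2 *\<^sub>R J p + c3 *\<^sub>R K p = 0"
      using dep[of p] by blast
    define d where "d = c1 + c2 * \<alpha> p + c3 * \<beta> p"
    have e: "d *\<^sub>R I p + c2 *\<^sub>R N p + c3 *\<^sub>R L p = 0"
      using c(2) by (simp add: N_def L_def escale_def d_def algebra_simps)
    \<comment> \<open>\<open>N\<close> and \<open>L\<close> anticommute with \<open>I\<close>, so
      composing the relation with \<open>I\<close> on the left and on the right and adding isolates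
      d.\<close>
    have d: "d = 0"
    proof (rule scalar_unique[of p])
      fix v assume v: "v \<in> TS p"
      have z: "d *\<^sub>R I p w + c2 *\<^sub>R N p w + c3 *\<^sub>R L p w = 0" for w
        using fun_cong[OF e, of w] by simp
      have w: "I p v \<in> TS p" "N p v \<in> TS p" "L p v \<in> TS p"
        using v P_TE[OF PF_P[OF I(1)]] P_TE[OF PF_P[OF N]] P_TE[OF PF_P[OF L]] TE_closed by blast+
      have "I p (d *\<^sub>R I p v + c2 *\<^sub>R N p v + c3 *\<^sub>R L p v) = 0"
        unfolding z by (simp add: TE)
      then have "d *\<^sub>R v + c2 *\<^sub>R I p (N p v) + c3 *\<^sub>R I p (L p v) = 0"
        using w v by (simp add: TE II)
      moreover have "d *\<^sub>R v - c2 *\<^sub>R I p (N p v) - c3 *\<^sub>R I p (L p v) = 0"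
        using z[of "I p v"] v by (simp add: II NI LI)
      moreover have "2 *\<^sub>R u = (u + a + b) + (u - a - b)" for u a b :: "'a tvec"
        by (simp add: fun_eq_iff)
      ultimately have "2 *\<^sub>R (d *\<^sub>R v) = 0" by (metis add_0)
      then show "d *\<^sub>R v = 0 *\<^sub>R v" by simp
    qed
    have e': "c2 *\<^sub>R N p + c3 *\<^sub>R L p = 0" using e d by simp
    have "c3 \<noteq> 0"
    proof
      assume "c3 = 0"
      then have "c2 = 0" using e' N0[of p] by simp
      then show False using \<open>c3 = 0\<close> d c(1) by (simp add: d_def)
    qed
    have "c3 *\<^sub>R L p = - (c2 *\<^sub>R N p)" using e' by (simp add: add_eq_0_iff)
    then have "inverse c3 *\<^sub>R (c3 *\<^sub>R L p) = inverse c3 *\<^sub>R (- (c2 *\<^sub>R N p))" by simp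
    then have l: "L p = (- (inverse c3 * c2)) *\<^sub>R N p" using \<open>c3 \<noteq> 0\<close> by simp
    moreover have "- (inverse c3 * c2) \<noteq> 0" using l L0[of p] by auto
    ultimately show ?thesis by blast
  qed
  then obtain s where s: "\<And>p. s p \<noteq> 0" "\<And>p. L p = s p *\<^sub>R N p" by metis
  obtain \<sigma> M where \<sigma>: "\<sigma> \<in> SF" "\<forall>p. \<sigma> p * \<sigma> p = 1" and M: "M \<in> PF"
    and m: "\<forall>p. \<forall>v\<in>TS p. I p (N p v) = \<sigma> p *\<^sub>R N p v \<and> I p (M p v) = - \<sigma> p *\<^sub>R M p v \<and>
      M p (I p v) = - I p (M p v) \<and> N p (M p v) + M p (N p v) = v \<and> M p (M p v) = 0"
    using null_section_triple[OF I(1) N II NI NN N0] by metis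
  have IN: "I p (N p v) = \<sigma> p *\<^sub>R N p v" and IM: "I p (M p v) = - \<sigma> p *\<^sub>R M p v"
    and MI: "M p (I p v) = - I p (M p v)" and NM: "N p (M p v) + M p (N p v) = v" and MM: "M p (M p v) = 0"
    if "v \<in> TS p" for p v
    using m that by blast+
  \<comment> \<open>The factor \<open>s\<close> was chosen pointwise. Since \<open>M\<close> pairs
    to 1 with \<open>N\<close>, its pairing with L = s N recovers \<open>s\<close> as the scalar of
    an anticommutator, which is smooth.\<close>
  obtain s' where s': "s' \<in> SF" "\<And>p v. v \<in> TS p \<Longrightarrow> L p (M p v) + M p (L p v) = s' p *\<^sub>R v"
    using anticommutator_SF[OF L M] by blast
  note TE' = TE_simps[OF P_TE[OF PF_P[OF N]]] TE_simps[OF P_TE[OF PF_P[OF M]]]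
  have "s = s'"
  proof
    show "s p = s' p" for p
    proof (rule scalar_unique[of p])
      fix v assume v: "v \<in> TS p"
      have *: "L p (M p v) + M p (L p v) = s p *\<^sub>R (N p (M p v) + M p (N p v))"
        using v by (simp add: s(2) TE' scaleR_add_right)
      show "s p *\<^sub>R v = s' p *\<^sub>R v"
        using trans[OF *[symmetric] s'(2)[OF v]] NM[OF v] by simp
    qed
  qed
  then have s_SF: "s \<in> SF" using s'(1) by simp
  \<comment> \<open>A^2 = N M + M N = 1, and I A = \<sigma> (N - M), so \<open>N\<close> is
    recovered as half of A + \<sigma> I A.\<close>
  define A where "A = N + M"
  have A: "A \<in> PF" unfolding A_def by (intro PF_ops N M)
  interpret quaternionic_frame \<A> P I A 1
  proof
    fix p v assume v: "v \<in> TS p"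
    show "I p (I p v) = 1 *\<^sub>R v" using II[OF v] by simp
    show "A p (I p v) = - I p (A p v)"
      using v by (simp add: A_def TE TE' NI MI)
    show "A p (A p v) = v"
      using v NM[OF v] by (simp add: A_def TE' NN MM)
  qed (use I A in auto)
  have N_eq: "N = (1/2) *\<^sub>R (A + escale \<sigma> B)"
  proof (rule EF_eqI)
    show "N p v = ((1/2) *\<^sub>R (A + escale \<sigma> B)) p v" if v: "v \<in> TS p" for p v
    proof -
      have "\<sigma> p *\<^sub>R I p (A p v) = (\<sigma> p * \<sigma> p) *\<^sub>R N p v - (\<sigma> p * \<sigma> p) *\<^sub>R M p v"
        using v by (simp add: A_def TE TE' IN IM scaleR_add_right scaleR_diff_right)
      then have "\<sigma> p *\<^sub>R I p (A p v) = N p v - M p v" using \<sigma>(2) by simp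
      then show ?thesis by (simp add: escale_def B_def ecomp_def) (simp add: A_def fun_eq_iff)
    qed
  qed (intro EF_ops PF_EF N A B_PF \<sigma>)+
  show ?thesis
  proof (rule para_quaternionic_degenerate[OF refl \<sigma>(1) _ N_eq \<alpha> \<beta> s_SF s(1) _ _ _ J(4) K(4) J(2) K(2)])
    show "\<sigma> p * \<sigma> p = 1" for p using \<sigma>(2) by blast
    show J_eq: "J = escale \<alpha> I + N" by (simp add: N_def fun_eq_iff)
    show K_eq: "K = escale \<beta> I + escale s N" using s(2) by (simp add: L_def escale_def fun_eq_iff algebra_simps)
    show "\<beta> p \<noteq> s p * \<alpha> p" for p
    proof
      assume b: "\<beta> p = s p * \<alpha> p"
      have "K p = s p *\<^sub>R J p"
        by (simp add: J_eq K_eq escale_def b scaleR_add_right)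
      from proportional_units[OF PF_P[OF J(1)] J(2,3) PF_P[OF K(1)] K(2,3) this] ind(3)[of p]
      show False by blast
    qed
  qed
qed

end

theorem theorem11:
  fixes \<A> :: "('a::{t2_space,second_countable_topology}, 'n::finite) chart set"
    and \<P> :: "'a \<Rightarrow> 'a tend set"
    and m :: nat
  assumes "smooth_atlas \<A>"
    and "CARD('n) = 4 * m" and "4 * m \<ge> 8"
    and "almost_para_quaternionic \<A> \<P>"
    and "(\<exists>I1 I2.
            (complex_structure \<A> I1 \<or> para_complex_structure \<A> I1) \<and>
            (complex_structure \<A> I2 \<or> para_complex_structure \<A> I2) \<and>
            compatible \<P> I1 \<and> compatible \<P> I2 \<and>
            independent_structures I1 I2 \<and>
            (complex_structure \<A> I1 \<or> complex_structure \<A> I2))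
       \<or> (\<exists>I1 I2.
            para_complex_structure \<A> I1 \<and> para_complex_structure \<A> I2 \<and>
            compatible \<P> I1 \<and> compatible \<P> I2 \<and>
            independent_structures I1 I2 \<and>
            (\<forall>p. nondegenerate_at \<A> \<P> p (span {I1 p, I2 p})))
       \<or> (\<exists>I1 I2 I3.
            para_complex_structure \<A> I1 \<and> para_complex_structure \<A> I2 \<and> para_complex_structure \<A> I3 \<and>
            compatible \<P> I1 \<and> compatible \<P> I2 \<and> compatible \<P> I3 \<and>
            independent_structures I1 I2 \<and> independent_structures I1 I3 \<and> independent_structures I2 I3 \<and>
            (\<forall>p. \<exists>c1 c2 c3 :: real. (c1, c2, c3) \<noteq> (0, 0, 0) \<and>
                   c1 *\<^sub>R I1 p + c2 *\<^sub>R I2 p + c3 *\<^sub>R I3 p = 0) \<and>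
            (\<forall>p. \<not> nondegenerate_at \<A> \<P> p (span {I1 p, I2 p}) \<and>
                 \<not> nondegenerate_at \<A> \<P> p (span {I1 p, I3 p}) \<and>
                 \<not> nondegenerate_at \<A> \<P> p (span {I2 p, I3 p})))"
  shows "para_quaternionic \<A> \<P>"
proof -
  interpret almost_para_quaternionic_manifold \<A> \<P>
    using assms(1,4) by unfold_locales
  have independent: "I p \<noteq> J p \<and> I p \<noteq> - J p" "J p \<noteq> I p \<and> J p \<noteq> - I p"
    if "independent_structures I J" for I J :: "'a \<Rightarrow> 'a tend" and p
    using that unfolding independent_structures_def by (metis minus_minus)+
  \<comment> \<open>The first situation is symmetric in its two structures, so the complex one may
    be put first.\<close>
  consider I1 I2 \<eta> where "complex_structure \<A> I1" "eps_complex \<A> \<eta> I2" "compatible \<P> I1" "compatible \<P> I2"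
      "\<And>p. I1 p \<noteq> I2 p \<and> I1 p \<noteq> - I2 p"
    | I1 I2 where "para_complex_structure \<A> I1" "para_complex_structure \<A> I2"
      "compatible \<P> I1" "compatible \<P> I2" "independent_structures I1 I2"
      "\<forall>p. nondegenerate_at \<A> \<P> p (span {I1 p, I2 p})"
    | I1 I2 I3 where "para_complex_structure \<A> I1" "para_complex_structure \<A> I2" "para_complex_structure \<A> I3"
      "compatible \<P> I1" "compatible \<P> I2" "compatible \<P> I3"
      "independent_structures I1 I2" "independent_structures I1 I3" "independent_structures I2 I3"
      "\<forall>p. \<exists>c1 c2 c3 :: real. (c1, c2, c3) \<noteq> (0, 0, 0) \<and>
        c1 *\<^sub>R I1 p + c2 *\<^sub>R I2 p + c3 *\<^sub>R I3 p = 0"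
      "\<forall>p. \<not> nondegenerate_at \<A> \<P> p (span {I1 p, I2 p})"
      "\<forall>p. \<not> nondegenerate_at \<A> \<P> p (span {I1 p, I3 p})"
    using assms(5) independent by (elim disjE exE conjE) metis+
  then show ?thesis
  proof cases
    case 1
    then show ?thesis using complex_case by blast
  next
    case 2
    then show ?thesis using nondegenerate_para_complex_case[OF 2(1,3,2,4)] independent(1) by blast
  next
    case 3
    show ?thesis
      by (rule degenerate_para_complex_case[OF 3(1,4,2,5,3,6)])
        (use 3 independent(1) in blast)+
  qed
qed

end
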